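(* Let $n\ge 2$, $m\in\mathbb{Z}_{>0}$ and $q\in(-1,1)$. Then for every $f\in\mathbb{P}^{(2m-1,n)}_{\texttt{a}}$, \[ \frac{1}{(2\pi)^{n-1}n^{1/2}}\int_{\mathbb{A}^{(n)}_{\texttt{a}}} f(\boldsymbol{\xi})\,|C_{\texttt{a}}(\boldsymbol{\xi};q)|^{-2}\,\mathrm{d}\boldsymbol{\xi} =\sum_{\lambda\in\Lambda^{(m,n)}_{\texttt{a}}} f\bigl(\boldsymbol{\xi}^{(m,n)}_{\texttt{a};\lambda}\bigr)\,\hat{\Delta}^{(m,n)}_{\texttt{a};\lambda}, \] where the Christoffel weights are \[ \hat{\Delta}^{(m,n)}_{\texttt{a};\lambda}:=\Bigl(\sum_{\mu\in\Lambda^{(m,n)}_{\texttt{a}}}\bigl|P_{\texttt{a};\mu}(\boldsymbol{\xi}^{(m,n)}_{\texttt{a};\lambda};q)\bigr|^2\,\delta^{(m,n)}_{\texttt{a};\mu}(q)\Bigr)^{-1}. \]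
   Context: Let $e_1,\dots,e_n$ be the standard basis of $\mathbb{R}^n$. Let $\mathbb{R}^n_0=\{\boldsymbol{\xi}\in\mathbb{R}^n:\xi_1+\dots+\xi_n=0\}$, equipped with the Lebesgue measure $\mathrm{d}\boldsymbol{\xi}$ given by the standard $(n-1)$-dimensional Euclidean volume, and let $\mathbb{A}^{(n)}_{\texttt{a}}=\{\boldsymbol{\xi}\in\mathbb{R}^n_0:\xi_1>\xi_2>\dots>\xi_n>\xi_1-2\pi\}$. Let $\omega_j=e_1+\dots+e_j-\frac{j}{n}(e_1+\dots+e_n)$ ($j=1,\dots,n-1$) and, for an integer $D\ge0$, $\Lambda^{(D,n)}_{\texttt{a}}=\{l_1\omega_1+\dots+l_{n-1}\omega_{n-1}: l_j\in\mathbb{Z}_{\ge0},\ l_1+\dots+l_{n-1}\le D\}$. For $\mu$ in the $\mathbb{Z}$-span of $\omega_1,\dots,\omega_{n-1}$, define $C_{\texttt{a}}(\boldsymbol{\xi};q)=\prod_{1\le j<k\le n}\frac{1-qe^{-i(\xi_j-\xi_k)}}{1-e^{-i(\xi_j-\xi_k)}}$ and the Hall-Littlewood polynomial $P_{\texttt{a};\mu}(\boldsymbol{\xi};q)=\sum_{\sigma\in S_n}C_{\texttt{a}}(\xi_{\sigma_1},\dots,\xi_{\sigma_n};q)\exp(i\xi_{\sigma_1}\mu_1+\dots+i\xi_{\sigma_n}\mu_n)$ (a symmetric trigonometric polynomial). Define $\delta^{(m,n)}_{\texttt{a};\mu}(q)=\prod_{1\le j<k\le n,\ \mu_j-\mu_k=0}\frac{1-q^{k-j}}{1-q^{1+k-j}}\prod_{1\le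 j<k\le n,\ \mu_j-\mu_k=m}\frac{1-q^{n-k+j}}{1-q^{n+1-k+j}}$. Let $u_q(\theta)=\frac{1-q^2}{1-2q\cos\theta+q^2}$, $v_q(\vartheta)=\int_0^\vartheta u_q(\theta)\,\mathrm{d}\theta$, and $\varrho_{\texttt{a};j}=\frac12(n+1-2j)$. For $\lambda\in\Lambda^{(m,n)}_{\texttt{a}}$ the node $\boldsymbol{\xi}^{(m,n)}_{\texttt{a};\lambda}\in\mathbb{R}^n$ is the unique global minimizer of the strictly convex function $V(\boldsymbol{\xi})=\sum_{1\le j<k\le n}\int_0^{\xi_j-\xi_k}v_q(\vartheta)\,\mathrm{d}\vartheta+\sum_{j=1}^n\bigl(\frac m2\xi_j^2-2\pi(\varrho_{\texttt{a};j}+\lambda_j)\xi_j\bigr)$, equivalently the unique solution of $m\xi_j+\sum_{k\ne j}v_q(\xi_j-\xi_k)=2\pi(\lambda_j+\varrho_{\texttt{a};j})$, $j=1,\dots,n$ (it lies in $\mathbb{A}^{(n)}_{\texttt{a}}$). For $D\ge0$, $\mathbb{P}^{(D,n)}_{\texttt{a}}$ is the linear span of the symmetric monomials $M_{\texttt{a};\mu}(\boldsymbol{\xi})=\sum_{\nu}\exp(i\nu_1\xi_1+\dots+i\nu_n\xi_n)$, $\mu\in\Lambda^{(D,n)}_{\texttt{a}}$, where $\nu$ runs over the distinct permutations of $(\mu_1,\dots,\mu_n)$. *)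

theory Defs
  imports "HOL-Analysis.Analysis" "HOL-Combinatorics.Permutations"
begin

definition vecs :: "nat \<Rightarrow> (nat \<Rightarrow> real) set" where
  "vecs n = {x. \<forall>k. k \<notin> {1..n} \<longrightarrow> x k = 0}"

definition omega :: "nat \<Rightarrow> nat \<Rightarrow> nat \<Rightarrow> real" where
  "omega n j = (\<lambda>k. if k \<in> {1..n} then (if k \<le> j then 1 else 0) - real j / real n else 0)"

definition Lam :: "nat \<Rightarrow> nat \<Rightarrow> (nat \<Rightarrow> real) set" where
  "Lam D n = {(\<lambda>k. \<Sum>j\<in>{1..n-1}. real (l j) * omega n j k) | l :: nat \<Rightarrow> nat.
                 (\<Sum>j\<in>{1..n-1}. l j) \<le> D}"

definition alcove :: "nat \<Rightarrow> (nat \<Rightarrow> real) set" where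
  "alcove n = {x \<in> vecs n. (\<Sum>j\<in>{1..n}. x j) = 0 \<and>
                (\<forall>j\<in>{1..n-1}. x j > x (Suc j)) \<and> x n > x 1 - 2 * pi}"

definition Ca :: "nat \<Rightarrow> real \<Rightarrow> (nat \<Rightarrow> real) \<Rightarrow> complex" where
  "Ca n q x = (\<Prod>j\<in>{1..n}. \<Prod>k\<in>{j<..n}.
      (1 - complex_of_real q * exp (- \<i> * complex_of_real (x j - x k))) /
      (1 - exp (- \<i> * complex_of_real (x j - x k))))"

definition HL :: "nat \<Rightarrow> real \<Rightarrow> (nat \<Rightarrow> real) \<Rightarrow> (nat \<Rightarrow> real) \<Rightarrow> complex" where
  "HL n q mu x = (\<Sum>\<sigma>\<in>{\<sigma>. \<sigma> permutes {1..n}}.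
      Ca n q (x \<circ> \<sigma>) * exp (\<i> * complex_of_real (\<Sum>k\<in>{1..n}. x (\<sigma> k) * mu k)))"

definition Msym :: "nat \<Rightarrow> (nat \<Rightarrow> real) \<Rightarrow> (nat \<Rightarrow> real) \<Rightarrow> complex" where
  "Msym n mu x = (\<Sum>\<nu>\<in>{mu \<circ> \<sigma> | \<sigma>. \<sigma> permutes {1..n}}.
      exp (\<i> * complex_of_real (\<Sum>k\<in>{1..n}. \<nu> k * x k)))"

definition delta :: "nat \<Rightarrow> nat \<Rightarrow> real \<Rightarrow> (nat \<Rightarrow> real) \<Rightarrow> real" where
  "delta m n q mu =
     (\<Prod>j\<in>{1..n}. \<Prod>k\<in>{k\<in>{j<..n}. mu j - mu k = 0}.
        (1 - q ^ (k - j)) / (1 - q ^ (1 + k - j))) *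
     (\<Prod>j\<in>{1..n}. \<Prod>k\<in>{k\<in>{j<..n}. mu j - mu k = real m}.
        (1 - q ^ (n - k + j)) / (1 - q ^ (n + 1 - k + j)))"

definition uq :: "real \<Rightarrow> real \<Rightarrow> real" where
  "uq q \<theta> = (1 - q\<^sup>2) / (1 - 2 * q * cos \<theta> + q\<^sup>2)"

definition vq :: "real \<Rightarrow> real \<Rightarrow> real" where
  "vq q t = (LBINT \<theta>=ereal 0..ereal t. uq q \<theta>)"

definition rho :: "nat \<Rightarrow> nat \<Rightarrow> real" where
  "rho n j = (real n + 1 - 2 * real j) / 2"

text \<open>Node xi^(m,n)_{a;lambda}: the unique solution of the critical point equations
  of the strictly convex function V.\<close>
definition node :: "nat \<Rightarrow> nat \<Rightarrow> real \<Rightarrow> (nat \<Rightarrow> real) \<Rightarrow> (nat \<Rightarrow> real)" where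
  "node m n q lam = (THE x. x \<in> vecs n \<and>
     (\<forall>j\<in>{1..n}. real m * x j + (\<Sum>k\<in>{1..n} - {j}. vq q (x j - x k))
                    = 2 * pi * (lam j + rho n j)))"

definition chris :: "nat \<Rightarrow> nat \<Rightarrow> real \<Rightarrow> (nat \<Rightarrow> real) \<Rightarrow> real" where
  "chris m n q lam = inverse (\<Sum>mu\<in>Lam m n.
      (cmod (HL n q mu (node m n q lam)))\<^sup>2 * delta m n q mu)"

text \<open>Parametrisation of R^n_0 by R^{n-1}: (x_1..x_{n-1}) |-> (x_1,..,x_{n-1}, -sum x).
  Its Jacobian factor (square root of the Gram determinant) is sqrt n, so the
  (n-1)-dimensional Euclidean volume on R^n_0 is sqrt n times the pushforward of
  Lebesgue measure on R^{n-1}.\<close>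
definition emb :: "nat \<Rightarrow> (nat \<Rightarrow> real) \<Rightarrow> (nat \<Rightarrow> real)" where
  "emb n y = (\<lambda>k. if k \<in> {1..n-1} then y k
                   else if k = n then - (\<Sum>j\<in>{1..n-1}. y j) else 0)"

definition hyp_integral :: "nat \<Rightarrow> ((nat \<Rightarrow> real) \<Rightarrow> complex) \<Rightarrow> complex" where
  "hyp_integral n g = complex_of_real (sqrt (real n)) *
      (\<integral>y. g (emb n y) \<partial>(PiM {1..n-1} (\<lambda>_. lborel)))"

end

theory Submission
  imports Defs "HOL-Complex_Analysis.Cauchy_Integral_Formula" "HOL-Combinatorics.Multiset_Permutations"
    "Jordan_Normal_Form.Determinant"
begin

text \<open>Write \<open>v\<close> for \<open>v_q\<close> and \<open>G\<close> for the gradient map \<open>G_j(x) = m x_j + \<Sum>k\<noteq>j. v(x_j - x_k)\<close>; the nodes are the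
  points of the alcove at which all \<open>G_j - G_k\<close> are multiples of \<open>2\<pi>\<close>. Since \<open>exp(i v(t)) = (z - q) / (1 - q z)\<close>
  with \<open>z = exp(i t)\<close>, both \<open>|C|^-2\<close> and \<open>P_\<mu> cnj(P_\<nu>) |C|^-2\<close> are linear combinations of unimodular monomials in
  \<open>exp(i x_j)\<close> and \<open>exp(i v(x_j - x_k))\<close>. Shifting such a monomial along an integer direction turns it into a
  function analytic in the unit disc, so its torus average is the value at the origin. In the direction \<open>k\<close> this
  shows that \<open>f |C|^-2 exp(i k.G)\<close> integrates to \<open>0\<close> for every nonzero \<open>k\<close> in the root lattice when \<open>f\<close> has
  degree below \<open>2m\<close>. Hence multiplying \<open>f |C|^-2\<close> by a nonnegative kernel in \<open>exp(i G)\<close> that concentrates on the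
  nodes does not change the integral, so the integral vanishes whenever \<open>f\<close> vanishes at the nodes: it is a linear
  combination of the values of \<open>f\<close> there, with some weights.

  The same averaging argument gives the orthogonality of the \<open>P_\<mu>\<close>, with norms given by inversion generating
  functions of Young subgroups. Cubature of \<open>P_\<mu> cnj(P_\<nu>)\<close> turns it into orthogonality on the nodes; the pairs with both
  weights of level \<open>m\<close> are reached by cyclic rotation of the weights, which at a node multiplies \<open>P_\<mu>\<close> by a phase
  independent of \<open>\<mu>\<close>. As the nodes inject into the weights of level at most \<open>m\<close>, the matrix of values
  is square with a left inverse, so it is invertible: every weight has a node, and the diagonal of the reversed product
  identifies the cubature weights with the Christoffel weights.\<close>

unbundle no m_inv_syntax \<comment> \<open>HOL-Algebra's \<open>inv\<close> would make the inverse of a permutation ambiguous\<close>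

subsection \<open>The phase function\<close>

text \<open>The bound 2m-1 comes from integrality. In direction \<open>k\<close> the shifted weight
  pairs with \<open>k\<close> to m * sum k_j^2 plus a linear term of size at most (2m-1)/2 * sum
  |k_j|. As |k_j| <= k_j^2 for integers, a positive amount is left over; at degree 2m this estimate
  leaves nothing. That is why products of two polynomials of level m need the detour through
  rotations. The mean of the kernel tends to 0 as its power N grows. The argument works because this
  decay is only polynomial in 1/N, while away from the nodes the kernel decays geometrically.
  Solvability of the node equations is not obtained by minimising the convex function: only
  uniqueness is proved directly. Until the final rank argument all statements therefore concern the
  set of nodes actually present in the alcove, and the cubature weights are unknown complex numbers.
  \<open>HL\<close> has apparent poles on the walls. It is traded for \<open>Ah\<close>, a sum of
  signed unimodular terms defined everywhere, which differs from it off the walls by a factor common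
  to all weights.\<close>

lemma uq_denom_pos:
  fixes q t :: real
  assumes "\<bar>q\<bar> < 1"
  shows "0 < 1 - 2 * q * cos t + q\<^sup>2"
proof -
  have "0 < (1 - \<bar>q\<bar>)\<^sup>2" using assms by (intro zero_less_power) simp
  also have "\<dots> = 1 - 2 * \<bar>q\<bar> + q\<^sup>2" by (simp add: power2_eq_square algebra_simps)
  also have "\<dots> \<le> 1 - 2 * q * cos t + q\<^sup>2"
  proof -
    have "q * cos t \<le> \<bar>q * cos t\<bar>" by simp
    also have "\<dots> \<le> \<bar>q\<bar> * 1" unfolding abs_mult by (intro mult_left_mono) auto
    finally show ?thesis by simp
  qed
  finally show ?thesis .
qed

lemma one_minus_q_cos_pos:
  fixes q t :: real
  assumes "\<bar>q\<bar> < 1"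
  shows "0 < 1 - q * cos t"
proof -
  have "q * cos t \<le> \<bar>q * cos t\<bar>" by simp
  also have "\<dots> \<le> \<bar>q\<bar> * 1" unfolding abs_mult by (intro mult_left_mono) auto
  finally show ?thesis using assms by simp
qed

text \<open>The closed form is t - 2 arg(1 - q exp(i t)). Since 1 - q cos t > 0, the arctan is a
  global smooth branch of the argument.\<close>

lemma vq_primitive_deriv:
  assumes "\<bar>q\<bar> < 1"
  shows "((\<lambda>t. t + 2 * arctan (q * sin t / (1 - q * cos t))) has_real_derivative uq q t) (at t)"
proof -
  have p: "1 - q * cos t \<noteq> 0" using one_minus_q_cos_pos[OF assms, of t] by simp
  have d: "1 - 2 * q * cos t + q\<^sup>2 \<noteq> 0" using uq_denom_pos[OF assms, of t] by simp
  have s: "(sin t)\<^sup>2 = 1 - (cos t)\<^sup>2" by (simp add: sin_squared_eq)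
  have e0: "(1 - q * cos t)\<^sup>2 + (q * sin t)\<^sup>2 = 1 - 2 * q * cos t + q\<^sup>2"
    unfolding power_mult_distrib s by (simp add: power2_eq_square algebra_simps)
  have e: "1 + (q * sin t / (1 - q * cos t))\<^sup>2 = (1 - 2 * q * cos t + q\<^sup>2) / (1 - q * cos t)\<^sup>2"
    unfolding e0[symmetric] using p by (simp add: power_divide add_divide_distrib)
  have n: "q * cos t * (1 - q * cos t) - q * sin t * (q * sin t) = q * cos t - q\<^sup>2"
  proof -
    have "q * cos t * (1 - q * cos t) - q * sin t * (q * sin t) = q * cos t - q\<^sup>2 * (cos t)\<^sup>2 - q\<^sup>2 * (sin t)\<^sup>2"
      by (simp add: power2_eq_square algebra_simps)
    then show ?thesis unfolding s by (simp add: right_diff_distrib)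
  qed
  have D1: "((\<lambda>t. q * sin t / (1 - q * cos t)) has_real_derivative (q * cos t - q\<^sup>2) / (1 - q * cos t)\<^sup>2) (at t)"
  proof -
    have "((\<lambda>t. q * sin t / (1 - q * cos t)) has_real_derivative
       (q * cos t * (1 - q * cos t) - q * sin t * (q * sin t)) / ((1 - q * cos t) * (1 - q * cos t))) (at t)"
      using p by (auto intro!: derivative_eq_intros simp: algebra_simps)
    then show ?thesis unfolding n by (simp add: power2_eq_square)
  qed
  have "((\<lambda>t. t + 2 * arctan (q * sin t / (1 - q * cos t))) has_real_derivative
      1 + 2 * (inverse (1 + (q * sin t / (1 - q * cos t))\<^sup>2) * ((q * cos t - q\<^sup>2) / (1 - q * cos t)\<^sup>2))) (at t)"
    by (intro DERIV_add DERIV_ident DERIV_cmult DERIV_chain2[OF DERIV_arctan D1])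
  also have "1 + 2 * (inverse (1 + (q * sin t / (1 - q * cos t))\<^sup>2) * ((q * cos t - q\<^sup>2) / (1 - q * cos t)\<^sup>2))
     = 1 + 2 * ((q * cos t - q\<^sup>2) / (1 - 2 * q * cos t + q\<^sup>2))"
    unfolding e using p by simp
  also have "\<dots> = uq q t" unfolding uq_def using d by (simp add: field_simps)
  finally show ?thesis .
qed

lemma vq_eq:
  assumes "\<bar>q\<bar> < 1"
  shows "vq q t = t + 2 * arctan (q * sin t / (1 - q * cos t))"
proof -
  have c: "continuous_on S (uq q)" for S
    unfolding uq_def using uq_denom_pos[OF assms] 
    by (intro continuous_intros) (metis less_irrefl)
  have "vq q t = (t + 2 * arctan (q * sin t / (1 - q * cos t))) - (0 + 2 * arctan (q * sin 0 / (1 - q * cos 0)))"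
    unfolding vq_def
    apply (rule interval_integral_FTC_finite[OF c])
    using vq_primitive_deriv[OF assms]
    by (metis has_real_derivative_iff_has_vector_derivative has_vector_derivative_at_within)
  then show ?thesis by simp
qed

lemma vq_deriv:
  assumes "\<bar>q\<bar> < 1"
  shows "(vq q has_real_derivative uq q t) (at t)"
  using vq_primitive_deriv[OF assms] unfolding vq_eq[OF assms, abs_def] .

lemma vq_strict_mono:
  assumes "\<bar>q\<bar> < 1" "s < t"
  shows "vq q s < vq q t"
proof (rule DERIV_pos_imp_increasing[OF assms(2)])
  fix x
  have "q\<^sup>2 < 1" using assms(1) by (simp add: abs_square_less_1)
  then have "0 < uq q x" unfolding uq_def using uq_denom_pos[OF assms(1)] by simp
  then show "\<exists>y. (vq q has_real_derivative y) (at x) \<and> 0 < y" using vq_deriv[OF assms(1)] by blast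
qed

lemma vq_mono: "\<bar>q\<bar> < 1 \<Longrightarrow> s \<le> t \<Longrightarrow> vq q s \<le> vq q t"
  using vq_strict_mono[of q s t] by (cases "s = t") auto

lemma vq_0 [simp]: "vq q 0 = 0"
  unfolding vq_def by simp

lemma vq_minus: "\<bar>q\<bar> < 1 \<Longrightarrow> vq q (- t) = - vq q t"
  by (simp add: vq_eq arctan_minus)

text \<open>The arctan term is periodic, so only the linear term moves. Hence integer multiples of
  \<open>vq\<close> have well-defined phases on the torus.\<close>

lemma vq_add_int:
  assumes "\<bar>q\<bar> < 1"
  shows "vq q (t + 2 * pi * of_int k) = vq q t + 2 * pi * of_int k"
proof -
  have "sin (t + 2 * pi * of_int k) = sin t" "cos (t + 2 * pi * of_int k) = cos t"
    by (auto simp: sin_add cos_add) 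
  then show ?thesis by (simp add: vq_eq[OF assms])
qed

lemma continuous_on_vq [continuous_intros]:
  assumes "\<bar>q\<bar> < 1" "continuous_on S f"
  shows "continuous_on S (\<lambda>x. vq q (f x))"
proof -
  have "continuous_on UNIV (vq q)"
    using vq_deriv[OF assms(1)] by (meson DERIV_continuous_on UNIV_I has_field_derivative_at_within)
  then show ?thesis using continuous_on_compose2[OF _ assms(2)] by blast
qed

text \<open>With g the argument of the arctan, 1 - q cis(t) is (1 - q cos t)(1 - i g), so cis(2
  arctan g) is a quotient of conjugates. The result is a Blaschke factor in cis(t): holomorphic on
  the closed disc for |q| < 1, with value -q at the centre.\<close>

lemma cis_vq:
  assumes "\<bar>q\<bar> < 1"
  shows "cis (vq q t) = (cis t - of_real q) / (1 - of_real q * cis t)"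
proof -
  define g where "g = q * sin t / (1 - q * cos t)"
  have p: "1 - q * cos t > 0" using one_minus_q_cos_pos[OF assms, of t] by simp
  have nz: "1 - of_real q * cis t \<noteq> 0" "1 - of_real q * cis (-t) \<noteq> 0"
    using p by (auto simp: complex_eq_iff)
  have sq: "sqrt (1 + g\<^sup>2) ^ 2 = 1 + g\<^sup>2" by (simp add: add_nonneg_nonneg)
  have c: "cis (2 * arctan g) = (1 + \<i> * of_real g)\<^sup>2 / of_real (1 + g\<^sup>2)"
  proof -
    have "cis (2 * arctan g) = cis (arctan g) ^ 2" by (simp add: power2_eq_square cis_mult)
    also have "cis (arctan g) = (1 + \<i> * of_real g) / of_real (sqrt (1 + g\<^sup>2))"
      by (simp add: complex_eq_iff sin_arctan cos_arctan)
    finally show ?thesis using sq by (simp add: power_divide flip: of_real_power)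
  qed
  have "of_real (1 + g\<^sup>2) = (1 + \<i> * of_real g) * (1 - \<i> * complex_of_real g)"
    by (simp add: algebra_simps power2_eq_square)
  moreover have "1 + \<i> * complex_of_real g \<noteq> 0" by (simp add: complex_eq_iff)
  ultimately have c2: "cis (2 * arctan g) = (1 + \<i> * of_real g) / (1 - \<i> * of_real g)"
    unfolding c by (simp add: power2_eq_square)
  have n1: "1 - of_real q * cis (-t) = of_real (1 - q * cos t) * (1 + \<i> * of_real g)"
    and n2: "1 - of_real q * cis t = of_real (1 - q * cos t) * (1 - \<i> * of_real g)"
    using p by (auto simp: complex_eq_iff g_def)
  have c3: "cis (2 * arctan g) = (1 - of_real q * cis (-t)) / (1 - of_real q * cis t)"
    unfolding c2 n1 n2 using p by (simp del: of_real_diff of_real_mult)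
  have "cis (vq q t) = cis t * cis (2 * arctan g)"
    unfolding vq_eq[OF assms] g_def[symmetric] by (simp add: cis_mult)
  also have "\<dots> = (cis t - of_real q * (cis t * cis (-t))) / (1 - of_real q * cis t)"
    unfolding c3 by (simp add: algebra_simps)
  also have "cis t * cis (-t) = 1" by (simp add: cis_mult)
  finally show ?thesis by simp
qed

subsection \<open>Pairs of indices and the sign of a permutation\<close>

definition prs :: "nat \<Rightarrow> (nat \<times> nat) set" where
  "prs n = {(j, k). 1 \<le> j \<and> j < k \<and> k \<le> n}"

lemma prs_Sigma: "prs n = Sigma {1..n} (\<lambda>j. {j<..n})"
  by (auto simp: prs_def)

lemma finite_prs [simp, intro]: "finite (prs n)"
  unfolding prs_Sigma by auto

lemma prs_mem: "(j, k) \<in> prs n \<longleftrightarrow> 1 \<le> j \<and> j < k \<and> k \<le> n"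
  by (simp add: prs_def)

text \<open>A permutation maps unordered pairs bijectively to unordered pairs and reverses the
  orientation of the inverted ones. Working in \<open>comm_monoid_set\<close> serves the phases
  (sums) and the weight functions (products) at once.\<close>

lemma (in comm_monoid_set) pairs_reindex:
  assumes w: "w permutes {1..n}"
  shows "F (\<lambda>(i,i'). \<phi> (w i) (w i')) (prs n) =
         F (\<lambda>(j,k). if inv w j < inv w k then \<phi> j k else \<phi> k j) (prs n)"
proof (rule reindex_bij_witness[where
      i = "\<lambda>(j,k). if inv w j < inv w k then (inv w j, inv w k) else (inv w k, inv w j)" and
      j = "\<lambda>(i,i'). if w i < w i' then (w i, w i') else (w i', w i)"])
  have wi: "inv w (w i) = i" "w (inv w i) = i" for i using permutes_inverses[OF w] by auto
  have wr: "w i \<in> {1..n} \<longleftrightarrow> i \<in> {1..n}" "inv w i \<in> {1..n} \<longleftrightarrow> i \<in> {1..n}" for i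
    using permutes_in_image[OF w] permutes_in_image[OF Permutations.permutes_inv[OF w]] by auto
  have inj: "w i = w j \<longleftrightarrow> i = j" "inv w i = inv w j \<longleftrightarrow> i = j" for i j
    by (metis wi(1), metis wi(2))
  fix p assume "p \<in> prs n"
  then obtain a b where p: "p = (a, b)" "1 \<le> a" "a < b" "b \<le> n" by (auto simp: prs_def)
  have r: "1 \<le> w a" "w a \<le> n" "1 \<le> w b" "w b \<le> n" "1 \<le> inv w a" "inv w a \<le> n" "1 \<le> inv w b" "inv w b \<le> n"
    using wr[of a] wr[of b] p by auto
  have ne: "w a \<noteq> w b" "inv w a \<noteq> inv w b" using inj p by auto
  show "(case case p of (i, i') \<Rightarrow> if w i < w i' then (w i, w i') else (w i', w i) of
          (j, k) \<Rightarrow> if inv w j < inv w k then (inv w j, inv w k) else (inv w k, inv w j)) = p"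
    using p by (auto simp: wi)
  show "(case p of (i, i') \<Rightarrow> if w i < w i' then (w i, w i') else (w i', w i)) \<in> prs n"
    using p r ne by (auto simp: prs_def)
  show "(case case p of (i, i') \<Rightarrow> if w i < w i' then (w i, w i') else (w i', w i) of
          (j, k) \<Rightarrow> if inv w j < inv w k then \<phi> j k else \<phi> k j) = (case p of (i, i') \<Rightarrow> \<phi> (w i) (w i'))"
    using p by (auto simp: wi)
  show "(case case p of (j, k) \<Rightarrow> if inv w j < inv w k then (inv w j, inv w k) else (inv w k, inv w j) of
          (i, i') \<Rightarrow> if w i < w i' then (w i, w i') else (w i', w i)) = p"
    using p by (auto simp: wi)
  show "(case p of (j, k) \<Rightarrow> if inv w j < inv w k then (inv w j, inv w k) else (inv w k, inv w j)) \<in> prs n"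
    using p r ne by (auto simp: prs_def)
qed

text \<open>The sign of \<open>w\<close>, counted by inversions, because this is the form in which
  it leaves an antisymmetric product over pairs.\<close>

definition inv_sign :: "nat \<Rightarrow> (nat \<Rightarrow> nat) \<Rightarrow> real" where
  "inv_sign n w = (\<Prod>(j,k)\<in>prs n. if inv w j < inv w k then 1 else -1)"

lemma prod_antisym_reindex:
  fixes \<phi> :: "nat \<Rightarrow> nat \<Rightarrow> 'a::real_field"
  assumes w: "w permutes {1..n}" and a: "\<And>j k. \<lbrakk>j \<in> {1..n}; k \<in> {1..n}; j \<noteq> k\<rbrakk> \<Longrightarrow> \<phi> k j = - \<phi> j k"
  shows "(\<Prod>(i,i')\<in>prs n. \<phi> (w i) (w i')) = of_real (inv_sign n w) * (\<Prod>(j,k)\<in>prs n. \<phi> j k)"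
proof -
  have "(\<Prod>(i,i')\<in>prs n. \<phi> (w i) (w i')) = (\<Prod>(j,k)\<in>prs n. if inv w j < inv w k then \<phi> j k else \<phi> k j)"
    by (rule prod.pairs_reindex[OF w])
  also have "\<dots> = (\<Prod>(j,k)\<in>prs n. of_real (if inv w j < inv w k then 1 else -1) * \<phi> j k)"
    by (intro prod.cong) (auto simp: prs_def intro!: a)
  also have "\<dots> = of_real (inv_sign n w) * (\<Prod>(j,k)\<in>prs n. \<phi> j k)"
    by (simp add: inv_sign_def case_prod_beta' prod.distrib of_real_prod)
  finally show ?thesis .
qed

text \<open>Permuting the variables of a Vandermonde product produces the sign as a factor; the
  product does not vanish at the identity, so the factors can be compared.\<close>

lemma inv_sign_compose:
  assumes "v permutes {1..n}" "w permutes {1..n}"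
  shows "inv_sign n (v \<circ> w) = inv_sign n v * inv_sign n w"
proof -
  define V where "V = (\<lambda>x :: nat \<Rightarrow> nat. \<Prod>(i,i')\<in>prs n. (real (x i') - real (x i)))"
  have vw: "v \<circ> w permutes {1..n}" using assms permutes_compose by blast
  have *: "V (x \<circ> u) = inv_sign n u * V x" if "u permutes {1..n}" for x u
    using prod_antisym_reindex[OF that, of "\<lambda>i i'. real (x i') - real (x i)"] by (simp add: V_def)
  have "V id \<noteq> 0" unfolding V_def by (auto simp: prs_mem prod_zero_iff)
  moreover have "V (v \<circ> w) = inv_sign n (v \<circ> w) * V id" using *[OF vw, of id] by simp
  moreover have "V (v \<circ> w) = inv_sign n w * (inv_sign n v * V id)"
    using *[OF assms(2), of v] *[OF assms(1), of id] by simp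
  ultimately show ?thesis by (simp add: mult.commute)
qed

lemma inv_sign_id [simp]: "inv_sign n id = 1"
  by (auto simp: inv_sign_def prs_def intro!: prod.neutral)

lemma inv_sign_cases: "inv_sign n w = 1 \<or> inv_sign n w = -1"
proof -
  have "\<bar>inv_sign n w\<bar> = 1" unfolding inv_sign_def abs_prod
    by (intro prod.neutral) auto
  then show ?thesis by linarith
qed

lemma inv_sign_square [simp]: "inv_sign n w * inv_sign n w = 1"
  using inv_sign_cases[of n w] by auto

lemma inv_sign_transpose:
  assumes "a \<in> {1..n}" "b \<in> {1..n}" "a \<noteq> b"
  shows "inv_sign n (Transposition.transpose a b) = -1"
proof -
  have main: "inv_sign n (Transposition.transpose a b) = -1" if "a < b" "1 \<le> a" "b \<le> n" for a b
  proof -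
    let ?t = "Transposition.transpose a b"
    let ?f = "\<lambda>(j,k). if inv ?t j < inv ?t k then 1 else (-1::real)"
    \<comment> \<open>Contains all inverted pairs: (a,b), and for each c strictly between also (a,c)
      and (c,b), whose two signs cancel.\<close>
    let ?S = "insert (a,b) ((\<lambda>c. (a,c)) ` {a<..<b} \<union> (\<lambda>c. (c,b)) ` {a<..<b})"
    have t: "?t j = (if j = a then b else if j = b then a else j)" for j
      by (simp add: Transposition.transpose_def)
    have "inv_sign n ?t = prod ?f (prs n)" by (simp add: inv_sign_def)
    also have "\<dots> = prod ?f ?S"
    proof (rule prod.mono_neutral_right)
      show "?S \<subseteq> prs n" using that by (auto simp: prs_def)
      have "?f (j, k) = 1" if "(j, k) \<in> prs n - ?S" for j k
      proof -
        have "j < k" "(j, k) \<noteq> (a, b)" "\<not> (j = a \<and> a < k \<and> k < b)" "\<not> (k = b \<and> a < j \<and> j < b)"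
          using that by (auto simp: prs_def)
        then show ?thesis using \<open>a < b\<close> unfolding case_prod_conv inv_transpose_eq t by auto
      qed
      then show "\<forall>p\<in>prs n - ?S. ?f p = 1" by auto
    qed simp
    also have "\<dots> = ?f (a, b) * (prod ?f ((\<lambda>c. (a,c)) ` {a<..<b}) * prod ?f ((\<lambda>c. (c,b)) ` {a<..<b}))"
      by (subst prod.insert, simp, force, subst prod.union_disjoint) auto
    also have "?f (a, b) = -1"
      unfolding case_prod_conv inv_transpose_eq t using \<open>a < b\<close> by simp
    also have "prod ?f ((\<lambda>c. (a,c)) ` {a<..<b}) = (\<Prod>c\<in>{a<..<b}. -1)"
      by (subst prod.reindex) (auto simp: inj_on_def inv_transpose_eq t intro!: prod.cong)
    also have "prod ?f ((\<lambda>c. (c,b)) ` {a<..<b}) = (\<Prod>c\<in>{a<..<b}. -1)"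
      by (subst prod.reindex) (auto simp: inj_on_def inv_transpose_eq t intro!: prod.cong)
    finally show ?thesis by (simp flip: power_mult_distrib)
  qed
  show ?thesis
    using main[of a b] main[of b a] assms by (cases "a < b") (auto simp: Transposition.transpose_commute)
qed

subsection \<open>Integration over the torus\<close>

text \<open>The periods, in units of 2 pi, of the torus on which all integrands live.\<close>

definition root_lattice :: "nat \<Rightarrow> (nat \<Rightarrow> int) set" where
  "root_lattice n = {k. (\<forall>i. i \<notin> {1..n} \<longrightarrow> k i = 0) \<and> (\<Sum>i\<in>{1..n}. k i) = 0}"

text \<open>Boundedness and Borel measurability, rather than integrability, pass to products,
  translates and restrictions to coordinate circles without further conditions.\<close>

definition torusfun :: "nat \<Rightarrow> ((nat \<Rightarrow> real) \<Rightarrow> complex) \<Rightarrow> bool" where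
  "torusfun n F \<longleftrightarrow> F \<in> borel_measurable borel \<and> (\<exists>B. \<forall>x. norm (F x) \<le> B) \<and>
     (\<forall>x. \<forall>k\<in>root_lattice n. F (\<lambda>i. x i + 2 * pi * of_int (k i)) = F x)"

definition lebs :: "nat \<Rightarrow> (nat \<Rightarrow> real) measure" where
  "lebs n = PiM {1..n-1} (\<lambda>_. lborel)"

definition tbox :: "nat \<Rightarrow> (nat \<Rightarrow> real) set" where
  "tbox n = PiE {1..n-1} (\<lambda>_. {0..<2*pi})"

text \<open>In the first n-1 coordinates the box is a fundamental domain for the translations by 2
  pi times \<open>root_lattice n\<close>. The factor sqrt n of \<open>hyp_integral\<close> is left
  out.\<close>

definition tint :: "nat \<Rightarrow> ((nat \<Rightarrow> real) \<Rightarrow> complex) \<Rightarrow> complex" where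
  "tint n F = (\<integral>y. indicator (tbox n) y *\<^sub>R F (emb n y) \<partial>lebs n)"

section \<open>Measurability, integrability and linearity of the torus integral\<close>

lemma measurable_emb [measurable]: "emb n \<in> borel_measurable (lebs n)"
proof (rule measurable_coordinatewise_then_product)
  fix k
  consider "k \<in> {1..n-1}" | "k \<notin> {1..n-1}" "k = n" | "k \<notin> {1..n-1}" "k \<noteq> n" by blast
  then show "(\<lambda>y. emb n y k) \<in> borel_measurable (lebs n)"
    unfolding lebs_def by cases (simp_all only: emb_def if_True if_False refl, measurable)
qed

lemma measurable_coord_fun:
  fixes \<phi> :: "'a \<Rightarrow> nat \<Rightarrow> real"
  assumes "\<And>i. (\<lambda>x. \<phi> x i) \<in> borel_measurable M" "F \<in> borel_measurable borel"
  shows "(\<lambda>x. F (\<phi> x)) \<in> borel_measurable M"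
  using measurable_compose[OF measurable_coordinatewise_then_product[OF assms(1)] assms(2)] .

lemma sets_tbox [measurable, simp]: "tbox n \<in> sets (lebs n)"
  unfolding tbox_def lebs_def by (rule sets_PiM_I_finite) auto

interpretation lborels: product_sigma_finite "\<lambda>_::nat. lborel :: real measure"
  by standard

lemma emeasure_tbox: "emeasure (lebs n) (tbox n) = ennreal ((2 * pi) ^ (n - 1))"
proof -
  have "emeasure (lebs n) (tbox n) = (\<Prod>i\<in>{1..n-1}. emeasure lborel {0..<2*pi})"
    unfolding tbox_def lebs_def by (rule lborels.emeasure_PiM) auto
  also have "\<dots> = ennreal (2 * pi) ^ (n - 1)" by simp
  also have "\<dots> = ennreal ((2 * pi) ^ (n - 1))" by (rule ennreal_power) simp
  finally show ?thesis .
qed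

lemma measure_tbox: "measure (lebs n) (tbox n) = (2 * pi) ^ (n - 1)"
  by (simp add: measure_def emeasure_tbox)

lemma integrable_tbox:
  fixes f :: "(nat \<Rightarrow> real) \<Rightarrow> 'a::{banach, second_countable_topology}"
  assumes "f \<in> borel_measurable (lebs n)" "\<And>y. norm (f y) \<le> B"
  shows "integrable (lebs n) (\<lambda>y. indicator (tbox n) y *\<^sub>R f y)"
  by (rule integrableI_bounded_set_indicator[where B = B])
     (use assms in \<open>auto simp: emeasure_tbox\<close>)

lemma integrable_tint:
  fixes F :: "(nat \<Rightarrow> real) \<Rightarrow> 'a::{banach, second_countable_topology}"
  assumes "F \<in> borel_measurable borel" "\<And>y. norm (F y) \<le> B"
  shows "integrable (lebs n) (\<lambda>y. indicator (tbox n) y *\<^sub>R F (emb n y))"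
  by (rule integrable_tbox) (use assms in auto)

lemma torusfunD:
  assumes "torusfun n F"
  shows "F \<in> borel_measurable borel" "\<exists>B. \<forall>x. norm (F x) \<le> B"
    "k \<in> root_lattice n \<Longrightarrow> F (\<lambda>i. x i + 2 * pi * of_int (k i)) = F x"
  using assms by (auto simp: torusfun_def)

lemma integrable_torusfun:
  assumes "torusfun n F"
  shows "integrable (lebs n) (\<lambda>y. indicator (tbox n) y *\<^sub>R F (emb n y))"
proof -
  obtain B where "\<And>x. norm (F x) \<le> B" using torusfunD(2)[OF assms] by auto
  from integrable_tint[OF torusfunD(1)[OF assms] this] show ?thesis .
qed

lemma torusfun_add: 
  assumes "torusfun n F" "torusfun n G" shows "torusfun n (\<lambda>x. F x + G x)"
proof -
  obtain B C where "\<And>x. norm (F x) \<le> B" "\<And>x. norm (G x) \<le> C" using assms by (auto simp: torusfun_def)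
  then have "norm (F x + G x) \<le> B + C" for x by (meson add_mono norm_triangle_le)
  then show ?thesis using assms unfolding torusfun_def by auto
qed

lemma torusfun_mult: 
  assumes "torusfun n F" "torusfun n G" shows "torusfun n (\<lambda>x. F x * G x)"
proof -
  obtain B C where "\<And>x. norm (F x) \<le> B" "\<And>x. norm (G x) \<le> C" using assms by (auto simp: torusfun_def)
  then have "norm (F x * G x) \<le> B * C" for x unfolding norm_mult
    by (intro mult_mono) (auto intro: order_trans[OF norm_ge_zero])
  then show ?thesis using assms unfolding torusfun_def by auto
qed

lemma torusfun_const [intro]: "torusfun n (\<lambda>x. c)"
  by (auto simp: torusfun_def)

lemma torusfun_sum: "(\<And>a. a \<in> A \<Longrightarrow> torusfun n (F a)) \<Longrightarrow> torusfun n (\<lambda>x. \<Sum>a\<in>A. F a x)"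
  by (induction A rule: infinite_finite_induct) (auto intro: torusfun_add)

lemma tint_add: "torusfun n F \<Longrightarrow> torusfun n G \<Longrightarrow> tint n (\<lambda>x. F x + G x) = tint n F + tint n G"
  unfolding tint_def scaleR_add_right by (rule Bochner_Integration.integral_add; rule integrable_torusfun)

lemma tint_cmult: "tint n (\<lambda>x. c * F x) = c * tint n F"
  unfolding tint_def by (simp flip: mult_scaleR_right)

lemma tint_0 [simp]: "tint n (\<lambda>x. 0) = 0"
  unfolding tint_def by simp

lemma tint_sum: "(\<And>a. a \<in> A \<Longrightarrow> torusfun n (F a)) \<Longrightarrow> tint n (\<lambda>x. \<Sum>a\<in>A. F a x) = (\<Sum>a\<in>A. tint n (F a))"
  by (induction A rule: infinite_finite_induct) (auto simp: tint_add torusfun_sum)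

lemma tint_const:
  fixes c :: complex
  shows "tint n (\<lambda>x. c) = (2 * pi) ^ (n - 1) * c"
proof -
  have "tbox n \<inter> space (lebs n) = tbox n" using sets.sets_into_space[OF sets_tbox] by blast
  then show ?thesis
    unfolding tint_def
    by (simp add: measure_tbox emeasure_tbox scaleR_conv_of_real del: One_nat_def)
qed

lemma tint_cnj: "tint n (\<lambda>x. cnj (F x)) = cnj (tint n F)"
  unfolding tint_def by (subst Bochner_Integration.integral_cnj[symmetric]) simp

lemma torusfun_shift:
  assumes "torusfun n F" shows "torusfun n (\<lambda>x. F (\<lambda>i. x i + a i))"
proof -
  have "F (\<lambda>i. x i + 2 * pi * of_int (k i) + a i) = F (\<lambda>i. x i + a i)" if "k \<in> root_lattice n" for x k
    using torusfunD(3)[OF assms that, of "\<lambda>i. x i + a i"] by (simp add: algebra_simps)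
  moreover have "(\<lambda>x. F (\<lambda>i. x i + a i)) \<in> borel_measurable borel"
    by (rule measurable_coord_fun[OF _ torusfunD(1)[OF assms]]) simp
  ultimately show ?thesis using torusfunD(2)[OF assms] unfolding torusfun_def by blast
qed

lemma torusfun_perm:
  assumes "torusfun n F" "\<sigma> permutes {1..n}" shows "torusfun n (\<lambda>x. F (x \<circ> \<sigma>))"
proof -
  have "F ((\<lambda>i. x i + 2 * pi * of_int (k i)) \<circ> \<sigma>) = F (x \<circ> \<sigma>)" if k: "k \<in> root_lattice n" for x k
  proof -
    have "(\<Sum>i\<in>{1..n}. k (\<sigma> i)) = (\<Sum>i\<in>{1..n}. k i)" using sum.permute[OF assms(2), of k] by (simp add: o_def)
    then have "k \<circ> \<sigma> \<in> root_lattice n"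
      using k assms(2) by (auto simp: root_lattice_def permutes_not_in)
    from torusfunD(3)[OF assms(1) this, of "x \<circ> \<sigma>"] show ?thesis by (simp add: o_def)
  qed
  moreover have "(\<lambda>x. F (x \<circ> \<sigma>)) \<in> borel_measurable borel"
    by (rule measurable_coord_fun[OF _ torusfunD(1)[OF assms(1)]]) simp
  ultimately show ?thesis using torusfunD(2)[OF assms(1)] unfolding torusfun_def by blast
qed

section \<open>Invariance of the torus integral under translations and permutations\<close>

lemma periodic_integral_shift:
  fixes g :: "real \<Rightarrow> complex"
  assumes g: "g \<in> borel_measurable borel" "\<And>t. norm (g t) \<le> B"
    and per: "\<And>t (p::int). g (t + 2 * pi * of_int p) = g t"
  shows "(\<integral>t. indicator {0..<2*pi} t *\<^sub>R g (c + t) \<partial>lborel) = (\<integral>t. indicator {0..<2*pi} t *\<^sub>R g t \<partial>lborel)"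
proof -
  have fin: "emeasure lborel {a..<b} < \<infinity>" for a b :: real by (cases "a \<le> b") auto
  have int: "integrable lborel (\<lambda>t. indicator {a..<b} t *\<^sub>R g t)" for a b
    by (rule integrableI_bounded_set_indicator[where B = B]) (use g fin in auto)
  define p where "p = \<lfloor>c / (2 * pi)\<rfloor>"
  define d where "d = c - 2 * pi * of_int p"
  have "of_int p \<le> c / (2*pi)" "c / (2*pi) < of_int p + 1" unfolding p_def by linarith+
  then have d: "0 \<le> d" "d < 2 * pi" unfolding d_def by (auto simp: field_simps)
  have gd: "g (c + t) = g (d + t)" for t
    using per[of "d + t" p] by (simp add: d_def algebra_simps)
  have "(\<integral>t. indicator {0..<2*pi} t *\<^sub>R g (c + t) \<partial>lborel) = (\<integral>t. indicator {0..<2*pi} t *\<^sub>R g (d + t) \<partial>lborel)"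
    unfolding gd ..
  also have "\<dots> = (\<integral>t. indicator {d..<d+2*pi} t *\<^sub>R g t \<partial>lborel)"
    by (subst (2) lborel_integral_real_affine[where t = d and c = 1])
       (auto intro!: Bochner_Integration.integral_cong simp: indicator_def)
  also have "\<dots> = (\<integral>t. indicator {d..<2*pi} t *\<^sub>R g t + indicator {2*pi..<2*pi+d} t *\<^sub>R g t \<partial>lborel)"
    using d by (intro Bochner_Integration.integral_cong) (auto simp: indicator_def)
  also have "\<dots> = (\<integral>t. indicator {d..<2*pi} t *\<^sub>R g t \<partial>lborel) + (\<integral>t. indicator {2*pi..<2*pi+d} t *\<^sub>R g t \<partial>lborel)"
    by (rule Bochner_Integration.integral_add[OF int int])
  also have "(\<integral>t. indicator {2*pi..<2*pi+d} t *\<^sub>R g t \<partial>lborel) = (\<integral>t. indicator {0..<d} t *\<^sub>R g t \<partial>lborel)"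
    using per[of _ 1]
    by (subst lborel_integral_real_affine[where t = "2*pi" and c = 1])
       (auto intro!: Bochner_Integration.integral_cong simp: indicator_def add.commute)
  also have "(\<integral>t. indicator {d..<2*pi} t *\<^sub>R g t \<partial>lborel) + (\<integral>t. indicator {0..<d} t *\<^sub>R g t \<partial>lborel)
     = (\<integral>t. indicator {d..<2*pi} t *\<^sub>R g t + indicator {0..<d} t *\<^sub>R g t \<partial>lborel)"
    by (rule Bochner_Integration.integral_add[OF int int, symmetric])
  also have "\<dots> = (\<integral>t. indicator {0..<2*pi} t *\<^sub>R g t \<partial>lborel)"
    using d by (intro Bochner_Integration.integral_cong) (auto simp: indicator_def)
  finally show ?thesis .
qed

lemma periodic_integral_reflect:
  fixes g :: "real \<Rightarrow> complex"
  assumes g: "g \<in> borel_measurable borel" "\<And>t. norm (g t) \<le> B"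
    and per: "\<And>t (p::int). g (t + 2 * pi * of_int p) = g t"
  shows "(\<integral>t. indicator {0..<2*pi} t *\<^sub>R g (c - t) \<partial>lborel) = (\<integral>t. indicator {0..<2*pi} t *\<^sub>R g t \<partial>lborel)"
proof -
  have "(\<integral>t. indicator {0..<2*pi} t *\<^sub>R g (c - t) \<partial>lborel) = (\<integral>t. indicator {0<..2*pi} t *\<^sub>R g ((c - 2*pi) + t) \<partial>lborel)"
    by (subst lborel_integral_real_affine[where t = "2*pi" and c = "-1"])
       (auto intro!: Bochner_Integration.integral_cong simp: indicator_def algebra_simps)
  also have "\<dots> = (\<integral>t. indicator {0..<2*pi} t *\<^sub>R g ((c - 2*pi) + t) \<partial>lborel)"
  proof (rule integral_cong_AE)
    have "AE t in lborel. t \<noteq> (0::real)" "AE t in lborel. t \<noteq> 2 * pi" by (rule AE_lborel_singleton)+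
    then show "AE t in lborel. indicator {0<..2*pi} t *\<^sub>R g (c - 2*pi + t) = indicator {0..<2*pi} t *\<^sub>R g (c - 2*pi + t)"
      by eventually_elim (auto simp: indicator_def)
  qed (use g in auto)
  also have "\<dots> = (\<integral>t. indicator {0..<2*pi} t *\<^sub>R g t \<partial>lborel)"
    by (rule periodic_integral_shift[OF assms])
  finally show ?thesis .
qed

text \<open>Fubini: it suffices to compare the integrands on the circles along which coordinate j
  varies and the last coordinate compensates.\<close>

lemma tint_coord_cong:
  assumes F: "F \<in> borel_measurable borel" "\<And>y. norm (F y) \<le> B"
    and F': "F' \<in> borel_measurable borel" "\<And>y. norm (F' y) \<le> B'"
    and j: "j \<in> {1..n-1}"
    and eq: "\<And>y. (\<integral>t. indicator {0..<2*pi} t *\<^sub>R F (emb n (y(j := t))) \<partial>lborel)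
                = (\<integral>t. indicator {0..<2*pi} t *\<^sub>R F' (emb n (y(j := t))) \<partial>lborel)"
  shows "tint n F = tint n F'"
proof -
  let ?I = "{1..n-1} - {j}"
  have I: "{1..n-1} = insert j ?I" using j by auto
  have *: "tint n G = (\<integral>y. indicator (PiE ?I (\<lambda>_. {0..<2*pi})) y *\<^sub>R
     (\<integral>t. indicator {0..<2*pi} t *\<^sub>R G (emb n (y(j := t))) \<partial>lborel) \<partial>PiM ?I (\<lambda>_. lborel))"
    if G: "G \<in> borel_measurable borel" "\<And>y. norm (G y) \<le> C" for G :: "(nat \<Rightarrow> real) \<Rightarrow> complex" and C
  proof -
    have "tint n G = (\<integral>y. (\<integral>t. indicator (tbox n) (y(j := t)) *\<^sub>R G (emb n (y(j := t))) \<partial>lborel) \<partial>PiM ?I (\<lambda>_. lborel))"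
      unfolding tint_def lebs_def
      apply (subst (1) I)
      apply (rule lborels.product_integral_insert)
      using integrable_tint[OF G, of n] I unfolding lebs_def by auto
    also have "\<dots> = (\<integral>y. indicator (PiE ?I (\<lambda>_. {0..<2*pi})) y *\<^sub>R
       (\<integral>t. indicator {0..<2*pi} t *\<^sub>R G (emb n (y(j := t))) \<partial>lborel) \<partial>PiM ?I (\<lambda>_. lborel))"
    proof (rule Bochner_Integration.integral_cong[OF refl])
      fix y assume "y \<in> space (PiM ?I (\<lambda>_. lborel :: real measure))"
      then have y: "y \<in> extensional ?I" by (simp add: space_PiM PiE_def)
      have "indicator (tbox n) (y(j := t)) = (indicator (PiE ?I (\<lambda>_. {0..<2*pi})) y * indicator {0..<2*pi} t :: real)" for t
        using y j unfolding tbox_def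
        by (auto simp: indicator_def PiE_def Pi_def extensional_def split: if_splits)
      then show "(\<integral>t. indicator (tbox n) (y(j := t)) *\<^sub>R G (emb n (y(j := t))) \<partial>lborel) =
         indicator (PiE ?I (\<lambda>_. {0..<2*pi})) y *\<^sub>R (\<integral>t. indicator {0..<2*pi} t *\<^sub>R G (emb n (y(j := t))) \<partial>lborel)"
        by (simp flip: scaleR_scaleR)
    qed
    finally show ?thesis .
  qed
  show ?thesis unfolding *[OF F] *[OF F'] eq ..
qed

lemma emb_upd:
  assumes "j \<in> {1..n-1}"
  shows "emb n (y(j := t)) = (\<lambda>k. if k = j then t else if k \<in> {1..n-1} then y k
           else if k = n then - (\<Sum>i\<in>{1..n-1}-{j}. y i) - t else 0)"
proof -
  have "(\<Sum>i\<in>{1..n-1}. (y(j := t)) i) = t + (\<Sum>i\<in>{1..n-1}-{j}. y i)"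
    using assms by (subst sum.remove[of _ j]) (auto intro!: sum.cong)
  then show ?thesis using assms by (auto simp: emb_def fun_eq_iff)
qed

lemma torusfun_coord:
  assumes "torusfun n F" "j \<in> {1..n-1}"
  shows "(\<lambda>t. F (emb n (y(j := t)))) \<in> borel_measurable borel"
    "F (emb n (y(j := t + 2 * pi * of_int p))) = F (emb n (y(j := t)))"
proof -
  show "(\<lambda>t. F (emb n (y(j := t)))) \<in> borel_measurable borel"
  proof (rule measurable_coord_fun[OF _ torusfunD(1)[OF assms(1)]])
    fix i show "(\<lambda>t. emb n (y(j := t)) i) \<in> borel_measurable borel"
      unfolding emb_upd[OF assms(2)] by (cases "i = j"; cases "i \<in> {1..n-1}"; cases "i = n") auto
  qed
  define k where "k i = (if i = j then p else if i = n then -p else 0)" for i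
  have "(\<Sum>i\<in>{1..n}. k i) = (\<Sum>i\<in>{j, n}. k i)"
    using assms(2) by (intro sum.mono_neutral_right) (auto simp: k_def)
  then have "k \<in> root_lattice n" using assms(2) by (auto simp: root_lattice_def k_def)
  from torusfunD(3)[OF assms(1) this, of "emb n (y(j := t))"]
  show "F (emb n (y(j := t + 2 * pi * of_int p))) = F (emb n (y(j := t)))"
  proof (elim back_subst[where P = "\<lambda>z. z = _"], intro arg_cong[where f = F] ext)
    fix i
    show "emb n (y(j := t)) i + 2 * pi * of_int (k i) = emb n (y(j := t + 2 * pi * of_int p)) i"
      unfolding emb_upd[OF assms(2)] k_def using assms(2) by auto
  qed
qed

lemma tint_shift_coord:
  assumes F: "torusfun n F" and j: "j \<in> {1..n-1}"
  shows "tint n (\<lambda>x. F (\<lambda>i. x i + (if i = j then s else if i = n then -s else 0))) = tint n F"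
proof -
  obtain B where B: "\<And>x. norm (F x) \<le> B" using torusfunD(2)[OF F] by auto
  let ?a = "\<lambda>i. if i = j then s else if i = n then -s else 0"
  show ?thesis
  proof (rule tint_coord_cong[OF torusfunD(1)[OF torusfun_shift[OF F]] B torusfunD(1)[OF F] B j])
    fix y
    have *: "(\<lambda>i. emb n (y(j := t)) i + ?a i) = emb n (y(j := s + t))" for t
      unfolding emb_upd[OF j] using j by (auto simp: fun_eq_iff)
    show "(\<integral>t. indicator {0..<2*pi} t *\<^sub>R F (\<lambda>i. emb n (y(j := t)) i + ?a i) \<partial>lborel) =
          (\<integral>t. indicator {0..<2*pi} t *\<^sub>R F (emb n (y(j := t))) \<partial>lborel)"
      unfolding * by (rule periodic_integral_shift[OF torusfun_coord(1)[OF F j] B torusfun_coord(2)[OF F j]])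
  qed
qed

lemma tint_shift:
  assumes F: "torusfun n F" and n: "n \<ge> 2" and a: "\<And>i. i \<notin> {1..n} \<Longrightarrow> a i = 0" "(\<Sum>i\<in>{1..n}. a i) = 0"
  shows "tint n (\<lambda>x. F (\<lambda>i. x i + a i)) = tint n F"
proof -
  have "tint n (\<lambda>x. F (\<lambda>i. x i + (if i \<in> J then a i else if i = n then - (\<Sum>j\<in>J. a j) else 0))) = tint n F"
    if "finite J" "J \<subseteq> {1..n-1}" for J
    using that
  proof (induction J)
    case empty
    have "(\<lambda>i. x i + (if i \<in> {} then a i else if i = n then - (\<Sum>j\<in>{}. a j) else 0)) = x" for x :: "nat \<Rightarrow> real"
      by auto
    then show ?case by simp
  next
    case (insert j J)
    \<comment> \<open>A partial shift with the last coordinate compensating; enlarging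
      \<open>J\<close> by j adds one shift along the difference of the j-th and the last basis
      vector.\<close>
    let ?b = "\<lambda>J i. if i \<in> J then a i else if i = n then - (\<Sum>j\<in>J. a j) else 0"
    have j: "j \<in> {1..n-1}" and nJ: "n \<notin> J" "n \<noteq> j" using insert n by auto
    have "(\<lambda>i. x i + ?b (insert j J) i) = (\<lambda>i. (x i + (if i = j then a j else if i = n then - a j else 0)) + ?b J i)" for x
      using insert(1,2) nJ by (auto simp: fun_eq_iff)
    then have "tint n (\<lambda>x. F (\<lambda>i. x i + ?b (insert j J) i)) =
          tint n (\<lambda>x. F (\<lambda>i. (x i + (if i = j then a j else if i = n then - a j else 0)) + ?b J i))"
      by simp
    also have "\<dots> = tint n (\<lambda>x. F (\<lambda>i. x i + ?b J i))"
      using tint_shift_coord[OF torusfun_shift[OF F, of "?b J"] j, of "a j"] .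
    also have "\<dots> = tint n F" using insert by auto
    finally show ?case .
  qed
  from this[of "{1..n-1}"]
  have *: "tint n (\<lambda>x. F (\<lambda>i. x i + (if i \<in> {1..n-1} then a i else if i = n then - (\<Sum>j\<in>{1..n-1}. a j) else 0))) = tint n F"
    by simp
  have "{1..n} = insert n {1..n-1}" using n by auto
  then have "(\<Sum>i\<in>{1..n}. a i) = a n + (\<Sum>j\<in>{1..n-1}. a j)" using n by simp
  then have "(if i \<in> {1..n-1} then a i else if i = n then - (\<Sum>j\<in>{1..n-1}. a j) else 0) = a i" for i
    using a by auto
  then show ?thesis using * by simp
qed

text \<open>On each coordinate circle this swap is the reflection of t to a constant minus
  t.\<close>

lemma tint_transpose_last:
  assumes F: "torusfun n F" and j: "j \<in> {1..n-1}"
  shows "tint n (\<lambda>x. F (x \<circ> Transposition.transpose j n)) = tint n F"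
proof -
  obtain B where B: "\<And>x. norm (F x) \<le> B" using torusfunD(2)[OF F] by auto
  have p: "Transposition.transpose j n permutes {1..n}" using j by (intro permutes_swap_id) auto
  show ?thesis
  proof (rule tint_coord_cong[OF torusfunD(1)[OF torusfun_perm[OF F p]] B torusfunD(1)[OF F] B j])
    fix y
    have *: "emb n (y(j := t)) \<circ> Transposition.transpose j n = emb n (y(j := - (\<Sum>i\<in>{1..n-1}-{j}. y i) - t))" for t
      unfolding emb_upd[OF j] using j by (auto simp: fun_eq_iff Transposition.transpose_def)
    show "(\<integral>t. indicator {0..<2*pi} t *\<^sub>R F (emb n (y(j := t)) \<circ> Transposition.transpose j n) \<partial>lborel) =
          (\<integral>t. indicator {0..<2*pi} t *\<^sub>R F (emb n (y(j := t))) \<partial>lborel)"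
      unfolding * by (rule periodic_integral_reflect[OF torusfun_coord(1)[OF F j] B torusfun_coord(2)[OF F j]])
  qed
qed

lemma tint_transpose:
  assumes F: "torusfun n F" and ab: "a \<in> {1..n}" "b \<in> {1..n}"
  shows "tint n (\<lambda>x. F (x \<circ> Transposition.transpose a b)) = tint n F"
proof (cases "a = b")
  case False
  have *: "tint n (\<lambda>x. F (x \<circ> Transposition.transpose a n)) = tint n F"
    if "torusfun n F" "a \<in> {1..n}" "a \<noteq> n" for F a
    using that by (intro tint_transpose_last) auto
  show ?thesis
  proof (cases "b = n \<or> a = n")
    case True then show ?thesis using *[OF F] ab False by (metis transpose_commute)
  next
    case nn: False
    let ?a = "Transposition.transpose a n" and ?b = "Transposition.transpose b n"
    \<comment> \<open>Conjugation reduces to swaps with the last index, which act within a single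
      coordinate circle.\<close>
    have eq: "Transposition.transpose a b = ?a \<circ> ?b \<circ> ?a"
      using False nn by (auto simp: fun_eq_iff Transposition.transpose_def)
    have pa: "?a permutes {1..n}" and pb: "?b permutes {1..n}" using ab by (auto intro!: permutes_swap_id)
    have 1: "torusfun n (\<lambda>x. F (x \<circ> ?a))" by (rule torusfun_perm[OF F pa])
    have 2: "torusfun n (\<lambda>x. F (x \<circ> ?b \<circ> ?a))" by (rule torusfun_perm[OF 1 pb])
    have "tint n (\<lambda>x. F (x \<circ> Transposition.transpose a b)) = tint n (\<lambda>x. F (x \<circ> ?a \<circ> ?b \<circ> ?a))"
      unfolding eq by (simp add: o_assoc)
    also have "\<dots> = tint n (\<lambda>x. F (x \<circ> ?b \<circ> ?a))" using *[OF 2] ab nn by blast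
    also have "\<dots> = tint n (\<lambda>x. F (x \<circ> ?a))" using *[OF 1] ab nn by blast
    also have "\<dots> = tint n F" using *[OF F] ab nn by blast
    finally show ?thesis .
  qed
qed simp

lemma tint_perm:
  assumes "torusfun n F" "\<sigma> permutes {1..n}"
  shows "tint n (\<lambda>x. F (x \<circ> \<sigma>)) = tint n F"
  using assms(2) finite_atLeastAtMost assms(1)
proof (induction \<sigma> arbitrary: F rule: permutes_induct)
  case (swap a b p)
  have "tint n (\<lambda>x. F (x \<circ> (Transposition.transpose a b \<circ> p))) = tint n (\<lambda>x. F (x \<circ> Transposition.transpose a b \<circ> p))"
    by (simp add: o_assoc)
  also have "\<dots> = tint n (\<lambda>x. F (x \<circ> p))"
    using tint_transpose[OF torusfun_perm[OF swap.prems swap.hyps(4)] swap.hyps(1,2)] .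
  also have "\<dots> = tint n F" by (rule swap.IH[OF swap.prems])
  finally show ?case .
qed simp

subsection \<open>Averaging along a circle\<close>

lemma circle_mean:
  assumes "continuous_on (cball 0 1) g" "g holomorphic_on ball 0 1"
  shows "(\<integral>s. indicator {0..1} s *\<^sub>R g (cis (2 * pi * s)) \<partial>lborel) = g 0"
proof -
  have "((\<lambda>u. g u / (u - 0)) has_contour_integral (2 * of_real pi * \<i> * g 0)) (circlepath 0 1)"
    by (rule Cauchy_integral_circlepath) (use assms in auto)
  then have "((\<lambda>s. g (circlepath 0 1 s) / circlepath 0 1 s * vector_derivative (circlepath 0 1) (at s within {0..1}))
      has_integral (2 * of_real pi * \<i> * g 0)) {0..1}"
    by (simp add: has_contour_integral_def)
  moreover have "g (circlepath 0 1 s) / circlepath 0 1 s * vector_derivative (circlepath 0 1) (at s within {0..1})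
      = (2 * of_real pi * \<i>) * g (cis (2 * pi * s))" if "s \<in> {0..1}" for s
    using that by (subst vector_derivative_circlepath01) (auto simp: circlepath cis_conv_exp mult_ac)
  ultimately have "((\<lambda>s. (2 * of_real pi * \<i>) * g (cis (2 * pi * s))) has_integral (2 * of_real pi * \<i> * g 0)) {0..1}"
    by (rule has_integral_eq[rotated])
  from has_integral_mult_right[OF this, of "1 / (2 * of_real pi * \<i>)"]
  have "((\<lambda>s. g (cis (2 * pi * s))) has_integral g 0) {0..1}" by simp
  moreover have "set_integrable lborel {0..1} (\<lambda>s. g (cis (2 * pi * s)))"
    by (intro borel_integrable_atLeastAtMost' continuous_on_compose2[OF assms(1)] continuous_intros) auto
  ultimately have "(LINT s:{0..1}|lborel. g (cis (2 * pi * s))) = g 0"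
    by (subst set_borel_integral_eq_integral(2)) (auto intro: integral_unique)
  then show ?thesis unfolding set_lebesgue_integral_def .
qed

text \<open>Translation invariance allows averaging over the whole orbit in direction
  \<open>u\<close>; after Fubini only the mean over each closed orbit matters.\<close>

lemma tint_circle_average:
  fixes c :: complex
  assumes F: "torusfun n F" and n: "n \<ge> 2" and u: "u \<in> root_lattice n"
    and avg: "\<And>x. (\<integral>s. indicator {0..1} s *\<^sub>R F (\<lambda>i. x i + 2 * pi * s * of_int (u i)) \<partial>lborel) = c"
  shows "tint n F = (2 * pi) ^ (n - 1) * c"
proof -
  obtain B where B: "\<And>x. norm (F x) \<le> B" using torusfunD(2)[OF F] by auto
  interpret L: sigma_finite_measure "lebs n" unfolding lebs_def by (rule lborels.sigma_finite) auto
  interpret P: pair_sigma_finite lborel "lebs n" ..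
  let ?f = "\<lambda>s y. indicator {0..1} s *\<^sub>R indicator (tbox n) y *\<^sub>R F (\<lambda>i. emb n y i + 2 * pi * s * of_int (u i))"
  let ?A = "{0..1::real} \<times> tbox n"
  have embm: "(\<lambda>y. emb n y i) \<in> borel_measurable (lebs n)" for i
    using measurable_compose[OF measurable_emb measurable_product_coordinates] .
  have meas: "(\<lambda>p. F (\<lambda>i. emb n (snd p) i + 2 * pi * fst p * of_int (u i))) \<in> borel_measurable (lborel \<Otimes>\<^sub>M lebs n)"
  proof (rule measurable_coord_fun[OF _ torusfunD(1)[OF F]])
    fix i show "(\<lambda>p. emb n (snd p) i + 2 * pi * fst p * of_int (u i)) \<in> borel_measurable (lborel \<Otimes>\<^sub>M lebs n)"
      using measurable_compose[OF measurable_snd embm[of i]] by measurable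
  qed
  have "emeasure (lborel \<Otimes>\<^sub>M lebs n) ?A = emeasure lborel {0..1::real} * emeasure (lebs n) (tbox n)"
    by (rule L.emeasure_pair_measure_Times) auto
  then have fin: "emeasure (lborel \<Otimes>\<^sub>M lebs n) ?A < \<infinity>" by (simp add: emeasure_tbox)
  have "integrable (lborel \<Otimes>\<^sub>M lebs n) (\<lambda>p. indicator ?A p *\<^sub>R F (\<lambda>i. emb n (snd p) i + 2 * pi * fst p * of_int (u i)))"
    by (rule integrableI_bounded_set_indicator[where B = B]) (use fin meas B in auto)
  then have int: "integrable (lborel \<Otimes>\<^sub>M lebs n) (case_prod ?f)"
    by (rule back_subst[where P = "integrable _"]) (auto simp: fun_eq_iff indicator_def)
  have shift: "tint n (\<lambda>x. F (\<lambda>i. x i + 2 * pi * s * of_int (u i))) = tint n F" for s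
  proof (rule tint_shift[OF F n])
    show "2 * pi * s * of_int (u i) = 0" if "i \<notin> {1..n}" for i using u that by (auto simp: root_lattice_def)
    have u0: "(\<Sum>i\<in>{1..n}. u i) = 0" using u by (simp add: root_lattice_def)
    have "(\<Sum>i\<in>{1..n}. 2 * pi * s * of_int (u i)) = 2 * pi * s * of_int (\<Sum>i\<in>{1..n}. u i)"
      by (simp add: sum_distrib_left)
    then show "(\<Sum>i\<in>{1..n}. 2 * pi * s * of_int (u i)) = 0" unfolding u0 by simp
  qed
  \<comment> \<open>\<open>tint n F\<close> is written as its own mean over s in [0,1], and each
    copy is then replaced by the integral of the translate by 2 pi s u.\<close>
  have "integrable lborel (indicator {0..1::real} :: real \<Rightarrow> real)"
    by (rule integrable_real_indicator) auto
  then have "tint n F = (\<integral>s. indicator {0..1::real} s *\<^sub>R tint n F \<partial>lborel)"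
    by (subst Bochner_Integration.integral_scaleR_left) auto
  also have "\<dots> = (\<integral>s. indicator {0..1} s *\<^sub>R tint n (\<lambda>x. F (\<lambda>i. x i + 2 * pi * s * of_int (u i))) \<partial>lborel)"
    unfolding shift ..
  also have "\<dots> = (\<integral>s. \<integral>y. ?f s y \<partial>lebs n \<partial>lborel)" unfolding tint_def by (simp del: scaleR_scaleR)
  also have "\<dots> = (\<integral>y. \<integral>s. ?f s y \<partial>lborel \<partial>lebs n)" by (rule P.Fubini_integral[OF int, symmetric])
  also have "\<dots> = (\<integral>y. indicator (tbox n) y *\<^sub>R
      (\<integral>s. indicator {0..1} s *\<^sub>R F (\<lambda>i. emb n y i + 2 * pi * s * of_int (u i)) \<partial>lborel) \<partial>lebs n)"
    by (subst scaleR_left_commute) (simp del: scaleR_scaleR)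
  also have "\<dots> = tint n (\<lambda>_. c)" unfolding avg tint_def ..
  finally show ?thesis unfolding tint_const .
qed

subsection \<open>Phase monomials\<close>

text \<open>All functions that are integrated are linear combinations of these: the weight of the
  orthogonality measure is itself a trigonometric polynomial in the phases \<^term>\<open>vq q (x j - x k)\<close>.\<close>

definition Tmon :: "nat \<Rightarrow> real \<Rightarrow> (nat \<Rightarrow> real) \<Rightarrow> (nat \<Rightarrow> nat \<Rightarrow> int) \<Rightarrow> (nat \<Rightarrow> real) \<Rightarrow> complex" where
  "Tmon n q \<nu> e x = cis ((\<Sum>j\<in>{1..n}. \<nu> j * x j) + (\<Sum>(j,k)\<in>prs n. of_int (e j k) * vq q (x j - x k)))"

text \<open>Fundamental weights have entries with denominator n, so only differences of entries are
  integral. That suffices for periodicity, since lattice vectors have sum zero.\<close>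

definition intdiff :: "nat \<Rightarrow> (nat \<Rightarrow> real) \<Rightarrow> bool" where
  "intdiff n \<nu> \<longleftrightarrow> (\<forall>j\<in>{1..n}. \<forall>k\<in>{1..n}. \<nu> j - \<nu> k \<in> \<int>)"

lemma cis_cong_2pi:
  assumes "a = b + 2 * pi * r" "r \<in> \<int>"
  shows "cis a = cis b"
  unfolding assms(1) using cis_multiple_2pi[OF assms(2)] by (simp flip: cis_mult)

lemma intdiff_pairing:
  assumes "intdiff n \<nu>" "k \<in> root_lattice n" "n \<ge> 1"
  shows "(\<Sum>j\<in>{1..n}. \<nu> j * of_int (k j)) \<in> \<int>"
proof -
  have "(\<Sum>j\<in>{1..n}. \<nu> j * of_int (k j)) = (\<Sum>j\<in>{1..n}. (\<nu> j - \<nu> 1) * of_int (k j)) + \<nu> 1 * of_int (\<Sum>j\<in>{1..n}. k j)"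
    by (simp add: algebra_simps sum.distrib[symmetric] sum_distrib_left sum_subtractf)
  also have "\<dots> = (\<Sum>j\<in>{1..n}. (\<nu> j - \<nu> 1) * of_int (k j))" using assms(2) by (simp add: root_lattice_def)
  also have "\<dots> \<in> \<int>" using assms(1,3) by (intro Ints_sum Ints_mult) (auto simp: intdiff_def)
  finally show ?thesis .
qed

lemma continuous_on_coord [continuous_intros]: "continuous_on S (\<lambda>x :: nat \<Rightarrow> real. x i)"
  by (rule continuous_on_subset[OF continuous_on_product_coordinates]) simp

lemma continuous_on_cis' [continuous_intros]: "continuous_on S f \<Longrightarrow> continuous_on S (\<lambda>x. cis (f x))"
  unfolding cis_conv_exp by (intro continuous_intros)

lemma continuous_Tmon:
  assumes "\<bar>q\<bar> < 1" shows "continuous_on S (Tmon n q \<nu> e)"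
  unfolding Tmon_def case_prod_unfold by (intro continuous_intros assms)

lemma torusfun_Tmon:
  assumes q: "\<bar>q\<bar> < 1" and n: "n \<ge> 1" and \<nu>: "intdiff n \<nu>"
  shows "torusfun n (Tmon n q \<nu> e)"
  unfolding torusfun_def
proof (intro conjI allI ballI)
  show "Tmon n q \<nu> e \<in> borel_measurable borel"
    by (rule borel_measurable_continuous_onI[OF continuous_Tmon[OF q]])
  show "\<exists>B. \<forall>x. norm (Tmon n q \<nu> e x) \<le> B" by (auto simp: Tmon_def)
  fix x k assume k: "k \<in> root_lattice n"
  let ?x = "\<lambda>i. x i + 2 * pi * of_int (k i)"
  let ?r = "(\<Sum>j\<in>{1..n}. \<nu> j * of_int (k j)) + (\<Sum>(j,l)\<in>prs n. of_int (e j l * (k j - k l)))"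
  show "Tmon n q \<nu> e ?x = Tmon n q \<nu> e x"
    unfolding Tmon_def
  proof (rule cis_cong_2pi)
    show "?r \<in> \<int>" by (intro Ints_add intdiff_pairing[OF \<nu> k n] Ints_sum) auto
    have v: "vq q (?x j - ?x l) = vq q (x j - x l) + 2 * pi * of_int (k j - k l)" for j l
      using vq_add_int[OF q, of "x j - x l" "k j - k l"] by (simp add: algebra_simps)
    show "(\<Sum>j\<in>{1..n}. \<nu> j * ?x j) + (\<Sum>(j,k)\<in>prs n. of_int (e j k) * vq q (?x j - ?x k))
       = ((\<Sum>j\<in>{1..n}. \<nu> j * x j) + (\<Sum>(j,k)\<in>prs n. of_int (e j k) * vq q (x j - x k))) + 2 * pi * ?r"
      unfolding v by (simp add: distrib_left sum.distrib sum_distrib_left case_prod_unfold)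
         (auto intro!: sum.cong simp: algebra_simps sum.distrib[symmetric])
  qed
qed

lemma cis_sum: "cis (sum f A) = (\<Prod>a\<in>A. cis (f a))"
  by (induction A rule: infinite_finite_induct) (auto simp flip: cis_mult)

text \<open>If e and d have equal signs, oddness of \<open>vq\<close> moves the sign of e into the
  argument and the orbit variable enters with the exponent |d|. With opposite signs its inverse
  would enter, and analyticity in the disc would be lost.\<close>

lemma cis_vq_shift:
  assumes q: "\<bar>q\<bar> < 1" and ed: "e * d \<ge> (0::int)"
  shows "cis (of_int e * vq q (t + 2 * pi * s * of_int d)) =
    ((cis (of_int (sgn e) * t) * cis (2 * pi * s) ^ nat \<bar>d\<bar> - of_real q) /
     (1 - of_real q * (cis (of_int (sgn e) * t) * cis (2 * pi * s) ^ nat \<bar>d\<bar>))) ^ nat \<bar>e\<bar>"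
proof (cases "e = 0")
  case False
  have d: "real_of_int d * of_int (sgn e) = of_int \<bar>d\<bar>"
    using ed False by (cases "e > 0") (auto simp: zero_le_mult_iff)
  have "real_of_int e = of_int (\<bar>e\<bar> * sgn e)" by (simp only: abs_mult_sgn)
  then have e: "real_of_int e = of_int \<bar>e\<bar> * of_int (sgn e)" by (simp only: of_int_mult)
  have o: "of_int (sgn e) * vq q r = vq q (of_int (sgn e) * r)" for r
    using False vq_minus[OF q] by (cases "e > 0") auto
  have "of_int e * vq q (t + 2 * pi * s * of_int d) = of_int \<bar>e\<bar> * vq q (of_int (sgn e) * (t + 2 * pi * s * of_int d))"
    unfolding e by (simp add: o mult.assoc)
  also have "of_int (sgn e) * (t + 2 * pi * s * of_int d) = of_int (sgn e) * t + 2 * pi * s * of_int \<bar>d\<bar>"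
    unfolding d[symmetric] by (simp add: algebra_simps)
  finally have *: "of_int e * vq q (t + 2 * pi * s * of_int d) = real (nat \<bar>e\<bar>) * vq q (of_int (sgn e) * t + real (nat \<bar>d\<bar>) * (2 * pi * s))"
    by (simp add: mult_ac)
  show ?thesis unfolding * Complex.DeMoivre[symmetric] cis_vq[OF q]
    by (simp add: Complex.DeMoivre cis_mult)
qed simp

text \<open>Along the orbit in direction \<open>u\<close> the monomial is the boundary value of a
  function analytic in the disc, so its mean is the value at the centre. Condition \<open>eu\<close>
  makes every phase analytic, and a nonnegative integer \<open>M\<close> does the same for the
  linear part.\<close>

lemma tint_Tmon_mean:
  fixes c :: complex
  assumes q: "\<bar>q\<bar> < 1" and n: "n \<ge> 2" and \<nu>: "intdiff n \<nu>" and u: "u \<in> root_lattice n"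
    and eu: "\<And>j k. (j, k) \<in> prs n \<Longrightarrow> e j k * (u j - u k) \<ge> 0"
    and M: "(\<Sum>j\<in>{1..n}. \<nu> j * of_int (u j)) = real M"
    and c: "\<And>x. cis (\<Sum>j\<in>{1..n}. \<nu> j * x j) * 0 ^ M * (\<Prod>(j,k)\<in>prs n. 
        ((cis (of_int (sgn (e j k)) * (x j - x k)) * 0 ^ nat \<bar>u j - u k\<bar> - of_real q) /
         (1 - of_real q * (cis (of_int (sgn (e j k)) * (x j - x k)) * 0 ^ nat \<bar>u j - u k\<bar>))) ^ nat \<bar>e j k\<bar>) = c"
  shows "tint n (Tmon n q \<nu> e) = (2 * pi) ^ (n - 1) * c"
proof (rule tint_circle_average[OF torusfun_Tmon[OF q _ \<nu>] n u])
  show "n \<ge> 1" using n by simp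
  fix x
  \<comment> \<open>The integrand on the orbit with cis(2 pi s) replaced by a free disc variable;
    hypothesis \<open>c\<close> is its value at 0 written out.\<close>
  define G where "G \<zeta> = cis (\<Sum>j\<in>{1..n}. \<nu> j * x j) * \<zeta> ^ M * (\<Prod>(j,k)\<in>prs n. 
        ((cis (of_int (sgn (e j k)) * (x j - x k)) * \<zeta> ^ nat \<bar>u j - u k\<bar> - of_real q) /
         (1 - of_real q * (cis (of_int (sgn (e j k)) * (x j - x k)) * \<zeta> ^ nat \<bar>u j - u k\<bar>))) ^ nat \<bar>e j k\<bar>)" for \<zeta>
  \<comment> \<open>|q| < 1 keeps the poles of all Blaschke factors off the closed disc.\<close>
  have nz: "1 - of_real q * (cis a * \<zeta> ^ p) \<noteq> 0" if "norm \<zeta> \<le> 1" for \<zeta> a p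
  proof
    assume "1 - of_real q * (cis a * \<zeta> ^ p) = 0"
    then have "norm (of_real q * (cis a * \<zeta> ^ p)) = 1" by (metis diff_eq_diff_eq diff_zero norm_one eq_iff_diff_eq_0)
    then have "\<bar>q\<bar> * norm \<zeta> ^ p = 1" by (simp add: norm_mult norm_power)
    moreover have "\<bar>q\<bar> * norm \<zeta> ^ p \<le> \<bar>q\<bar> * 1" using that by (intro mult_left_mono power_le_one) auto
    ultimately show False using q by simp
  qed
  have "G holomorphic_on ball 0 1" unfolding G_def case_prod_unfold
    by (intro holomorphic_intros nz) auto
  moreover have "continuous_on (cball 0 1) G" unfolding G_def case_prod_unfold
    by (intro continuous_intros nz ballI) auto
  ultimately have mean: "(\<integral>s. indicator {0..1} s *\<^sub>R G (cis (2 * pi * s)) \<partial>lborel) = G 0"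
    by (rule circle_mean[rotated])
  have G0: "G 0 = c" unfolding G_def by (rule c)
  have "G (cis (2 * pi * s)) = Tmon n q \<nu> e (\<lambda>i. x i + 2 * pi * s * of_int (u i))" for s
  proof -
    let ?x = "\<lambda>i. x i + 2 * pi * s * of_int (u i)"
    have 1: "(\<Sum>j\<in>{1..n}. \<nu> j * ?x j) = (\<Sum>j\<in>{1..n}. \<nu> j * x j) + real M * (2 * pi * s)"
      unfolding M[symmetric] by (simp add: distrib_left sum.distrib sum_distrib_left sum_distrib_right mult_ac)
    have 2: "cis (of_int (e j k) * vq q (?x j - ?x k)) = 
       ((cis (of_int (sgn (e j k)) * (x j - x k)) * cis (2 * pi * s) ^ nat \<bar>u j - u k\<bar> - of_real q) /
         (1 - of_real q * (cis (of_int (sgn (e j k)) * (x j - x k)) * cis (2 * pi * s) ^ nat \<bar>u j - u k\<bar>))) ^ nat \<bar>e j k\<bar>"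
      if "(j, k) \<in> prs n" for j k
    proof -
      have D: "?x j - ?x k = (x j - x k) + 2 * pi * s * of_int (u j - u k)" by (simp add: algebra_simps)
      show ?thesis unfolding D by (rule cis_vq_shift[OF q eu[OF that]])
    qed
    have "Tmon n q \<nu> e ?x = cis (\<Sum>j\<in>{1..n}. \<nu> j * x j) * cis (2 * pi * s) ^ M * 
       (\<Prod>(j,k)\<in>prs n. cis (of_int (e j k) * vq q (?x j - ?x k)))"
      unfolding Tmon_def 1 cis_mult[symmetric] Complex.DeMoivre case_prod_unfold cis_sum by simp
    also have "\<dots> = G (cis (2 * pi * s))"
      unfolding G_def by (intro arg_cong2[where f = "(*)"] refl prod.cong) (auto simp: 2)
    finally show ?thesis by simp
  qed
  with mean show "(\<integral>s. indicator {0..1} s *\<^sub>R Tmon n q \<nu> e (\<lambda>i. x i + 2 * pi * s * of_int (u i)) \<partial>lborel) = c"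
    by (simp add: G0)
qed

text \<open>A positive pairing puts a positive power of the disc variable in front, which vanishes
  at the centre.\<close>

lemma tint_Tmon_zero:
  assumes q: "\<bar>q\<bar> < 1" and n: "n \<ge> 2" and \<nu>: "intdiff n \<nu>" and u: "u \<in> root_lattice n"
    and eu: "\<And>j k. (j, k) \<in> prs n \<Longrightarrow> e j k * (u j - u k) \<ge> 0"
    and pos: "(\<Sum>j\<in>{1..n}. \<nu> j * of_int (u j)) > 0"
  shows "tint n (Tmon n q \<nu> e) = 0"
proof -
  obtain z where z: "(\<Sum>j\<in>{1..n}. \<nu> j * of_int (u j)) = of_int z"
    using intdiff_pairing[OF \<nu> u] n Ints_cases by (metis dual_order.trans one_le_numeral)
  then have "z > 0" using pos by simp
  have "tint n (Tmon n q \<nu> e) = (2 * pi) ^ (n - 1) * (0::complex)"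
    by (rule tint_Tmon_mean[OF q n \<nu> u eu, where M = "nat z"]) (use z \<open>z > 0\<close> in auto)
  then show ?thesis by simp
qed

text \<open>In a strictly decreasing direction every pair difference moves, so at the centre each
  Blaschke factor takes its value -q.\<close>

lemma tint_Tmon_const:
  assumes q: "\<bar>q\<bar> < 1" and n: "n \<ge> 2" and e: "\<And>j k. (j, k) \<in> prs n \<Longrightarrow> e j k \<ge> 0"
  shows "tint n (Tmon n q (\<lambda>_. 0) e) = (2 * pi) ^ (n - 1) * (\<Prod>(j,k)\<in>prs n. (- complex_of_real q) ^ nat (e j k))"
proof -
  \<comment> \<open>Twice \<open>rho\<close>: integral, of sum zero and strictly decreasing.\<close>
  define u :: "nat \<Rightarrow> int" where "u j = (if j \<in> {1..n} then int n + 1 - 2 * int j else 0)" for j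
  have "(\<Sum>j\<in>{1..n}. int n + 1 - 2 * int j) = 0"
  proof -
    have "2 * (\<Sum>j\<in>{1..n}. int j) = int n * (int n + 1)" 
      using gauss_sum_from_Suc_0[of n, where 'a = int] by (induction n) (auto simp: algebra_simps)
    moreover have "(\<Sum>j\<in>{1..n}. int n + 1 - 2 * int j) = int n * (int n + 1) - 2 * (\<Sum>j\<in>{1..n}. int j)"
      by (simp add: sum_subtractf sum_distrib_left algebra_simps)
    ultimately show ?thesis by simp
  qed
  then have u: "u \<in> root_lattice n" by (auto simp: root_lattice_def u_def)
  have uu: "u j - u k > 0" if "(j, k) \<in> prs n" for j k using that by (auto simp: prs_mem u_def)
  show ?thesis
  proof (rule tint_Tmon_mean[OF q n _ u, where M = 0])
    show "intdiff n (\<lambda>_. 0)" by (simp add: intdiff_def)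
    show "e j k * (u j - u k) \<ge> 0" if "(j, k) \<in> prs n" for j k
      using e[OF that] uu[OF that] by simp
    fix x :: "nat \<Rightarrow> real"
    show "cis (\<Sum>j\<in>{1..n}. 0 * x j) * 0 ^ 0 * (\<Prod>(j,k)\<in>prs n. 
        ((cis (of_int (sgn (e j k)) * (x j - x k)) * 0 ^ nat \<bar>u j - u k\<bar> - of_real q) /
         (1 - of_real q * (cis (of_int (sgn (e j k)) * (x j - x k)) * 0 ^ nat \<bar>u j - u k\<bar>))) ^ nat \<bar>e j k\<bar>) =
        (\<Prod>(j,k)\<in>prs n. (- complex_of_real q) ^ nat (e j k))"
    proof -
      have "((cis (of_int (sgn (e j k)) * (x j - x k)) * 0 ^ nat \<bar>u j - u k\<bar> - of_real q) /
          (1 - of_real q * (cis (of_int (sgn (e j k)) * (x j - x k)) * 0 ^ nat \<bar>u j - u k\<bar>))) ^ nat \<bar>e j k\<bar>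
          = (- complex_of_real q) ^ nat (e j k)" if "(j, k) \<in> prs n" for j k
      proof -
        have z: "(0::complex) ^ nat \<bar>u j - u k\<bar> = 0" using uu[OF that] by simp
        show ?thesis unfolding z using e[OF that] by simp
      qed
      then show ?thesis by (auto intro!: prod.cong)
    qed
  qed simp
qed

subsection \<open>Bethe phases and the vanishing of their nontrivial Fourier modes\<close>

definition bethe :: "nat \<Rightarrow> nat \<Rightarrow> real \<Rightarrow> (nat \<Rightarrow> real) \<Rightarrow> nat \<Rightarrow> real" where
  "bethe m n q x j = real m * x j + (\<Sum>k\<in>{1..n} - {j}. vq q (x j - x k))"

lemma sum_offdiag_prs:
  fixes f :: "nat \<Rightarrow> nat \<Rightarrow> 'a::comm_monoid_add"
  shows "(\<Sum>j\<in>{1..n}. \<Sum>k\<in>{1..n}-{j}. f j k) = (\<Sum>(j,k)\<in>prs n. f j k + f k j)"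
proof -
  have "(\<Sum>j\<in>{1..n}. \<Sum>k\<in>{1..n}-{j}. f j k) = (\<Sum>(j,k)\<in>Sigma {1..n} (\<lambda>j. {1..n}-{j}). f j k)"
    by (rule sum.Sigma) auto
  also have "Sigma {1..n} (\<lambda>j. {1..n}-{j}) = prs n \<union> prod.swap ` prs n"
    by (auto simp: prs_def image_iff)
  also have "(\<Sum>(j,k)\<in>prs n \<union> prod.swap ` prs n. f j k) = (\<Sum>(j,k)\<in>prs n. f j k) + (\<Sum>(j,k)\<in>prod.swap ` prs n. f j k)"
    by (rule sum.union_disjoint) (simp, simp, auto simp: prs_mem)
  also have "(\<Sum>(j,k)\<in>prod.swap ` prs n. f j k) = (\<Sum>(j,k)\<in>prs n. f k j)"
    by (subst sum.reindex) (auto intro!: sum.cong)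
  finally show ?thesis by (simp add: sum.distrib case_prod_unfold)
qed

text \<open>Oddness of \<open>vq\<close> folds the off-diagonal double sum onto ordered pairs. Hence
  a Fourier mode in the Bethe phases is itself a phase monomial, and multiplying by it stays within
  the class.\<close>

lemma sum_bethe:
  assumes "\<bar>q\<bar> < 1"
  shows "(\<Sum>j\<in>{1..n}. of_int (k j) * bethe m n q x j) =
    (\<Sum>j\<in>{1..n}. real m * of_int (k j) * x j) + (\<Sum>(j,l)\<in>prs n. of_int (k j - k l) * vq q (x j - x l))"
proof -
  have "(\<Sum>j\<in>{1..n}. \<Sum>l\<in>{1..n}-{j}. of_int (k j) * vq q (x j - x l)) =
      (\<Sum>(j,l)\<in>prs n. of_int (k j) * vq q (x j - x l) + of_int (k l) * vq q (x l - x j))"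
    by (rule sum_offdiag_prs)
  also have "\<dots> = (\<Sum>(j,l)\<in>prs n. of_int (k j - k l) * vq q (x j - x l))"
  proof (intro sum.cong refl, clarify)
    fix j l show "of_int (k j) * vq q (x j - x l) + of_int (k l) * vq q (x l - x j) = of_int (k j - k l) * vq q (x j - x l)"
      using vq_minus[OF assms, of "x j - x l"] by (simp add: algebra_simps)
  qed
  finally show ?thesis
    by (simp add: bethe_def distrib_left sum.distrib sum_distrib_left mult_ac)
qed

lemma Tmon_mult_bethe:
  assumes "\<bar>q\<bar> < 1"
  shows "Tmon n q \<nu> e x * cis (\<Sum>j\<in>{1..n}. of_int (k j) * bethe m n q x j) =
     Tmon n q (\<lambda>j. \<nu> j + real m * of_int (k j)) (\<lambda>j l. e j l + (k j - k l)) x"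
  unfolding Tmon_def cis_mult sum_bethe[OF assms]
  by (rule arg_cong[where f = cis]) (simp add: distrib_right sum.distrib case_prod_unfold)

text \<open>What is needed so that multiplying by a trigonometric polynomial in the differences of
  the Bethe phases affects the integral only through its constant mode.\<close>

definition nonres :: "nat \<Rightarrow> nat \<Rightarrow> real \<Rightarrow> ((nat \<Rightarrow> real) \<Rightarrow> complex) \<Rightarrow> bool" where
  "nonres m n q h \<longleftrightarrow> torusfun n h \<and> (\<forall>k\<in>root_lattice n. k \<noteq> (\<lambda>_. 0) \<longrightarrow>
     tint n (\<lambda>x. h x * cis (\<Sum>j\<in>{1..n}. of_int (k j) * bethe m n q x j)) = 0)"

text \<open>The circle average is taken in the direction of the mode \<open>k\<close> itself. The
  phase exponents keep the sign of k_i - k_j, and the quadratic term m * sum k_j^2 dominates the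
  linear one.\<close>

lemma nonres_Tmon:
  assumes q: "\<bar>q\<bar> < 1" and n: "n \<ge> 2" and m: "m > 0" and \<nu>: "intdiff n \<nu>"
    and lev: "\<And>j k. \<lbrakk>j \<in> {1..n}; k \<in> {1..n}\<rbrakk> \<Longrightarrow> \<nu> j - \<nu> k \<le> 2 * real m - 1"
    and e: "\<And>j k. (j, k) \<in> prs n \<Longrightarrow> \<bar>e j k\<bar> \<le> 1"
  shows "nonres m n q (Tmon n q \<nu> e)"
  unfolding nonres_def
proof (intro conjI ballI impI)
  show "torusfun n (Tmon n q \<nu> e)" using torusfun_Tmon[OF q _ \<nu>] n by simp
  fix k assume k: "k \<in> root_lattice n" "k \<noteq> (\<lambda>_. 0)"
  show "tint n (\<lambda>x. Tmon n q \<nu> e x * cis (\<Sum>j\<in>{1..n}. of_int (k j) * bethe m n q x j)) = 0"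
    unfolding Tmon_mult_bethe[OF q]
  proof (rule tint_Tmon_zero[OF q n _ k(1)])
    show "intdiff n (\<lambda>j. \<nu> j + real m * of_int (k j))"
      unfolding intdiff_def
    proof (intro ballI)
      fix i j assume "i \<in> {1..n}" "j \<in> {1..n}"
      then have "\<nu> i - \<nu> j \<in> \<int>" using \<nu> by (auto simp: intdiff_def)
      then have "(\<nu> i - \<nu> j) + real m * (of_int (k i) - of_int (k j)) \<in> \<int>"
        by (rule Ints_add) (intro Ints_mult Ints_diff; simp)
      then show "\<nu> i + real m * of_int (k i) - (\<nu> j + real m * of_int (k j)) \<in> \<int>" by (simp add: algebra_simps)
    qed
    \<comment> \<open>A nonzero integer difference is at least as large as the perturbation
      \<open>e\<close>, so the exponent keeps its sign or becomes 0.\<close>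
    show "(e i j + (k i - k j)) * (k i - k j) \<ge> 0" if ij: "(i, j) \<in> prs n" for i j
    proof -
      consider "k i - k j = 0" | "k i - k j > 0" "e i j + (k i - k j) \<ge> 0" | "k i - k j < 0" "e i j + (k i - k j) \<le> 0"
        using e[OF ij] by linarith
      then show ?thesis by cases (auto intro: mult_nonneg_nonneg mult_nonpos_nonpos)
    qed
    let ?I = "{1..n}"
    have kne: "\<exists>j\<in>?I. k j \<noteq> 0"
    proof (rule ccontr)
      assume "\<not> ?thesis"
      then have "k j = 0" for j using k(1) unfolding root_lattice_def by (cases "j \<in> ?I") blast+
      then show False using k(2) by blast
    qed
    have k0: "(\<Sum>j\<in>?I. real_of_int (k j)) = 0" using k(1) by (simp add: root_lattice_def flip: of_int_sum)
    define a b where "a = Min (\<nu> ` ?I)" and "b = Max (\<nu> ` ?I)"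
    have ne: "finite (\<nu> ` ?I)" "\<nu> ` ?I \<noteq> {}" using n by auto
    have "a \<in> \<nu> ` ?I" "b \<in> \<nu> ` ?I" unfolding a_def b_def using Min_in[OF ne] Max_in[OF ne] by auto
    then have ab: "b - a \<le> 2 * real m - 1" using lev by auto
    have rng: "a \<le> \<nu> j" "\<nu> j \<le> b" if "j \<in> ?I" for j
      unfolding a_def b_def using that ne by auto
    \<comment> \<open>The midpoint of the range of the weight. Subtracting it is free because
      \<open>k\<close> has sum zero, and it halves the bound on the coefficients.\<close>
    define c where "c = (a + b) / 2"
    have dc: "\<bar>\<nu> j - c\<bar> \<le> (2 * real m - 1) / 2" if "j \<in> ?I" for j
      using rng[OF that] ab unfolding c_def by (auto simp: abs_le_iff field_simps)
    \<comment> \<open>Integrality enters here and leaves at least k_j^2 / 2 of each quadratic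
      term.\<close>
    have sq: "\<bar>real_of_int z\<bar> \<le> (real_of_int z)\<^sup>2" for z
    proof (cases "z = 0")
      case False
      then have "1 * \<bar>real_of_int z\<bar> \<le> \<bar>real_of_int z\<bar> * \<bar>real_of_int z\<bar>" by (intro mult_right_mono) linarith+
      then show ?thesis by (simp add: power2_eq_square)
    qed simp
    have "(\<Sum>j\<in>?I. (\<nu> j + real m * of_int (k j)) * of_int (k j))
        = (\<Sum>j\<in>?I. (\<nu> j - c) * of_int (k j) + real m * (of_int (k j))\<^sup>2) + c * (\<Sum>j\<in>?I. of_int (k j))"
      by (simp add: sum_distrib_left sum.distrib[symmetric] algebra_simps power2_eq_square)
    also have "\<dots> = (\<Sum>j\<in>?I. (\<nu> j - c) * of_int (k j) + real m * (of_int (k j))\<^sup>2)" unfolding k0 by simp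
    also have "\<dots> \<ge> (\<Sum>j\<in>?I. (of_int (k j))\<^sup>2 / 2)"
    proof (rule sum_mono)
      fix j assume j: "j \<in> ?I"
      have "\<bar>(\<nu> j - c) * of_int (k j)\<bar> \<le> (2 * real m - 1) / 2 * (of_int (k j))\<^sup>2"
        unfolding abs_mult by (intro mult_mono dc[OF j] sq) (use m in auto)
      then have "(\<nu> j - c) * of_int (k j) \<ge> - ((2 * real m - 1) / 2 * (of_int (k j))\<^sup>2)" by linarith
      then show "(of_int (k j))\<^sup>2 / 2 \<le> (\<nu> j - c) * of_int (k j) + real m * (of_int (k j))\<^sup>2"
        by (simp add: field_simps)
    qed
    moreover have "(\<Sum>j\<in>?I. (real_of_int (k j))\<^sup>2 / 2) > 0"
    proof -
      obtain j where "j \<in> ?I" "k j \<noteq> 0" using kne by blast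
      then show ?thesis by (intro sum_pos2[of _ j]) auto
    qed
    ultimately show "(\<Sum>j\<in>?I. (\<nu> j + real m * of_int (k j)) * of_int (k j)) > 0" by linarith
  qed
qed

lemma continuous_bethe [continuous_intros]:
  assumes "\<bar>q\<bar> < 1" shows "continuous_on S (\<lambda>x. bethe m n q x j)"
  unfolding bethe_def by (intro continuous_intros assms)

lemma torusfun_cis_bethe:
  assumes q: "\<bar>q\<bar> < 1" and n: "n \<ge> 2" and k: "k \<in> root_lattice n"
  shows "torusfun n (\<lambda>x. cis (\<Sum>j\<in>{1..n}. of_int (k j) * bethe m n q x j))"
proof -
  have "intdiff n (\<lambda>j. 0 + real m * of_int (k j))" 
    unfolding intdiff_def by (auto intro!: Ints_diff Ints_mult)
  then have "torusfun n (Tmon n q (\<lambda>j. 0 + real m * of_int (k j)) (\<lambda>j l. 0 + (k j - k l)))"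
    using torusfun_Tmon[OF q] n by simp
  then show ?thesis unfolding Tmon_mult_bethe[OF q, of n "\<lambda>_. 0" "\<lambda>_ _. 0", symmetric, abs_def]
    by (simp add: Tmon_def)
qed

lemma nonres_add:
  assumes "\<bar>q\<bar> < 1" "n \<ge> 2" "nonres m n q g" "nonres m n q h"
  shows "nonres m n q (\<lambda>x. g x + h x)"
  unfolding nonres_def
proof (intro conjI ballI impI)
  have t: "torusfun n g" "torusfun n h" using assms by (auto simp: nonres_def)
  show "torusfun n (\<lambda>x. g x + h x)" by (rule torusfun_add[OF t])
  fix k assume k: "k \<in> root_lattice n" "k \<noteq> (\<lambda>_. 0)"
  note c = torusfun_cis_bethe[OF assms(1,2) k(1)]
  show "tint n (\<lambda>x. (g x + h x) * cis (\<Sum>j\<in>{1..n}. of_int (k j) * bethe m n q x j)) = 0"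
    unfolding distrib_right tint_add[OF torusfun_mult[OF t(1) c] torusfun_mult[OF t(2) c]]
    using assms(3,4) k by (simp add: nonres_def del: One_nat_def)
qed

lemma nonres_cmult:
  assumes "nonres m n q h"
  shows "nonres m n q (\<lambda>x. c * h x)"
  using assms unfolding nonres_def by (auto intro!: torusfun_mult simp: tint_cmult mult.assoc)

lemma nonres_sum:
  assumes "\<bar>q\<bar> < 1" "n \<ge> 2" "\<And>a. a \<in> A \<Longrightarrow> nonres m n q (F a)"
  shows "nonres m n q (\<lambda>x. \<Sum>a\<in>A. F a x)"
  using assms(3)
proof (induction A rule: infinite_finite_induct)
  case (insert a A)
  then show ?case using nonres_add[OF assms(1,2)] by auto
qed (auto simp: nonres_def)

subsection \<open>A kernel concentrating on the Bethe points\<close>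

text \<open>A kernel with values in [0,1] that equals 1 exactly where all Bethe phases agree modulo
  2 pi. Its powers are trigonometric polynomials with an explicit constant mode.\<close>

definition kap :: "nat \<Rightarrow> nat \<Rightarrow> real \<Rightarrow> (nat \<Rightarrow> real) \<Rightarrow> real" where
  "kap m n q x = (\<Prod>j\<in>{1..n-1}. (1 + cos (bethe m n q x j - bethe m n q x n)) / 2)"

lemma one_plus_cos_nonneg: "0 \<le> 1 + cos (u::real)"
  using cos_ge_minus_one[of u] by linarith

lemma kap_bounds: "0 \<le> kap m n q x" "kap m n q x \<le> 1"
  unfolding kap_def using one_plus_cos_nonneg by (auto intro!: prod_nonneg prod_le_1)

lemma kap_eq_1_cos:
  assumes "kap m n q x = 1" "j \<in> {1..n-1}"
  shows "cos (bethe m n q x j - bethe m n q x n) = 1"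
proof (rule ccontr)
  let ?f = "\<lambda>j. (1 + cos (bethe m n q x j - bethe m n q x n)) / 2"
  have b: "0 \<le> ?f i" "?f i \<le> 1" for i
    using one_plus_cos_nonneg[of "bethe m n q x i - bethe m n q x n"] by auto
  assume "cos (bethe m n q x j - bethe m n q x n) \<noteq> 1"
  then have "cos (bethe m n q x j - bethe m n q x n) < 1"
    using order.not_eq_order_implies_strict[OF _ cos_le_one] by blast
  then have "?f j < 1" by simp
  moreover have "kap m n q x = ?f j * prod ?f ({1..n-1} - {j})"
    unfolding kap_def using assms(2) by (intro prod.remove) auto
  moreover have "prod ?f ({1..n-1} - {j}) \<le> 1" by (intro prod_le_1) (use b in auto)
  ultimately have "kap m n q x < 1"
    using mult_left_le[OF \<open>prod ?f ({1..n-1} - {j}) \<le> 1\<close> b(1)[of j]] by linarith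
  then show False using assms(1) by simp
qed

text \<open>(1 + cos u)/2 is the square of cos(u/2), so the N-th power is a binomial expansion of
  degree 2N whose half-integral frequencies combine to integers.\<close>

lemma fejer_expand:
  "complex_of_real (((1 + cos u) / 2) ^ N) = (\<Sum>a\<le>2*N. of_real (real ((2*N) choose a) / 4 ^ N) * cis ((real a - real N) * u))"
proof -
  have "(1 + cos u) / 2 = (cos (u/2))\<^sup>2" using cos_double_cos[of "u/2"] by simp
  then have "complex_of_real (((1 + cos u) / 2) ^ N) = of_real (cos (u/2)) ^ (2*N)"
    by (simp flip: power_mult)
  also have "complex_of_real (cos (u/2)) = (cis (u/2) + cis (- (u/2))) / 2"
    by (simp add: complex_eq_iff)
  also have "\<dots> ^ (2*N) = (cis (u/2) + cis (- (u/2))) ^ (2*N) / 4 ^ N"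
    by (simp add: power_divide power_mult)
  also have "(cis (u/2) + cis (- (u/2))) ^ (2*N) = (\<Sum>a\<le>2*N. of_nat ((2*N) choose a) * cis (u/2) ^ a * cis (- (u/2)) ^ (2*N-a))"
    by (rule binomial_ring)
  also have "\<dots> / 4 ^ N = (\<Sum>a\<le>2*N. of_real (real ((2*N) choose a) / 4 ^ N) * cis ((real a - real N) * u))"
    unfolding sum_divide_distrib
  proof (intro sum.cong refl)
    fix a assume "a \<in> {..2*N}"
    then have "cis (u/2) ^ a * cis (- (u/2)) ^ (2*N-a) = cis ((real a - real N) * u)"
      unfolding Complex.DeMoivre cis_mult by (intro arg_cong[where f = cis]) (simp add: of_nat_diff field_simps)
    then show "of_nat ((2*N) choose a) * cis (u/2) ^ a * cis (- (u/2)) ^ (2*N-a) / 4 ^ N =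
       of_real (real ((2*N) choose a) / 4 ^ N) * cis ((real a - real N) * u)"
      by (simp add: mult.assoc)
  qed
  finally show ?thesis .
qed

text \<open>Frequencies of products of powers of cis(G_j - G_n): the last entry collects the
  opposite of all others.\<close>

definition kmode :: "nat \<Rightarrow> nat \<Rightarrow> (nat \<Rightarrow> nat) \<Rightarrow> nat \<Rightarrow> int" where
  "kmode n N a j = (if j \<in> {1..n-1} then int (a j) - int N
      else if j = n then - (\<Sum>i\<in>{1..n-1}. int (a i) - int N) else 0)"

lemma atLeast1_insert_last: "n \<ge> 2 \<Longrightarrow> {1..n} = insert n {1..n-1}" for n :: nat
  by auto

lemma kmode_root_lattice: "n \<ge> 2 \<Longrightarrow> kmode n N a \<in> root_lattice n"
  unfolding root_lattice_def by (simp add: atLeast1_insert_last kmode_def del: One_nat_def) auto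

lemma kap_power_expand:
  assumes n: "n \<ge> 2"
  shows "complex_of_real (kap m n q x ^ N) = (\<Sum>a\<in>PiE {1..n-1} (\<lambda>_. {..2*N}).
     of_real (\<Prod>j\<in>{1..n-1}. real ((2*N) choose a j) / 4 ^ N) *
     cis (\<Sum>j\<in>{1..n}. of_int (kmode n N a j) * bethe m n q x j))"
proof -
  let ?u = "\<lambda>j. bethe m n q x j - bethe m n q x n"
  have "complex_of_real (kap m n q x ^ N) = (\<Prod>j\<in>{1..n-1}. of_real (((1 + cos (?u j)) / 2) ^ N))"
    by (simp add: kap_def prod_power_distrib)
  also have "\<dots> = (\<Prod>j\<in>{1..n-1}. \<Sum>a\<in>{..2*N}. of_real (real ((2*N) choose a) / 4 ^ N) * cis ((real a - real N) * ?u j))"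
    unfolding fejer_expand ..
  also have "\<dots> = (\<Sum>a\<in>PiE {1..n-1} (\<lambda>_. {..2*N}). \<Prod>j\<in>{1..n-1}. of_real (real ((2*N) choose a j) / 4 ^ N) * cis ((real (a j) - real N) * ?u j))"
    by (rule prod_sum_PiE) auto
  also have "\<dots> = (\<Sum>a\<in>PiE {1..n-1} (\<lambda>_. {..2*N}).
     of_real (\<Prod>j\<in>{1..n-1}. real ((2*N) choose a j) / 4 ^ N) *
     cis (\<Sum>j\<in>{1..n}. of_int (kmode n N a j) * bethe m n q x j))"
  proof (intro sum.cong refl)
    fix a
    have "(\<Sum>j\<in>{1..n}. of_int (kmode n N a j) * bethe m n q x j) =
       (\<Sum>j\<in>{1..n-1}. (real (a j) - real N) * bethe m n q x j) - (\<Sum>j\<in>{1..n-1}. real (a j) - real N) * bethe m n q x n"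
      using n by (simp add: atLeast1_insert_last kmode_def del: One_nat_def) auto
    also have "\<dots> = (\<Sum>j\<in>{1..n-1}. (real (a j) - real N) * ?u j)"
      unfolding right_diff_distrib sum_distrib_right sum_subtractf[symmetric] ..
    finally have "cis (\<Sum>j\<in>{1..n}. of_int (kmode n N a j) * bethe m n q x j) = (\<Prod>j\<in>{1..n-1}. cis ((real (a j) - real N) * ?u j))"
      by (simp add: cis_sum)
    then show "(\<Prod>j\<in>{1..n-1}. of_real (real ((2*N) choose a j) / 4 ^ N) * cis ((real (a j) - real N) * ?u j)) =
      of_real (\<Prod>j\<in>{1..n-1}. real ((2*N) choose a j) / 4 ^ N) * cis (\<Sum>j\<in>{1..n}. of_int (kmode n N a j) * bethe m n q x j)"
      unfolding prod.distrib of_real_prod by simp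
  qed
  finally show ?thesis .
qed

text \<open>All modes with nonzero frequency integrate to 0 by \<open>nonres\<close>; the factor is
  the constant mode of the kernel.\<close>

lemma tint_mult_kap_power:
  assumes q: "\<bar>q\<bar> < 1" and n: "n \<ge> 2" and h: "nonres m n q h"
  shows "tint n (\<lambda>x. h x * of_real (kap m n q x ^ N)) = of_real ((real ((2*N) choose N) / 4 ^ N) ^ (n-1)) * tint n h"
proof -
  let ?A = "PiE {1..n-1} (\<lambda>_. {..2*N})"
  let ?c = "\<lambda>a. complex_of_real (\<Prod>j\<in>{1..n-1}. real ((2*N) choose a j) / 4 ^ N)"
  let ?E = "\<lambda>a x. cis (\<Sum>j\<in>{1..n}. of_int (kmode n N a j) * bethe m n q x j)"
  \<comment> \<open>The only exponent tuple with trivial frequency.\<close>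
  let ?a0 = "\<lambda>j\<in>{1..n-1}. N"
  have th: "torusfun n h" using h by (simp add: nonres_def)
  have tE: "torusfun n (\<lambda>x. h x * ?E a x)" for a
    by (intro torusfun_mult th torusfun_cis_bethe[OF q n kmode_root_lattice[OF n]])
  have "tint n (\<lambda>x. h x * of_real (kap m n q x ^ N)) = tint n (\<lambda>x. \<Sum>a\<in>?A. ?c a * (h x * ?E a x))"
    unfolding kap_power_expand[OF n] by (simp only: sum_distrib_left mult.left_commute)
  also have "\<dots> = (\<Sum>a\<in>?A. ?c a * tint n (\<lambda>x. h x * ?E a x))"
    by (subst tint_sum) (auto intro!: torusfun_mult[OF torusfun_const tE] simp only: tint_cmult)
  also have "\<dots> = (\<Sum>a\<in>{?a0}. ?c a * tint n (\<lambda>x. h x * ?E a x))"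
  proof (rule sum.mono_neutral_right)
    show "finite ?A" by (intro finite_PiE) auto
    show "{?a0} \<subseteq> ?A" by auto
    show "\<forall>a\<in>?A - {?a0}. ?c a * tint n (\<lambda>x. h x * ?E a x) = 0"
    proof
      fix a assume a: "a \<in> ?A - {?a0}"
      have "kmode n N a \<noteq> (\<lambda>_. 0)"
      proof
        assume z: "kmode n N a = (\<lambda>_. 0)"
        have "a j = N" if "j \<in> {1..n-1}" for j using fun_cong[OF z, of j] that by (simp add: kmode_def)
        then have "a = ?a0" using a by (intro ext) (auto simp: PiE_def extensional_def restrict_def)
        then show False using a by simp
      qed
      then show "?c a * tint n (\<lambda>x. h x * ?E a x) = 0"
        using h kmode_root_lattice[OF n] unfolding nonres_def by simp
    qed
  qed
  also have "\<dots> = ?c ?a0 * tint n h"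
  proof -
    have "kmode n N ?a0 = (\<lambda>_. 0)" by (auto simp: kmode_def fun_eq_iff)
    then show ?thesis by simp
  qed
  also have "?c ?a0 = of_real ((real ((2*N) choose N) / 4 ^ N) ^ (n-1))" by simp
  finally show ?thesis .
qed

section \<open>Compactness and the limit of high kernel powers\<close>

lemma compact_PiE_UNIV:
  fixes K :: "nat \<Rightarrow> real set"
  assumes "\<And>i. compact (K i)"
  shows "compact (PiE UNIV K)"
proof -
  have "compactin (product_topology (\<lambda>i. euclidean) UNIV) (PiE UNIV K)"
    using assms by (simp add: compactin_PiE)
  then show ?thesis by (simp add: euclidean_product_topology)
qed

lemma poly_times_geometric_tendsto_0:
  fixes t :: real
  assumes "0 \<le> t" "t < 1" "p > 0"
  shows "(\<lambda>N. (2 * real N) ^ p * t ^ N) \<longlonglongrightarrow> 0"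
proof -
  \<comment> \<open>Taking the p-th root reduces the claim to N r^N -> 0.\<close>
  define r where "r = root p t"
  have r: "norm r < 1" "r ^ p = t" using assms by (auto simp: r_def real_root_lt_1_iff)
  have "(\<lambda>N. (2 * (real N * r ^ N)) ^ p) \<longlonglongrightarrow> (2 * 0) ^ p"
    by (intro tendsto_intros powser_times_n_limit_0 r)
  moreover have "(2 * (real N * r ^ N)) ^ p = (2 * real N) ^ p * t ^ N" for N
    by (simp add: power_mult_distrib r(2)[symmetric] mult.commute flip: power_mult)
  moreover have "(2 * 0 :: real) ^ p = 0" using assms(3) by simp
  ultimately show ?thesis by (simp only:)
qed

text \<open>Multiplying by the N-th kernel power scales the integral of \<open>h\<close> by the
  constant mode c. Where |h| is small the contribution is at most epsilon times the kernel mass,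
  which is also proportional to c; elsewhere it is of order t^N with t < 1. Dividing by c and
  letting N grow leaves epsilon.\<close>

lemma tint_eq_0_if_vanishes_on_bethe:
  assumes q: "\<bar>q\<bar> < 1" and n: "n \<ge> 2" and h: "nonres m n q h" and one: "nonres m n q (\<lambda>_. 1)"
    and cont: "continuous_on UNIV h"
    and van: "\<And>x. \<lbrakk>x \<in> vecs n; (\<Sum>j\<in>{1..n}. x j) = 0; kap m n q x = 1\<rbrakk> \<Longrightarrow> h x = 0"
  shows "tint n h = 0"
proof -
  have th: "torusfun n h" using h by (simp add: nonres_def)
  obtain B where B: "\<And>x. norm (h x) \<le> B" using torusfunD(2)[OF th] by auto
  have B0: "B \<ge> 0" using B order_trans[OF norm_ge_zero] by blast
  \<comment> \<open>A compact set containing the image of the box; the last coordinate is minus a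
    sum of n-1 numbers from [0, 2 pi).\<close>
  define K where "K = PiE UNIV (\<lambda>i. if i \<in> {1..n-1} then {0..2*pi} else if i = n then {- (2 * pi * real n)..0} else {0::real})
     \<inter> {x. (\<Sum>j\<in>{1..n}. x j) = 0}"
  have "closed {x :: nat \<Rightarrow> real. (\<Sum>j\<in>{1..n}. x j) = 0}"
    by (intro closed_Collect_eq continuous_intros)
  then have cK: "compact K" unfolding K_def by (intro compact_Int_closed compact_PiE_UNIV) auto
  have embK: "emb n y \<in> K" if "y \<in> tbox n" for y
  proof -
    have y: "0 \<le> y i" "y i \<le> 2 * pi" if "i \<in> {1..n-1}" for i
      using \<open>y \<in> tbox n\<close> that unfolding tbox_def by (auto simp: PiE_def Pi_def less_imp_le)
    have "(\<Sum>i\<in>{1..n-1}. y i) \<le> (\<Sum>i\<in>{1..n-1}. 2 * pi)" by (intro sum_mono y)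
    also have "\<dots> \<le> 2 * pi * real n" by (simp add: of_nat_diff mult.commute)
    finally have "(\<Sum>i\<in>{1..n-1}. y i) \<le> 2 * pi * real n" .
    moreover have "0 \<le> (\<Sum>i\<in>{1..n-1}. y i)" by (intro sum_nonneg y)
    moreover have "(\<Sum>j\<in>{1..n}. emb n y j) = 0"
      using n by (simp add: atLeast1_insert_last emb_def del: One_nat_def)
    ultimately show ?thesis using y unfolding K_def by (auto simp: emb_def simp del: One_nat_def)
  qed
  have Kvec: "x \<in> vecs n" "(\<Sum>j\<in>{1..n}. x j) = 0" if "x \<in> K" for x
  proof -
    have xk: "x k \<in> (if k \<in> {1..n-1} then {0..2*pi} else if k = n then {- (2 * pi * real n)..0} else {0})" for k
      using that unfolding K_def by (auto simp: PiE_def Pi_def)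
    have "x k = 0" if "k \<notin> {1..n}" for k
    proof -
      have "k \<notin> {1..n-1}" "k \<noteq> n" using that n by auto
      then show ?thesis using xk[of k] by (simp only: if_False singleton_iff)
    qed
    then show "x \<in> vecs n" unfolding vecs_def by simp
    show "(\<Sum>j\<in>{1..n}. x j) = 0" using that by (simp add: K_def)
  qed
  have ckap: "continuous_on S (kap m n q)" for S
    unfolding kap_def by (intro continuous_intros q) auto
  let ?V = "(2 * pi) ^ (n - 1)"
  have small: "norm (tint n h) \<le> ?V * \<epsilon>" if \<epsilon>: "\<epsilon> > 0" for \<epsilon>
  proof -
    \<comment> \<open>Since \<open>h\<close> vanishes wherever the kernel is 1, the kernel has a
      maximum below 1 on this compact set.\<close>
    define L where "L = {x \<in> K. \<epsilon> \<le> norm (h x)}"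
    have "closed {x. \<epsilon> \<le> norm (h x)}" by (intro closed_Collect_le continuous_intros cont)
    then have "compact (K \<inter> {x. \<epsilon> \<le> norm (h x)})" using cK by (rule compact_Int_closed[rotated])
    then have cL: "compact L" by (simp add: L_def Int_def)
    obtain t where t: "0 \<le> t" "t < 1" "\<And>x. x \<in> L \<Longrightarrow> kap m n q x \<le> t"
    proof (cases "L = {}")
      case True then show ?thesis using that[of 0] by auto
    next
      case False
      from continuous_attains_sup[OF cL False ckap] obtain z where z: "z \<in> L" "\<And>x. x \<in> L \<Longrightarrow> kap m n q x \<le> kap m n q z"
        by blast
      have "kap m n q z \<noteq> 1" using van[of z] Kvec[of z] z(1) \<epsilon> by (auto simp: L_def)
      then show ?thesis using that[of "kap m n q z"] kap_bounds[of m n q z] z(2) by force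
    qed
    have bnd: "norm (tint n h) \<le> ?V * (\<epsilon> + B * ((2 * real N) ^ (n-1) * t ^ N))" if N: "N > 0" for N
    proof -
      define c where "c = (real ((2*N) choose N) / 4 ^ N) ^ (n-1)"
      \<comment> \<open>The central binomial coefficient is at least 4^N / (2N), so dividing by c
        costs only a polynomial factor.\<close>
      have "1 / (2 * real N) \<le> real ((2*N) choose N) / 4 ^ N"
        using central_binomial_lower_bound[OF N] N by (simp add: field_simps)
      then have c: "(1 / (2 * real N)) ^ (n-1) \<le> c" unfolding c_def by (intro power_mono) auto
      moreover have "0 < (1 / (2 * real N)) ^ (n-1)" using N by (intro zero_less_power) simp
      ultimately have c0: "c > 0" by linarith
      have c1: "1 / c \<le> (2 * real N) ^ (n-1)"
        using c c0 N by (simp add: field_simps power_divide power_one_over del: One_nat_def)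
      have kint: "integrable (lebs n) (\<lambda>y. indicator (tbox n) y *\<^sub>R (kap m n q (emb n y) ^ N))"
        by (rule integrable_tint[where B = 1])
           (use kap_bounds in \<open>auto intro!: power_le_one borel_measurable_continuous_onI ckap continuous_intros\<close>)
      have hint: "integrable (lebs n) (\<lambda>y. indicator (tbox n) y *\<^sub>R (h (emb n y) * of_real (kap m n q (emb n y) ^ N)))"
        by (rule integrable_tint[where B = B and F = "\<lambda>x. h x * of_real (kap m n q x ^ N)"])
           (use kap_bounds B B0 in \<open>auto simp: norm_mult norm_power intro!: borel_measurable_continuous_onI ckap continuous_intros cont
              order_trans[OF mult_right_le_one_le] power_le_one\<close>)
      have cint: "integrable (lebs n) (\<lambda>y. indicator (tbox n) y *\<^sub>R (B * t ^ N))"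
        by (rule integrable_tbox[where B = "norm (B * t ^ N)"]) auto
      \<comment> \<open>The scaling identity applied to the constant 1 computes the total mass of
        the kernel.\<close>
      have "tint n (\<lambda>x. 1 * of_real (kap m n q x ^ N)) = of_real c * tint n (\<lambda>_. 1)"
        unfolding c_def by (rule tint_mult_kap_power[OF q n one])
      moreover have "tint n (\<lambda>x. 1 * of_real (kap m n q x ^ N)) = of_real (\<integral>y. indicator (tbox n) y *\<^sub>R (kap m n q (emb n y) ^ N) \<partial>lebs n)"
      proof -
        have "indicator (tbox n) y *\<^sub>R (1 * complex_of_real (kap m n q (emb n y) ^ N)) =
            complex_of_real (indicator (tbox n) y *\<^sub>R (kap m n q (emb n y) ^ N))" for y
          by (simp add: scaleR_conv_of_real)
        then show ?thesis unfolding tint_def by (simp only: integral_complex_of_real)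
      qed
      ultimately have "complex_of_real (\<integral>y. indicator (tbox n) y *\<^sub>R (kap m n q (emb n y) ^ N) \<partial>lebs n) = of_real (c * ?V)"
        by (simp add: tint_const)
      then have kI: "(\<integral>y. indicator (tbox n) y *\<^sub>R (kap m n q (emb n y) ^ N) \<partial>lebs n) = c * ?V"
        by (simp only: of_real_eq_iff)
      have "c * norm (tint n h) = norm (tint n (\<lambda>x. h x * of_real (kap m n q x ^ N)))"
        unfolding tint_mult_kap_power[OF q n h] c_def[symmetric] using c0 by (simp add: norm_mult)
      also have "\<dots> \<le> (\<integral>y. indicator (tbox n) y *\<^sub>R (\<epsilon> * kap m n q (emb n y) ^ N) + indicator (tbox n) y *\<^sub>R (B * t ^ N) \<partial>lebs n)"
        unfolding tint_def
      proof (rule order_trans[OF integral_norm_bound], rule integral_mono)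
        show "integrable (lebs n) (\<lambda>y. norm (indicator (tbox n) y *\<^sub>R (h (emb n y) * of_real (kap m n q (emb n y) ^ N))))"
          using hint by (rule integrable_norm)
        have "integrable (lebs n) (\<lambda>y. \<epsilon> * (indicator (tbox n) y *\<^sub>R (kap m n q (emb n y) ^ N)))"
          by (intro integrable_mult_right kint)
        then show "integrable (lebs n) (\<lambda>y. indicator (tbox n) y *\<^sub>R (\<epsilon> * kap m n q (emb n y) ^ N) + indicator (tbox n) y *\<^sub>R (B * t ^ N))"
          by (intro Bochner_Integration.integrable_add cint) (simp add: mult_ac)
        fix y
        show "norm (indicator (tbox n) y *\<^sub>R (h (emb n y) * of_real (kap m n q (emb n y) ^ N))) \<le>
           indicator (tbox n) y *\<^sub>R (\<epsilon> * kap m n q (emb n y) ^ N) + indicator (tbox n) y *\<^sub>R (B * t ^ N)"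
        proof (cases "y \<in> tbox n")
          case True
          let ?x = "emb n y"
          have k0: "0 \<le> kap m n q ?x ^ N" using kap_bounds by simp
          have "norm (h ?x) * kap m n q ?x ^ N \<le> \<epsilon> * kap m n q ?x ^ N + B * t ^ N"
          proof (cases "?x \<in> L")
            case True
            have "norm (h ?x) * kap m n q ?x ^ N \<le> B * t ^ N"
              using B B0 k0 t(3)[OF True] kap_bounds by (intro mult_mono power_mono) auto
            then show ?thesis using \<epsilon> k0 by (simp add: add_increasing)
          next
            case False
            then have "norm (h ?x) \<le> \<epsilon>" using embK[OF \<open>y \<in> tbox n\<close>] by (auto simp: L_def)
            then have "norm (h ?x) * kap m n q ?x ^ N \<le> \<epsilon> * kap m n q ?x ^ N" using k0 by (rule mult_right_mono)
            then show ?thesis using B0 t(1) by (simp add: add_increasing2)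
          qed
          then show ?thesis using True k0 kap_bounds by (simp add: norm_mult norm_power)
        qed simp
      qed
      also have "\<dots> = (\<integral>y. \<epsilon> * (indicator (tbox n) y *\<^sub>R (kap m n q (emb n y) ^ N)) \<partial>lebs n) + (\<integral>y. indicator (tbox n) y *\<^sub>R (B * t ^ N) \<partial>lebs n)"
        using Bochner_Integration.integral_add[OF integrable_mult_right[OF kint, of \<epsilon>] cint] by (simp add: mult_ac)
      also have "(\<integral>y. indicator (tbox n) y *\<^sub>R (B * t ^ N) \<partial>lebs n) = ?V * (B * t ^ N)"
        using sets.sets_into_space[OF sets_tbox, of n] by (simp add: measure_tbox emeasure_tbox Int_absorb2 del: One_nat_def)
      also have "(\<integral>y. \<epsilon> * (indicator (tbox n) y *\<^sub>R (kap m n q (emb n y) ^ N)) \<partial>lebs n) = \<epsilon> * (c * ?V)"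
        by (simp only: kI Bochner_Integration.integral_mult_right_zero)
      finally have "c * norm (tint n h) \<le> \<epsilon> * (c * ?V) + ?V * (B * t ^ N)" .
      then have "norm (tint n h) \<le> ?V * (\<epsilon> + B * t ^ N * (1 / c))"
        using c0 by (simp add: field_simps)
      also have "\<dots> \<le> ?V * (\<epsilon> + B * t ^ N * (2 * real N) ^ (n-1))"
        using c1 B0 t(1) by (intro mult_left_mono add_left_mono) auto
      finally show ?thesis by (simp add: mult_ac)
    qed
    have "(\<lambda>N. ?V * (\<epsilon> + B * ((2 * real N) ^ (n-1) * t ^ N))) \<longlonglongrightarrow> ?V * (\<epsilon> + B * 0)"
      by (intro tendsto_intros poly_times_geometric_tendsto_0) (use n t in auto)
    moreover have "\<forall>\<^sub>F N in sequentially. norm (tint n h) \<le> ?V * (\<epsilon> + B * ((2 * real N) ^ (n-1) * t ^ N))"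
      using eventually_gt_at_top[of 0] by eventually_elim (rule bnd)
    ultimately have "norm (tint n h) \<le> ?V * (\<epsilon> + B * 0)"
      by (intro tendsto_lowerbound[where F = sequentially]) auto
    then show ?thesis by simp
  qed
  define V :: real where "V = (2 * pi) ^ (n - 1)"
  have V0: "V > 0" unfolding V_def by simp
  have "norm (tint n h) \<le> 0 + e" if "e > 0" for e
  proof -
    have "e / V > 0" using that V0 by simp
    from small[OF this, folded V_def] show ?thesis using V0 by simp
  qed
  then have "norm (tint n h) \<le> 0" by (rule field_le_epsilon)
  then show ?thesis by simp
qed

subsection \<open>The alcove as a fundamental domain of the affine symmetric group\<close>

text \<open>All pair inequalities at once and no normalisation of the sum, which is the form that
  survives permuting and translating points.\<close>

definition chamber :: "nat \<Rightarrow> (nat \<Rightarrow> real) set" where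
  "chamber n = {x. \<forall>(i,j)\<in>prs n. 0 < x i - x j \<and> x i - x j < 2 * pi}"

lemma chamberD:
  "x \<in> chamber n \<Longrightarrow> 1 \<le> i \<Longrightarrow> i < j \<Longrightarrow> j \<le> n \<Longrightarrow> 0 < x i - x j \<and> x i - x j < 2 * pi"
  by (auto simp: chamber_def prs_def)

lemma alcove_eq_chamber:
  assumes "n \<ge> 2"
  shows "alcove n = {x \<in> chamber n. x \<in> vecs n \<and> (\<Sum>j\<in>{1..n}. x j) = 0}"
proof (intro equalityI subsetI)
  fix x assume x: "x \<in> alcove n"
  have step: "x j > x (Suc j)" if "1 \<le> j" "j < n" for j using x that by (auto simp: alcove_def)
  have dec: "x (i + Suc d) < x i" if "1 \<le> i" "i + Suc d \<le> n" for i d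
    using that
  proof (induction d)
    case 0 then show ?case using step[of i] by simp
  next
    case (Suc d) then show ?case using step[of "i + Suc d"] by fastforce
  qed
  have lt: "x j < x i" if "1 \<le> i" "i < j" "j \<le> n" for i j
    using dec[of i "j - i - 1"] that by simp
  then have le: "x j \<le> x i" if "1 \<le> i" "i \<le> j" "j \<le> n" for i j
    using that by (cases "i = j") (auto intro: less_imp_le)
  have "x i - x j < 2 * pi" if "1 \<le> i" "i < j" "j \<le> n" for i j
    using le[of 1 i] le[of j n] that x by (auto simp: alcove_def)
  then show "x \<in> {x \<in> chamber n. x \<in> vecs n \<and> (\<Sum>j\<in>{1..n}. x j) = 0}"
    using lt x by (auto simp: alcove_def chamber_def prs_def)
next
  fix x assume "x \<in> {x \<in> chamber n. x \<in> vecs n \<and> (\<Sum>j\<in>{1..n}. x j) = 0}"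
  then show "x \<in> alcove n"
  proof -
    assume x: "x \<in> {x \<in> chamber n. x \<in> vecs n \<and> (\<Sum>j\<in>{1..n}. x j) = 0}"
    have "x (Suc j) < x j" if "j \<in> {1..n-1}" for j
      using chamberD[of x n j "Suc j"] x that by auto
    moreover have "x 1 - 2 * pi < x n" using chamberD[of x n 1 n] x assms by auto
    ultimately show ?thesis using x by (simp add: alcove_def)
  qed
qed

lemma int_eq_if_small_diff:
  assumes "0 < t + 2 * pi * of_int a" "t + 2 * pi * of_int a < 2 * pi"
    "0 < t + 2 * pi * of_int b" "t + 2 * pi * of_int b < 2 * pi"
  shows "a = b"
proof -
  have "2 * pi * (of_int a - of_int b) < 2 * pi * 1" "2 * pi * (of_int b - of_int a) < 2 * pi * 1"
    using assms by (auto simp: algebra_simps)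
  then have "real_of_int a - of_int b < 1" "real_of_int b - of_int a < 1"
    by (simp_all only: mult_less_cancel_left_pos[OF mult_pos_pos[OF zero_less_numeral pi_gt_zero]])
  then show ?thesis by linarith
qed

lemma int_mem_if_small:
  assumes "0 < t + 2 * pi * of_int a" "t + 2 * pi * of_int a < 2 * pi" "- (2 * pi) < t" "t < 0"
  shows "a = 1"
proof -
  have "2 * pi * of_int a < 2 * pi * 2" "2 * pi * 0 < 2 * pi * of_int a"
    using assms by linarith+
  then have "real_of_int a < 2" "0 < real_of_int a"
    by (simp_all only: mult_less_cancel_left_pos[OF mult_pos_pos[OF zero_less_numeral pi_gt_zero]])
  then show ?thesis by linarith
qed

lemma strict_mono_permutes_id:
  assumes p: "\<tau> permutes {1..n}" and mono: "\<And>i j. \<lbrakk>1 \<le> i; i < j; j \<le> n\<rbrakk> \<Longrightarrow> \<tau> i < \<tau> (j::nat)"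
  shows "\<tau> = id"
proof -
  have ge: "i \<le> \<tau> i" if "1 \<le> i" "i \<le> n" for i
    using that
  proof (induction i)
    case (Suc i)
    show ?case
    proof (cases "i = 0")
      case True then show ?thesis using permutes_in_image[OF p, of 1] Suc.prems by auto
    next
      case False then show ?thesis using Suc mono[of i "Suc i"] by force
    qed
  qed simp
  have "(\<Sum>i\<in>{1..n}. \<tau> i) = (\<Sum>i\<in>{1..n}. i)" using sum.permute[OF p, of "\<lambda>i. i"] by (simp add: o_def)
  then have "i = \<tau> i" if "i \<in> {1..n}" for i
    using sum_mono_inv[of "\<lambda>i. i" "{1..n}" \<tau> i] ge that by auto
  then show ?thesis using permutes_not_in[OF p] by (metis ext id_apply)
qed

text \<open>For i < j the chamber inequalities force K_i - K_j to be 0 if \<open>\<tau>\<close>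
  keeps the order of the pair and 1 if it reverses it. Sum zero then makes \<open>K\<close> vanish,
  so \<open>\<tau>\<close> is increasing.\<close>

lemma chamber_affine_unique:
  assumes p: "x \<in> chamber n" and n: "n \<ge> 1" and t: "\<tau> permutes {1..n}" and K: "K \<in> root_lattice n"
    and p': "(\<lambda>i. x (\<tau> i) + 2 * pi * of_int (K i)) \<in> chamber n"
  shows "\<tau> = id" "K = (\<lambda>_. 0)"
proof -
  have rng: "1 \<le> \<tau> i \<and> \<tau> i \<le> n" if "1 \<le> i" "i \<le> n" for i using permutes_in_image[OF t, of i] that by auto
  have inj: "\<tau> i \<noteq> \<tau> j" if "i \<noteq> j" for i j using permutes_inj[OF t] that by (meson injD)
  have D: "(\<tau> i < \<tau> j \<and> K i = K j) \<or> (\<tau> j < \<tau> i \<and> K i = K j + 1)" if ij: "1 \<le> i" "i < j" "j \<le> n" for i j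
  proof -
    have b: "0 < (x (\<tau> i) - x (\<tau> j)) + 2 * pi * of_int (K i - K j)" "(x (\<tau> i) - x (\<tau> j)) + 2 * pi * of_int (K i - K j) < 2 * pi"
      using chamberD[OF p' ij] by (auto simp: algebra_simps)
    show ?thesis
    proof (cases "\<tau> i < \<tau> j")
      case True
      then show ?thesis using int_eq_if_small_diff[OF b, of 0] chamberD[OF p, of "\<tau> i" "\<tau> j"] rng[of i] rng[of j] ij by auto
    next
      case False
      then have "\<tau> j < \<tau> i" using inj[of i j] ij by simp
      then show ?thesis using int_mem_if_small[OF b] chamberD[OF p, of "\<tau> j" "\<tau> i"] rng[of i] rng[of j] ij by auto
    qed
  qed
  have K0: "(\<Sum>i\<in>{1..n}. K i) = 0" using K by (simp add: root_lattice_def)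
  \<comment> \<open>By \<open>D\<close> the values of \<open>K\<close> lie in {K 1 - 1, K 1}. If
    both occurred, all values would be <= 0 or all >= 0, with one of them strict, contradicting sum
    zero.\<close>
  have eq: "K i = K 1" if "i \<in> {1..n}" for i
  proof (rule ccontr)
    assume ne: "K i \<noteq> K 1"
    then have i: "1 < i" "i \<le> n" "K 1 = K i + 1" using that D[of 1 i] by (cases "i = 1"; force)+
    have up: "K j \<le> K 1" if "j \<in> {1..n}" for j using that D[of 1 j] by (cases "j = 1") auto
    have lo: "K j \<ge> K i" if "j \<in> {1..n}" for j using up[OF that] that D[of 1 j] i(3) by (cases "j = 1") auto
    show False
    proof (cases "K 1 \<le> 0")
      case True
      have "(\<Sum>j\<in>{1..n}. K j) < (\<Sum>j\<in>{1..n}. 0)"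
      proof (rule sum_strict_mono_ex1)
        show "\<forall>j\<in>{1..n}. K j \<le> 0" using up True by force
        show "\<exists>j\<in>{1..n}. K j < 0" using i True by (intro bexI[of _ i]) auto
      qed simp
      then show False using K0 by simp
    next
      case False
      have "(\<Sum>j\<in>{1..n}. 0) < (\<Sum>j\<in>{1..n}. K j)"
      proof (rule sum_strict_mono_ex1)
        show "\<forall>j\<in>{1..n}. 0 \<le> K j" using lo i(3) False by force
        show "\<exists>j\<in>{1..n}. 0 < K j" using n False by (intro bexI[of _ 1]) auto
      qed simp
      then show False using K0 by simp
    qed
  qed
  have "(\<Sum>i\<in>{1..n}. K i) = (\<Sum>i\<in>{1..n}. K 1)" by (rule sum.cong[OF refl eq])
  then have "(\<Sum>i\<in>{1..n}. K i) = int n * K 1" by simp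
  then have "K 1 = 0" using K0 n by simp
  then have "K i = 0" for i using eq[of i] K by (cases "i \<in> {1..n}") (auto simp: root_lattice_def)
  then show "K = (\<lambda>_. 0)" by blast
  show "\<tau> = id"
  proof (rule strict_mono_permutes_id[OF t])
    fix i j assume ij: "1 \<le> i" "i < j" "j \<le> n"
    have "K i = K j" using eq[of i] eq[of j] ij by simp
    then show "\<tau> i < \<tau> j" using D[OF ij] by linarith
  qed
qed

section \<open>Moving points off the walls into the alcove\<close>

definition wall :: "nat \<Rightarrow> (nat \<Rightarrow> real) \<Rightarrow> bool" where
  "wall n x \<longleftrightarrow> (\<exists>a\<in>{1..n}. \<exists>b\<in>{1..n}. a \<noteq> b \<and> (\<exists>z::int. x a - x b = 2 * pi * of_int z))"

lemma ex_top_subset: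
  fixes r :: "'a \<Rightarrow> real"
  assumes "finite A" "inj_on r A" "s \<le> card A"
  shows "\<exists>S\<subseteq>A. card S = s \<and> (\<forall>i\<in>S. \<forall>j\<in>A-S. r j < r i)"
  using assms(3)
proof (induction s)
  case 0 then show ?case by (intro exI[of _ "{}"]) auto
next
  case (Suc s)
  then obtain S where S: "S \<subseteq> A" "card S = s" "\<And>i j. i \<in> S \<Longrightarrow> j \<in> A-S \<Longrightarrow> r j < r i" by auto
  have fS: "finite S" using S(1) assms(1) finite_subset by blast
  have "A - S \<noteq> {}"
  proof
    assume "A - S = {}"
    then have "A = S" using S(1) by blast
    then show False using S(2) Suc.prems by simp
  qed
  then have ne: "finite (r ` (A-S))" "r ` (A-S) \<noteq> {}" using assms(1) by auto
  from Max_in[OF ne] obtain a where a: "a \<in> A - S" "r a = Max (r ` (A-S))" by auto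
  have "r j < r a" if "j \<in> A - insert a S" for j
  proof -
    have "r j \<le> r a" unfolding a(2) using that assms(1) by (intro Max_ge) auto
    moreover have "r j \<noteq> r a" using that a(1) assms(2) by (auto dest: inj_onD)
    ultimately show ?thesis by simp
  qed
  then show ?case using S a fS by (intro exI[of _ "insert a S"]) auto
qed

lemma ex_sorting_permutation:
  fixes z :: "nat \<Rightarrow> real"
  assumes inj: "inj_on z {1..n}"
  shows "\<exists>\<sigma>. \<sigma> permutes {1..n} \<and> (\<forall>i j. 1 \<le> i \<longrightarrow> i < j \<longrightarrow> j \<le> n \<longrightarrow> z (\<sigma> j) < z (\<sigma> i))"
proof -
  \<comment> \<open>Rank from the top: the largest entry has rank 1, and injectivity of
    \<open>z\<close> makes the ranks a permutation whose inverse sorts.\<close>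
  define r where "r j = card {l\<in>{1..n}. z j \<le> z l}" for j
  define p where "p j = (if j \<in> {1..n} then r j else j)" for j
  have mono: "r l < r j" if "z j < z l" "j \<in> {1..n}" for j l
  proof -
    have "{i\<in>{1..n}. z l \<le> z i} \<subseteq> {i\<in>{1..n}. z j \<le> z i}" using that by auto
    moreover have "j \<in> {i\<in>{1..n}. z j \<le> z i} - {i\<in>{1..n}. z l \<le> z i}" using that by auto
    ultimately show ?thesis unfolding r_def by (intro psubset_card_mono) (simp, blast)
  qed
  have rr: "r j \<in> {1..n}" if "j \<in> {1..n}" for j
  proof -
    have "{l\<in>{1..n}. z j \<le> z l} \<noteq> {}" using that by auto
    then have "0 < r j" unfolding r_def by (simp add: card_gt_0_iff)
    moreover have "r j \<le> card {1..n}" unfolding r_def by (intro card_mono) auto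
    ultimately show ?thesis by simp
  qed
  have "inj_on r {1..n}"
  proof (rule inj_onI)
    fix i j assume ij: "i \<in> {1..n}" "j \<in> {1..n}" "r i = r j"
    then have "z i = z j" using mono[of i j] mono[of j i] by (metis less_irrefl linorder_cases)
    then show "i = j" using inj ij by (auto dest: inj_onD)
  qed
  moreover have "inj_on p {1..n} \<longleftrightarrow> inj_on r {1..n}" by (rule inj_on_cong) (simp add: p_def)
  ultimately have "inj_on p {1..n}" by simp
  moreover have "p ` {1..n} \<subseteq> {1..n}" using rr by (auto simp: p_def simp del: atLeastAtMost_iff)
  ultimately have "bij_betw p {1..n} {1..n}"
    using endo_inj_surj[of "{1..n}" p] by (simp add: bij_betw_def)
  then have pp: "p permutes {1..n}" by (rule bij_imp_permutes) (auto simp: p_def)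
  have "z (inv p j) < z (inv p i)" if ij: "1 \<le> i" "i < j" "j \<le> n" for i j
  proof (rule ccontr)
    have m: "inv p i \<in> {1..n}" "inv p j \<in> {1..n}" using permutes_in_image[OF permutes_inv[OF pp]] ij by auto
    assume "\<not> ?thesis"
    then have "r (inv p j) \<le> r (inv p i)" unfolding r_def by (intro card_mono) auto
    then have "p (inv p j) \<le> p (inv p i)" using m by (simp add: p_def)
    then show False using ij permutes_inverses[OF pp] by simp
  qed
  then show ?thesis using permutes_inv[OF pp] by blast
qed

text \<open>Reducing every coordinate modulo 2 pi spoils the sum by a multiple of 2 pi. Lowering the
  right number of largest coordinates by 2 pi repairs it while the spread stays below 2 pi; sorting
  finishes.\<close>

lemma ex_affine_to_alcove:
  assumes n: "n \<ge> 2" and x: "x \<in> vecs n" "(\<Sum>j\<in>{1..n}. x j) = 0" and nw: "\<not> wall n x"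
  shows "\<exists>\<sigma> k. \<sigma> permutes {1..n} \<and> k \<in> root_lattice n \<and> (\<lambda>i. x (\<sigma> i) + 2 * pi * of_int (k i)) \<in> alcove n"
proof -
  define a where "a j = \<lfloor>x j / (2 * pi)\<rfloor>" for j
  define r where "r j = x j - 2 * pi * of_int (a j)" for j
  have r: "0 \<le> r j" "r j < 2 * pi" for j
  proof -
    have "of_int (a j) \<le> x j / (2*pi)" "x j / (2*pi) < of_int (a j) + 1" unfolding a_def by linarith+
    then show "0 \<le> r j" "r j < 2 * pi" unfolding r_def by (auto simp: field_simps)
  qed
  have nz: "x i - x j \<noteq> 2 * pi * of_int z" if "i \<in> {1..n}" "j \<in> {1..n}" "i \<noteq> j" for i j z
    using nw that unfolding wall_def by blast
  have injr: "inj_on r {1..n}"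
  proof (rule inj_onI, rule ccontr)
    fix i j assume ij: "i \<in> {1..n}" "j \<in> {1..n}" "r i = r j" "i \<noteq> j"
    have "x i - x j = 2 * pi * of_int (a i - a j)" using ij(3) by (simp add: r_def algebra_simps)
    then show False using nz ij by blast
  qed
  \<comment> \<open>The reduced coordinates sum to 2 pi s with 0 <= s < n, so s of them have to be
    lowered.\<close>
  define s where "s = - (\<Sum>j\<in>{1..n}. a j)"
  have "(\<Sum>j\<in>{1..n}. r j) = 2 * pi * of_int s"
    using x(2) by (simp add: r_def s_def sum_subtractf sum_distrib_left)
  moreover have "(\<Sum>j\<in>{1..n}. r j) < (\<Sum>j\<in>{1..n}. 2 * pi)" using n r by (intro sum_strict_mono) auto
  moreover have "0 \<le> (\<Sum>j\<in>{1..n}. r j)" using r by (intro sum_nonneg)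
  ultimately have "2 * pi * of_int s < 2 * pi * real n" "2 * pi * 0 \<le> 2 * pi * of_int s" by (auto simp: mult.commute)
  then have "real_of_int s < real n" "0 \<le> real_of_int s"
    by (simp_all only: mult_less_cancel_left_pos mult_le_cancel_left_pos mult_pos_pos[OF zero_less_numeral pi_gt_zero])
  then have s: "0 \<le> s" "s < int n" by linarith+
  then have "nat s \<le> card {1..n}" by simp
  from ex_top_subset[OF finite_atLeastAtMost injr this]
  obtain S where S: "S \<subseteq> {1..n}" "card S = nat s" "\<And>i j. i \<in> S \<Longrightarrow> j \<in> {1..n} - S \<Longrightarrow> r j < r i"
    by blast
  define k where "k j = (if j \<in> {1..n} then - a j - (if j \<in> S then 1 else 0) else 0)" for j
  define z where "z j = x j + 2 * pi * of_int (k j)" for j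
  have "(\<Sum>j\<in>{1..n}. k j) = - (\<Sum>j\<in>{1..n}. a j) - (\<Sum>j\<in>{1..n}. if j \<in> S then 1 else 0)"
    by (simp add: k_def sum_subtractf sum_negf)
  also have "(\<Sum>j\<in>{1..n}. if j \<in> S then 1 else 0) = int (card S)"
    using S(1) by (simp add: sum.If_cases Int_absorb1)
  finally have k: "k \<in> root_lattice n" using S(2) s by (auto simp: root_lattice_def k_def s_def)
  have zr: "z j = (if j \<in> S then r j - 2 * pi else r j)" if "j \<in> {1..n}" for j
    using that by (auto simp: z_def k_def r_def algebra_simps)
  \<comment> \<open>The critical case is i outside \<open>S\<close> and j inside: the difference is
    r_i - r_j + 2 pi, and r_i < r_j because \<open>S\<close> holds the largest.\<close>
  have zd: "z i - z j < 2 * pi" if "i \<in> {1..n}" "j \<in> {1..n}" for i j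
    using zr[OF that(1)] zr[OF that(2)] r[of i] r[of j] S(3)[of j i] that by (auto split: if_splits)
  have "inj_on z {1..n}"
  proof (rule inj_onI, rule ccontr)
    fix i j assume ij: "i \<in> {1..n}" "j \<in> {1..n}" "z i = z j" "i \<noteq> j"
    have "x i - x j = 2 * pi * of_int (k j - k i)" using ij(3) by (simp add: z_def algebra_simps)
    then show False using nz ij by blast
  qed
  then obtain \<sigma> where \<sigma>: "\<sigma> permutes {1..n}" "\<And>i j. 1 \<le> i \<Longrightarrow> i < j \<Longrightarrow> j \<le> n \<Longrightarrow> z (\<sigma> j) < z (\<sigma> i)"
    using ex_sorting_permutation by blast
  have \<sigma>n: "\<sigma> i \<in> {1..n} \<longleftrightarrow> i \<in> {1..n}" for i using permutes_in_image[OF \<sigma>(1)] .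
  have k\<sigma>: "(\<Sum>j\<in>{1..n}. k (\<sigma> j)) = (\<Sum>j\<in>{1..n}. k j)" using sum.permute[OF \<sigma>(1), of k] by (simp add: o_def)
  have "k \<circ> \<sigma> \<in> root_lattice n" using k k\<sigma> permutes_not_in[OF \<sigma>(1)] by (auto simp: root_lattice_def)
  moreover have "(\<lambda>i. x (\<sigma> i) + 2 * pi * of_int ((k \<circ> \<sigma>) i)) \<in> alcove n"
  proof -
    have e: "(\<lambda>i. x (\<sigma> i) + 2 * pi * of_int ((k \<circ> \<sigma>) i)) = z \<circ> \<sigma>" by (auto simp: z_def)
    have "(\<Sum>j\<in>{1..n}. z (\<sigma> j)) = (\<Sum>j\<in>{1..n}. z j)" using sum.permute[OF \<sigma>(1), of z] by (simp add: o_def)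
    also have "\<dots> = (\<Sum>j\<in>{1..n}. x j) + 2 * pi * of_int (\<Sum>j\<in>{1..n}. k j)"
      by (simp add: z_def sum.distrib sum_distrib_left)
    also have "(\<Sum>j\<in>{1..n}. k j) = 0" using k by (simp add: root_lattice_def)
    finally have sz: "(\<Sum>j\<in>{1..n}. z (\<sigma> j)) = 0" using x(2) by simp
    have "z (\<sigma> j) = 0" if "j \<notin> {1..n}" for j
      using that x(1) permutes_not_in[OF \<sigma>(1) that] by (auto simp: z_def k_def vecs_def)
    moreover have "z (\<sigma> i) - z (\<sigma> j) < 2 * pi" if "i \<in> {1..n}" "j \<in> {1..n}" for i j
      using zd \<sigma>n that by blast
    ultimately show ?thesis unfolding e alcove_eq_chamber[OF n]
      using sz \<sigma>(2) by (auto simp: vecs_def chamber_def prs_def)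
  qed
  ultimately show ?thesis using \<sigma>(1) by blast
qed

text \<open>The image of one chamber in the torus; off the walls, the n! permuted copies of it
  partition the torus.\<close>

definition in_tile :: "nat \<Rightarrow> (nat \<Rightarrow> real) \<Rightarrow> bool" where
  "in_tile n x \<longleftrightarrow> (\<exists>k\<in>root_lattice n. (\<lambda>i. x i + 2 * pi * of_int (k i)) \<in> chamber n)"

lemma root_lattice_diff: "k \<in> root_lattice n \<Longrightarrow> l \<in> root_lattice n \<Longrightarrow> (\<lambda>i. k i - l i) \<in> root_lattice n"
  by (auto simp: root_lattice_def sum_subtractf)

lemma root_lattice_perm:
  assumes "k \<in> root_lattice n" "\<sigma> permutes {1..n}" shows "k \<circ> \<sigma> \<in> root_lattice n"
proof -
  have "(\<Sum>i\<in>{1..n}. k (\<sigma> i)) = (\<Sum>i\<in>{1..n}. k i)" using sum.permute[OF assms(2), of k] by (simp add: o_def)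
  then show ?thesis using assms by (auto simp: root_lattice_def permutes_not_in)
qed

lemma in_tile_shift:
  assumes k: "k \<in> root_lattice n"
  shows "in_tile n (\<lambda>i. x i + 2 * pi * of_int (k i)) \<longleftrightarrow> in_tile n x"
proof
  assume "in_tile n (\<lambda>i. x i + 2 * pi * of_int (k i))"
  then obtain l where l: "l \<in> root_lattice n" "(\<lambda>i. x i + 2 * pi * of_int (k i) + 2 * pi * of_int (l i)) \<in> chamber n"
    by (auto simp: in_tile_def)
  moreover have "(\<lambda>i. k i + l i) \<in> root_lattice n" using k l(1) by (auto simp: root_lattice_def sum.distrib)
  ultimately show "in_tile n x" unfolding in_tile_def
    by (intro bexI[of _ "\<lambda>i. k i + l i"]) (auto simp: algebra_simps)
next
  assume "in_tile n x"
  then obtain l where l: "l \<in> root_lattice n" "(\<lambda>i. x i + 2 * pi * of_int (l i)) \<in> chamber n"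
    by (auto simp: in_tile_def)
  then show "in_tile n (\<lambda>i. x i + 2 * pi * of_int (k i))" unfolding in_tile_def
    using root_lattice_diff[OF l(1) k]
    by (intro bexI[of _ "\<lambda>i. l i - k i"]) (auto simp: algebra_simps)
qed

lemma card_tile_perms:
  assumes n: "n \<ge> 2" and x: "x \<in> vecs n" "(\<Sum>j\<in>{1..n}. x j) = 0" and nw: "\<not> wall n x"
  shows "card {\<sigma>. \<sigma> permutes {1..n} \<and> in_tile n (x \<circ> \<sigma>)} = 1"
proof -
  obtain \<sigma> k where \<sigma>: "\<sigma> permutes {1..n}" "k \<in> root_lattice n" "(\<lambda>i. x (\<sigma> i) + 2 * pi * of_int (k i)) \<in> chamber n"
    using ex_affine_to_alcove[OF assms] by (auto simp: alcove_eq_chamber[OF n])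
  have "\<sigma>' = \<sigma>" if \<sigma>': "\<sigma>' permutes {1..n}" "in_tile n (x \<circ> \<sigma>')" for \<sigma>'
  proof -
    obtain k' where k': "k' \<in> root_lattice n" "(\<lambda>i. x (\<sigma>' i) + 2 * pi * of_int (k' i)) \<in> chamber n"
      using \<sigma>'(2) by (auto simp: in_tile_def)
    \<comment> \<open>Two representatives in the chamber differ by a permutation followed by a
      lattice shift, which must be trivial.\<close>
    define t where "t = inv \<sigma> \<circ> \<sigma>'"
    have t: "t permutes {1..n}" unfolding t_def using \<sigma>(1) \<sigma>'(1) permutes_compose permutes_inv by blast
    have st: "\<sigma> (t i) = \<sigma>' i" for i unfolding t_def using permutes_inverses(1)[OF \<sigma>(1)] by simp
    have K: "(\<lambda>i. k' i - (k \<circ> t) i) \<in> root_lattice n"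
      by (intro root_lattice_diff k' root_lattice_perm \<sigma> t)
    have "t = id"
    proof (rule chamber_affine_unique(1)[OF \<sigma>(3) _ t K])
      show "(\<lambda>i. x (\<sigma> (t i)) + 2 * pi * of_int (k (t i)) + 2 * pi * of_int (k' i - (k \<circ> t) i)) \<in> chamber n"
        using k'(2) by (simp add: st algebra_simps)
    qed (use n in simp)
    then show ?thesis using st by (simp add: fun_eq_iff)
  qed
  moreover have "in_tile n (x \<circ> \<sigma>)" using \<sigma> by (auto simp: in_tile_def)
  ultimately have "{\<sigma>. \<sigma> permutes {1..n} \<and> in_tile n (x \<circ> \<sigma>)} = {\<sigma>}" using \<sigma>(1) by blast
  then show ?thesis by simp
qed

lemma countable_root_lattice: "countable (root_lattice n)"
proof -
  have "root_lattice n \<subseteq> (\<lambda>f i. if i \<in> {1..n} then f i else 0) ` PiE {1..n} (\<lambda>_. UNIV)"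
  proof
    fix k assume k: "k \<in> root_lattice n"
    then show "k \<in> (\<lambda>f i. if i \<in> {1..n} then f i else 0) ` PiE {1..n} (\<lambda>_. UNIV)"
      by (intro image_eqI[of _ _ "restrict k {1..n}"]) (auto simp: root_lattice_def fun_eq_iff)
  qed
  moreover have "countable (PiE {1..n} (\<lambda>_. UNIV :: int set))" by (intro countable_PiE) auto
  ultimately show ?thesis by (rule countable_subset[OF _ countable_image])
qed

lemma sets_chamber_shift: "{x. (\<lambda>i. x i + c i) \<in> chamber n} \<in> sets borel"
proof -
  have "{x. (\<lambda>i. x i + c i) \<in> chamber n} = (\<Inter>p\<in>prs n. {x. 0 < x (fst p) + c (fst p) - (x (snd p) + c (snd p))} \<inter>
     {x. x (fst p) + c (fst p) - (x (snd p) + c (snd p)) < 2 * pi})"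
    unfolding chamber_def by force
  also have "open \<dots>" by (intro open_INT finite_prs ballI open_Int open_Collect_less continuous_intros)
  finally show ?thesis by simp
qed

lemma sets_in_tile: "{x. in_tile n x} \<in> sets borel"
proof -
  have "{x. in_tile n x} = (\<Union>k\<in>root_lattice n. {x. (\<lambda>i. x i + 2 * pi * of_int (k i)) \<in> chamber n})"
    by (auto simp: in_tile_def)
  then show ?thesis using sets_chamber_shift
    by (simp only:) (intro sets.countable_UN'[OF countable_root_lattice], auto)
qed

lemma torusfun_in_tile: "torusfun n (\<lambda>x. of_bool (in_tile n x))"
proof -
  have "(\<lambda>x. of_bool (in_tile n x) :: complex) = indicator {x. in_tile n x}" by (auto simp: fun_eq_iff indicator_def)
  then have "(\<lambda>x. of_bool (in_tile n x) :: complex) \<in> borel_measurable borel"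
    using sets_in_tile by simp
  moreover have "norm (of_bool (in_tile n x) :: complex) \<le> 1" for x by simp
  ultimately show ?thesis unfolding torusfun_def using in_tile_shift by auto
qed

lemma emb_facts:
  assumes "n \<ge> 2" shows "emb n y \<in> vecs n" "(\<Sum>j\<in>{1..n}. emb n y j) = 0"
proof -
  show "emb n y \<in> vecs n" using assms by (auto simp: vecs_def emb_def)
  have "(\<Sum>j\<in>{1..n}. emb n y j) = emb n y n + (\<Sum>j\<in>{1..n-1}. emb n y j)"
    using assms by (subst atLeast1_insert_last) auto
  also have "(\<Sum>j\<in>{1..n-1}. emb n y j) = (\<Sum>j\<in>{1..n-1}. y j)" by (intro sum.cong) (auto simp: emb_def)
  also have "emb n y n = - (\<Sum>j\<in>{1..n-1}. y j)" using assms by (auto simp: emb_def)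
  finally show "(\<Sum>j\<in>{1..n}. emb n y j) = 0" by simp
qed

text \<open>Off the walls the permuted tile indicators sum to 1; on the walls both sides vanish with
  \<open>h\<close>, so no null-set argument is needed. Each summand has the same integral by
  permutation invariance.\<close>

lemma tint_eq_tile:
  assumes n: "n \<ge> 2" and h: "torusfun n h" and sym: "\<And>\<sigma> x. \<sigma> permutes {1..n} \<Longrightarrow> h (x \<circ> \<sigma>) = h x"
    and van: "\<And>x. wall n x \<Longrightarrow> h x = 0"
  shows "tint n h = of_nat (fact n) * tint n (\<lambda>x. of_bool (in_tile n x) * h x)"
proof -
  let ?P = "{\<sigma>. \<sigma> permutes {1..n}}"
  have fP: "finite ?P" by (simp add: finite_permutations)
  have t: "torusfun n (\<lambda>x. of_bool (in_tile n x) * h x)" by (intro torusfun_mult torusfun_in_tile h)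
  have "tint n h = tint n (\<lambda>x. \<Sum>\<sigma>\<in>?P. of_bool (in_tile n (x \<circ> \<sigma>)) * h (x \<circ> \<sigma>))"
    unfolding tint_def
  proof (intro Bochner_Integration.integral_cong refl arg_cong2[where f = scaleR])
    fix y
    let ?x = "emb n y"
    show "h ?x = (\<Sum>\<sigma>\<in>?P. of_bool (in_tile n (?x \<circ> \<sigma>)) * h (?x \<circ> \<sigma>))"
    proof (cases "wall n ?x")
      case True
      then show ?thesis using sym van[OF True] by simp
    next
      case False
      have "(\<Sum>\<sigma>\<in>?P. of_bool (in_tile n (?x \<circ> \<sigma>)) * h (?x \<circ> \<sigma>)) = (\<Sum>\<sigma>\<in>?P. of_bool (in_tile n (?x \<circ> \<sigma>))) * h ?x"
        unfolding sum_distrib_right using sym by (intro sum.cong) auto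
      also have "(\<Sum>\<sigma>\<in>?P. of_bool (in_tile n (?x \<circ> \<sigma>))) = (1::complex)"
        using card_tile_perms[OF n emb_facts[OF n] False] fP
        by (subst sum_of_bool_eq) (auto simp: Int_def)
      finally have E: "(\<Sum>\<sigma>\<in>?P. of_bool (in_tile n (?x \<circ> \<sigma>)) * h (?x \<circ> \<sigma>)) = 1 * h ?x" .
      show ?thesis unfolding E by simp
    qed
  qed
  also have "\<dots> = (\<Sum>\<sigma>\<in>?P. tint n (\<lambda>x. of_bool (in_tile n (x \<circ> \<sigma>)) * h (x \<circ> \<sigma>)))"
    by (intro tint_sum) (use torusfun_perm[OF t] in auto)
  also have "\<dots> = (\<Sum>\<sigma>\<in>?P. tint n (\<lambda>x. of_bool (in_tile n x) * h x))"
    by (intro sum.cong refl) (use tint_perm[OF t] in auto)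
  also have "\<dots> = of_nat (fact n) * tint n (\<lambda>x. of_bool (in_tile n x) * h x)"
  proof -
    have "card ?P = fact n" by (rule card_permutations) auto
    then show ?thesis by (simp only: sum_constant)
  qed
  finally show ?thesis .
qed

section \<open>From the tile inside the box to the alcove itself\<close>

lemma distr_lebs_shift:
  "distr (lebs n) (lebs n) (\<lambda>y. \<lambda>i\<in>{1..n-1}. y i + c i) = lebs n"
  unfolding lebs_def
proof (rule lborels.PiM_eqI)
  let ?I = "{1..n-1}" let ?f = "\<lambda>y. \<lambda>i\<in>?I. y i + c i"
  fix A assume A: "\<And>i. i \<in> ?I \<Longrightarrow> A i \<in> sets (lborel :: real measure)"
  have m: "?f \<in> measurable (PiM ?I (\<lambda>_. lborel)) (PiM ?I (\<lambda>_. lborel :: real measure))"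
    by (rule measurable_restrict) auto
  have "emeasure (distr (PiM ?I (\<lambda>_. lborel)) (PiM ?I (\<lambda>_. lborel)) ?f) (PiE ?I A) =
     emeasure (PiM ?I (\<lambda>_. lborel)) (?f -` PiE ?I A \<inter> space (PiM ?I (\<lambda>_. lborel)))"
    by (rule emeasure_distr[OF m]) (use A in \<open>auto intro!: sets_PiM_I_finite\<close>)
  also have "?f -` PiE ?I A \<inter> space (PiM ?I (\<lambda>_. lborel)) = PiE ?I (\<lambda>i. (\<lambda>t. c i + t) -` A i)"
    by (auto simp: space_PiM PiE_def Pi_def extensional_def add.commute)
  also have "emeasure (PiM ?I (\<lambda>_. lborel)) \<dots> = (\<Prod>i\<in>?I. emeasure lborel ((\<lambda>t. c i + t) -` A i))"
    by (rule lborels.emeasure_PiM) (use A in \<open>auto intro!: measurable_sets_borel[where M = borel]\<close>)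
  also have "\<dots> = (\<Prod>i\<in>?I. emeasure lborel (A i))"
  proof (intro prod.cong refl)
    fix i assume i: "i \<in> ?I"
    have "emeasure lborel (A i) = emeasure (distr lborel borel ((+) (c i))) (A i)" by (simp add: lborel_distr_plus)
    also have "\<dots> = emeasure lborel ((+) (c i) -` A i \<inter> space lborel)" by (rule emeasure_distr) (use A[OF i] in auto)
    finally show "emeasure lborel ((\<lambda>t. c i + t) -` A i) = emeasure lborel (A i)" by simp
  qed
  finally show "emeasure (distr (PiM ?I (\<lambda>_. lborel)) (PiM ?I (\<lambda>_. lborel)) ?f) (PiE ?I A) = (\<Prod>i\<in>?I. emeasure lborel (A i))" .
qed auto

text \<open>All coordinates lie within 2 pi of one another, so one of modulus at least 2 pi would
  give all of them the same sign, against sum zero.\<close>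

lemma alcove_coord_bound:
  assumes n: "n \<ge> 2" and x: "x \<in> alcove n" and i: "i \<in> {1..n}"
  shows "- (2 * pi) < x i" "x i < 2 * pi"
proof -
  have c: "x \<in> chamber n" "(\<Sum>j\<in>{1..n}. x j) = 0" using x by (auto simp: alcove_eq_chamber[OF n])
  have d: "x i - 2 * pi < x j \<and> x j < x i + 2 * pi" if "j \<in> {1..n}" for j
    using chamberD[OF c(1), of i j] chamberD[OF c(1), of j i] i that pi_gt_zero
    by (cases i j rule: linorder_cases) (auto simp: algebra_simps)
  show "- (2 * pi) < x i"
  proof (rule ccontr)
    assume "\<not> ?thesis"
    then have "(\<Sum>j\<in>{1..n}. x j) < (\<Sum>j\<in>{1..n}. 0)"
      using d n by (intro sum_strict_mono) fastforce+
    then show False using c(2) by simp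
  qed
  show "x i < 2 * pi"
  proof (rule ccontr)
    assume "\<not> ?thesis"
    then have "(\<Sum>j\<in>{1..n}. 0) < (\<Sum>j\<in>{1..n}. x j)"
      using d n by (intro sum_strict_mono) fastforce+
    then show False using c(2) by simp
  qed
qed

text \<open>The alcove does not lie inside the box. It is cut by the translates of the box, and the
  pieces moved back into the box form the tile.\<close>

lemma alcove_integral:
  assumes n: "n \<ge> 2" and h: "torusfun n h" and sym: "\<And>\<sigma> x. \<sigma> permutes {1..n} \<Longrightarrow> h (x \<circ> \<sigma>) = h x"
    and van: "\<And>x. wall n x \<Longrightarrow> h x = 0"
  shows "of_nat (fact n) * (\<integral>y. indicator (alcove n) (emb n y) *\<^sub>R h (emb n y) \<partial>lebs n) = tint n h"
proof -
  let ?I = "{1..n-1}"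
  \<comment> \<open>Box coordinates lie in [0, 2 pi) and alcove coordinates in (-2 pi, 2 pi), so
    only these shifts lead from the box into the alcove.\<close>
  define Ks where "Ks = PiE ?I (\<lambda>_. {-1, 0::int})"
  define sh where "sh = (\<lambda>(k::nat \<Rightarrow> int) (y::nat \<Rightarrow> real). \<lambda>i\<in>?I. y i + 2 * pi * of_int (k i))"
  define g where "g y = indicator (alcove n) (emb n y) *\<^sub>R h (emb n y)" for y
  \<comment> \<open>Prolongs a shift of the free coordinates to a lattice vector.\<close>
  define ex where "ex k i = (if i \<in> ?I then k i else if i = n then - (\<Sum>j\<in>?I. k j) else 0)" for k :: "nat \<Rightarrow> int" and i
  have fK: "finite Ks" unfolding Ks_def by (intro finite_PiE) auto
  have ne: "n \<notin> ?I" using n by auto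
  have exr: "ex k \<in> root_lattice n" for k
  proof -
    have "(\<Sum>i\<in>{1..n}. ex k i) = ex k n + (\<Sum>i\<in>?I. ex k i)"
      using n by (subst atLeast1_insert_last) auto
    also have "(\<Sum>i\<in>?I. ex k i) = (\<Sum>i\<in>?I. k i)" by (intro sum.cong) (auto simp: ex_def)
    also have "ex k n = - (\<Sum>i\<in>?I. k i)" by (simp only: ex_def ne if_False if_True refl)
    finally show ?thesis using n by (auto simp: root_lattice_def ex_def)
  qed
  have emb_sh: "emb n (sh k y) = (\<lambda>i. emb n y i + 2 * pi * of_int (ex k i))" for k y
  proof
    fix i
    have "(\<Sum>j\<in>?I. sh k y j) = (\<Sum>j\<in>?I. y j) + 2 * pi * of_int (\<Sum>j\<in>?I. k j)"
      by (simp add: sh_def sum.distrib sum_distrib_left)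
    then show "emb n (sh k y) i = emb n y i + 2 * pi * of_int (ex k i)"
      using ne unfolding emb_def ex_def by (auto simp: sh_def algebra_simps)
  qed
  have hsh: "h (emb n (sh k y)) = h (emb n y)" for k y
    unfolding emb_sh by (rule torusfunD(3)[OF h exr])
  have cha: "emb n y \<in> chamber n \<longleftrightarrow> emb n y \<in> alcove n" for y
    using emb_facts[OF n, of y] by (auto simp: alcove_eq_chamber[OF n])
  have cell: "of_bool (in_tile n (emb n y)) * h (emb n y) = (\<Sum>k\<in>Ks. g (sh k y))" if y: "y \<in> tbox n" for y
  proof (cases "in_tile n (emb n y)")
    case True
    then obtain \<kappa> where \<kappa>: "\<kappa> \<in> root_lattice n" "(\<lambda>i. emb n y i + 2 * pi * of_int (\<kappa> i)) \<in> chamber n"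
      by (auto simp: in_tile_def)
    define k where "k = restrict \<kappa> ?I"
    have "(\<Sum>i\<in>{1..n}. \<kappa> i) = \<kappa> n + (\<Sum>i\<in>?I. \<kappa> i)"
      using n by (subst atLeast1_insert_last) auto
    then have "\<kappa> n = - (\<Sum>i\<in>?I. \<kappa> i)" using \<kappa>(1) by (simp add: root_lattice_def)
    then have exk: "ex k = \<kappa>"
    proof (intro ext)
      fix i assume a: "\<kappa> n = - (\<Sum>i\<in>?I. \<kappa> i)"
      show "ex k i = \<kappa> i" using a \<kappa>(1) unfolding ex_def k_def root_lattice_def
        by (cases "i \<in> ?I"; cases "i = n") auto
    qed
    have shk: "emb n (sh k y) \<in> alcove n" using \<kappa>(2) cha[of "sh k y"] unfolding emb_sh exk by blast
    have kK: "k \<in> Ks" unfolding Ks_def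
    proof (rule PiE_I)
      fix i assume i: "i \<in> ?I"
      have e: "emb n (sh k y) i = y i + 2 * pi * of_int (\<kappa> i)" unfolding emb_sh exk using i by (simp add: emb_def)
      have y01: "0 \<le> y i" "y i < 2 * pi" using y i by (auto simp: tbox_def PiE_def Pi_def)
      have "i \<in> {1..n}" using i by auto
      from alcove_coord_bound[OF n shk this] have "- (2 * pi) < y i + 2 * pi * of_int (\<kappa> i)" "y i + 2 * pi * of_int (\<kappa> i) < 2 * pi"
        unfolding e by auto
      then have "2 * pi * (-2) < 2 * pi * of_int (\<kappa> i)" "2 * pi * of_int (\<kappa> i) < 2 * pi * 1" using y01 by linarith+
      then have "-2 < real_of_int (\<kappa> i)" "real_of_int (\<kappa> i) < 1"
        by (simp_all only: mult_less_cancel_left_pos[OF mult_pos_pos[OF zero_less_numeral pi_gt_zero]])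
      then have "\<kappa> i \<in> {-1, 0}" by auto
      then show "k i \<in> {-1, 0}" using i by (simp add: k_def)
    qed (auto simp: k_def)
    have "g (sh k' y) = 0" if k': "k' \<in> Ks - {k}" for k'
    proof (rule ccontr)
      assume "g (sh k' y) \<noteq> 0"
      then have a: "emb n (sh k' y) \<in> alcove n" by (auto simp: g_def indicator_def split: if_splits)
      have "(\<lambda>i. ex k' i - ex k i) = (\<lambda>_. 0)"
      proof (rule chamber_affine_unique(2)[of "emb n (sh k y)" n id])
        show "emb n (sh k y) \<in> chamber n" using shk cha by blast
        have "(\<lambda>i. emb n (sh k y) (id i) + 2 * pi * of_int (ex k' i - ex k i)) = emb n (sh k' y)"
          unfolding emb_sh by (auto simp: algebra_simps)
        then show "(\<lambda>i. emb n (sh k y) (id i) + 2 * pi * of_int (ex k' i - ex k i)) \<in> chamber n" using a cha by simp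
      qed (use n exr root_lattice_diff permutes_id in auto)
      then have "ex k' i = ex k i" for i by (metis eq_iff_diff_eq_0)
      then have "k' i = k i" if "i \<in> ?I" for i using that by (metis ex_def)
      then have "k' = k" using k' kK unfolding Ks_def by (intro PiE_ext[of k' ?I _ k]) auto
      then show False using k' by simp
    qed
    then have "(\<Sum>k\<in>Ks. g (sh k y)) = g (sh k y)"
      using kK fK by (subst sum.remove[of _ k]) auto
    also have "\<dots> = h (emb n y)" using shk by (simp add: g_def hsh)
    finally show ?thesis using True by simp
  next
    case False
    have "g (sh k y) = 0" for k
    proof (rule ccontr)
      assume "g (sh k y) \<noteq> 0"
      then have "emb n (sh k y) \<in> chamber n" by (auto simp: g_def cha indicator_def split: if_splits)
      then show False using False exr unfolding emb_sh in_tile_def by blast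
    qed
    then show ?thesis using False by simp
  qed
  obtain B where B: "\<And>x. norm (h x) \<le> B" using torusfunD(2)[OF h] by auto
  have gm: "g \<in> borel_measurable (lebs n)"
  proof -
    have "indicator (alcove n) (emb n y) = (indicator (chamber n) (emb n y) :: real)" for y
      using cha by (auto simp: indicator_def)
    then have ge: "g y = indicator (chamber n) (emb n y) *\<^sub>R h (emb n y)" for y by (simp add: g_def)
    have "chamber n \<in> sets borel" using sets_chamber_shift[of "\<lambda>_. 0" n] by simp
    then have "(\<lambda>x. indicator (chamber n) x *\<^sub>R h x) \<in> borel_measurable borel"
      using torusfunD(1)[OF h] by simp
    from measurable_compose[OF measurable_emb this] show ?thesis unfolding ge[abs_def] .
  qed
  have gB: "norm (g y) \<le> B" for y
    unfolding g_def using B[of "emb n y"] order_trans[OF norm_ge_zero B] by (auto simp: indicator_def)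
  have shm: "sh k \<in> measurable (lebs n) (lebs n)" for k
    unfolding sh_def lebs_def by (rule measurable_restrict) auto
  have dist: "distr (lebs n) (lebs n) (sh k) = lebs n" for k
    unfolding sh_def by (rule distr_lebs_shift)
  have inv: "sh (\<lambda>i. - k i) (sh k y) = y" if "y \<in> space (lebs n)" for k y
    using that by (auto simp: sh_def lebs_def space_PiM PiE_def extensional_def fun_eq_iff)
  \<comment> \<open>The part of \<open>g\<close> on the points that the shift \<open>k\<close>
    reaches from the box.\<close>
  let ?F = "\<lambda>k y. indicator (tbox n) (sh (\<lambda>i. - k i) y) *\<^sub>R g y"
  have Fm: "?F k \<in> borel_measurable (lebs n)" for k
    using measurable_compose[OF shm[of "\<lambda>i. - k i"] borel_measurable_indicator[OF sets_tbox]] gm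
    by (intro borel_measurable_scaleR) (auto simp: o_def)
  have Fsh: "?F k (sh k y) = indicator (tbox n) y *\<^sub>R g (sh k y)" if "y \<in> space (lebs n)" for k y
    using inv[OF that] by simp
  have int1: "integrable (lebs n) (\<lambda>y. indicator (tbox n) y *\<^sub>R g (sh k y))" for k
    by (rule integrable_tbox[OF _ gB]) (rule measurable_compose[OF shm gm])
  have int2: "integrable (lebs n) (?F k)" for k
  proof -
    have "integrable (distr (lebs n) (lebs n) (sh k)) (?F k)"
      unfolding integrable_distr_eq[OF shm Fm]
      using int1[of k] Fsh by (subst Bochner_Integration.integrable_cong[OF refl, of _ _ "\<lambda>y. indicator (tbox n) y *\<^sub>R g (sh k y)"]) auto
    then show ?thesis unfolding dist .
  qed
  have eqF: "(\<integral>y. indicator (tbox n) y *\<^sub>R g (sh k y) \<partial>lebs n) = (\<integral>y. ?F k y \<partial>lebs n)" for k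
  proof -
    have "(\<integral>y. ?F k y \<partial>lebs n) = (\<integral>y. ?F k y \<partial>distr (lebs n) (lebs n) (sh k))" unfolding dist ..
    also have "\<dots> = (\<integral>y. ?F k (sh k y) \<partial>lebs n)" by (rule integral_distr[OF shm Fm])
    also have "\<dots> = (\<integral>y. indicator (tbox n) y *\<^sub>R g (sh k y) \<partial>lebs n)"
      by (rule Bochner_Integration.integral_cong[OF refl Fsh])
    finally show ?thesis ..
  qed
  have "tint n (\<lambda>x. of_bool (in_tile n x) * h x) = (\<integral>y. (\<Sum>k\<in>Ks. indicator (tbox n) y *\<^sub>R g (sh k y)) \<partial>lebs n)"
    unfolding tint_def
  proof (rule Bochner_Integration.integral_cong[OF refl])
    fix y show "indicator (tbox n) y *\<^sub>R (of_bool (in_tile n (emb n y)) * h (emb n y)) = (\<Sum>k\<in>Ks. indicator (tbox n) y *\<^sub>R g (sh k y))"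
      using cell[of y] by (cases "y \<in> tbox n") (auto simp flip: scaleR_sum_right)
  qed
  also have "\<dots> = (\<Sum>k\<in>Ks. \<integral>y. indicator (tbox n) y *\<^sub>R g (sh k y) \<partial>lebs n)"
    by (rule Bochner_Integration.integral_sum) (rule int1)
  also have "\<dots> = (\<integral>y. (\<Sum>k\<in>Ks. ?F k y) \<partial>lebs n)"
    unfolding eqF by (rule Bochner_Integration.integral_sum[symmetric]) (rule int2)
  also have "\<dots> = (\<integral>y. g y \<partial>lebs n)"
  proof (rule Bochner_Integration.integral_cong[OF refl])
    fix y assume y: "y \<in> space (lebs n)"
    show "(\<Sum>k\<in>Ks. ?F k y) = g y"
    proof (cases "g y = 0")
      case False
      then have a: "emb n y \<in> alcove n" by (auto simp: g_def indicator_def split: if_splits)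
      have yb: "- (2 * pi) < y i" "y i < 2 * pi" if "i \<in> ?I" for i
      proof -
        have "i \<in> {1..n}" using that by auto
        from alcove_coord_bound[OF n a this] show "- (2 * pi) < y i" "y i < 2 * pi" using that by (auto simp: emb_def)
      qed
      \<comment> \<open>Negative coordinates come from the box by the shift -1, the others by
        0.\<close>
      define k0 where "k0 = (\<lambda>i\<in>?I. if y i < 0 then -1 else 0 :: int)"
      have k0K: "k0 \<in> Ks" by (auto simp: Ks_def k0_def)
      have mem: "sh (\<lambda>i. - k i) y \<in> tbox n \<longleftrightarrow> k = k0" if k: "k \<in> Ks" for k
      proof
        assume m: "sh (\<lambda>i. - k i) y \<in> tbox n"
        have "k i = k0 i" if i: "i \<in> ?I" for i
        proof -
          have "sh (\<lambda>i. - k i) y i \<in> {0..<2*pi}" using m i unfolding tbox_def by (rule PiE_mem)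
          then have "0 \<le> y i - 2 * pi * of_int (k i)" "y i - 2 * pi * of_int (k i) < 2 * pi" using i by (auto simp: sh_def)
          moreover have "k i \<in> {-1, 0}" using k i unfolding Ks_def by (rule PiE_mem)
          ultimately show ?thesis using i yb[OF i] by (auto simp: k0_def)
        qed
        then show "k = k0" using k k0K unfolding Ks_def by (intro PiE_ext[of k ?I _ k0]) auto
      next
        assume "k = k0"
        then show "sh (\<lambda>i. - k i) y \<in> tbox n"
          unfolding tbox_def by (intro PiE_I) (use yb in \<open>auto simp: sh_def k0_def intro: less_imp_le\<close>)
      qed
      have "(\<Sum>k\<in>Ks. ?F k y) = (\<Sum>k\<in>Ks. if k = k0 then g y else 0)"
        using mem by (intro sum.cong) auto
      also have "\<dots> = g y" using k0K fK by simp
      finally show ?thesis .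
    qed simp
  qed
  finally show ?thesis using tint_eq_tile[OF assms] by (simp add: g_def)
qed

subsection \<open>Antisymmetrized phase sums\<close>

text \<open>The halved pair sum is the phase of \<open>Ca\<close>, up to a factor that changes only
  by a sign when the coordinates are permuted.\<close>

definition hl_phase :: "nat \<Rightarrow> real \<Rightarrow> (nat \<Rightarrow> real) \<Rightarrow> (nat \<Rightarrow> real) \<Rightarrow> real" where
  "hl_phase n q \<mu> x = (\<Sum>k\<in>{1..n}. \<mu> k * x k) + (\<Sum>(i,j)\<in>prs n. vq q (x i - x j)) / 2"

text \<open>Off the walls this is the Hall-Littlewood polynomial divided by a factor of modulus
  \<^term>\<open>cmod (Ca n q x)\<close>; unlike the latter it is a smooth expression everywhere.\<close>

definition Ah :: "nat \<Rightarrow> real \<Rightarrow> (nat \<Rightarrow> real) \<Rightarrow> (nat \<Rightarrow> real) \<Rightarrow> complex" where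
  "Ah n q \<mu> x = (\<Sum>\<sigma>\<in>{\<sigma>. \<sigma> permutes {1..n}}. of_real (inv_sign n \<sigma>) * cis (hl_phase n q \<mu> (x \<circ> \<sigma>)))"

lemma Ah_antisym:
  assumes t: "\<tau> permutes {1..n}"
  shows "Ah n q \<mu> (x \<circ> \<tau>) = of_real (inv_sign n \<tau>) * Ah n q \<mu> x"
proof -
  let ?P = "{\<sigma>. \<sigma> permutes {1..n}}"
  have "Ah n q \<mu> x = (\<Sum>\<sigma>\<in>?P. of_real (inv_sign n (\<tau> \<circ> \<sigma>)) * cis (hl_phase n q \<mu> (x \<circ> (\<tau> \<circ> \<sigma>))))"
    unfolding Ah_def by (rule setum_permutations_compose_left[OF t])
  also have "\<dots> = (\<Sum>\<sigma>\<in>?P. of_real (inv_sign n \<tau>) * (of_real (inv_sign n \<sigma>) * cis (hl_phase n q \<mu> (x \<circ> \<tau> \<circ> \<sigma>))))"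
    by (intro sum.cong refl) (auto simp: inv_sign_compose[OF t] o_assoc)
  also have "\<dots> = of_real (inv_sign n \<tau>) * Ah n q \<mu> (x \<circ> \<tau>)"
    unfolding Ah_def sum_distrib_left ..
  finally have "of_real (inv_sign n \<tau>) * Ah n q \<mu> x = of_real (inv_sign n \<tau> * inv_sign n \<tau>) * Ah n q \<mu> (x \<circ> \<tau>)"
    by (simp only: of_real_mult mult.assoc)
  then show ?thesis by simp
qed

text \<open>Modulo 2 the differences may be replaced by sums, and those add up to n-1 times the
  total, which is 0. Evenness compensates for the half in \<open>hl_phase\<close>.\<close>

lemma sum_prs_diff_even:
  fixes a :: "nat \<Rightarrow> int"
  assumes "(\<Sum>i\<in>{1..n}. a i) = 0"
  shows "(\<Sum>(i,j)\<in>prs n. a i - a j) = - 2 * (\<Sum>(i,j)\<in>prs n. a j)"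
proof -
  have "(\<Sum>(i,j)\<in>prs n. a i + a j) = (\<Sum>j\<in>{1..n}. \<Sum>k\<in>{1..n}-{j}. a j)"
    using sum_offdiag_prs[of "\<lambda>j k. a j" n] by simp
  also have "\<dots> = int (n - 1) * (\<Sum>j\<in>{1..n}. a j)"
    by (simp add: sum_distrib_left)
  finally have "(\<Sum>(i,j)\<in>prs n. a i + a j) = 0" using assms by simp
  moreover have "(\<Sum>(i,j)\<in>prs n. a i - a j) = (\<Sum>(i,j)\<in>prs n. a i + a j) - 2 * (\<Sum>(i,j)\<in>prs n. a j)"
    by (simp add: sum_subtractf sum.distrib case_prod_unfold)
  ultimately show ?thesis by simp
qed

lemma cis_hl_phase_periodic:
  assumes q: "\<bar>q\<bar> < 1" and n: "n \<ge> 1" and \<mu>: "intdiff n \<mu>" and k: "k \<in> root_lattice n"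
  shows "cis (hl_phase n q \<mu> (\<lambda>i. x i + 2 * pi * of_int (k i))) = cis (hl_phase n q \<mu> x)"
proof (rule cis_cong_2pi)
  define S where "S = (\<Sum>(i,j)\<in>prs n. k j)"
  let ?r = "(\<Sum>j\<in>{1..n}. \<mu> j * of_int (k j)) - of_int S"
  let ?x = "\<lambda>i. x i + 2 * pi * of_int (k i)"
  show "?r \<in> \<int>" by (intro Ints_diff intdiff_pairing[OF \<mu> k n] Ints_of_int)
  have "(\<Sum>(i,j)\<in>prs n. vq q (?x i - ?x j)) = (\<Sum>(i,j)\<in>prs n. vq q (x i - x j) + 2 * pi * of_int (k i - k j))"
  proof (intro sum.cong refl, clarify)
    fix i j show "vq q (?x i - ?x j) = vq q (x i - x j) + 2 * pi * of_int (k i - k j)"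
      using vq_add_int[OF q, of "x i - x j" "k i - k j"] by (simp add: algebra_simps)
  qed
  also have "\<dots> = (\<Sum>(i,j)\<in>prs n. vq q (x i - x j)) + 2 * pi * of_int (\<Sum>(i,j)\<in>prs n. k i - k j)"
    by (simp add: sum.distrib sum_distrib_left case_prod_unfold)
  also have "(\<Sum>(i,j)\<in>prs n. k i - k j) = - 2 * S"
    unfolding S_def by (rule sum_prs_diff_even) (use k in \<open>simp add: root_lattice_def\<close>)
  finally have "(\<Sum>(i,j)\<in>prs n. vq q (?x i - ?x j)) = (\<Sum>(i,j)\<in>prs n. vq q (x i - x j)) + 2 * pi * of_int (- 2 * S)" .
  then show "hl_phase n q \<mu> ?x = hl_phase n q \<mu> x + 2 * pi * ?r"
    unfolding hl_phase_def by (simp add: distrib_left right_diff_distrib sum.distrib sum_distrib_left add_divide_distrib diff_divide_distrib mult_ac)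
qed

lemma Ah_periodic:
  assumes q: "\<bar>q\<bar> < 1" and n: "n \<ge> 1" and \<mu>: "intdiff n \<mu>" and k: "k \<in> root_lattice n"
  shows "Ah n q \<mu> (\<lambda>i. x i + 2 * pi * of_int (k i)) = Ah n q \<mu> x"
  unfolding Ah_def
proof (intro sum.cong refl)
  fix \<sigma> assume "\<sigma> \<in> {\<sigma>. \<sigma> permutes {1..n}}"
  then have s: "\<sigma> permutes {1..n}" by simp
  have "(\<lambda>i. x i + 2 * pi * of_int (k i)) \<circ> \<sigma> = (\<lambda>i. (x \<circ> \<sigma>) i + 2 * pi * of_int ((k \<circ> \<sigma>) i))" by auto
  then show "of_real (inv_sign n \<sigma>) * cis (hl_phase n q \<mu> ((\<lambda>i. x i + 2 * pi * of_int (k i)) \<circ> \<sigma>)) =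
     of_real (inv_sign n \<sigma>) * cis (hl_phase n q \<mu> (x \<circ> \<sigma>))"
    using cis_hl_phase_periodic[OF q n \<mu> root_lattice_perm[OF k s], of "x \<circ> \<sigma>"] by simp
qed

text \<open>On a wall some transposition acts as a lattice translation, so antisymmetry and
  periodicity give A = -A.\<close>

lemma Ah_wall:
  assumes q: "\<bar>q\<bar> < 1" and n: "n \<ge> 1" and \<mu>: "intdiff n \<mu>" and w: "wall n x"
  shows "Ah n q \<mu> x = 0"
proof -
  obtain a b z where ab: "a \<in> {1..n}" "b \<in> {1..n}" "a \<noteq> b" "x a - x b = 2 * pi * of_int z"
    using w unfolding wall_def by blast
  define k where "k i = (if i = a then - z else if i = b then z else 0)" for i
  have "(\<Sum>i\<in>{1..n}. k i) = (\<Sum>i\<in>{a, b}. k i)"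
    by (rule sum.mono_neutral_right) (use ab in \<open>auto simp: k_def\<close>)
  then have k: "k \<in> root_lattice n" using ab by (auto simp: root_lattice_def k_def)
  have t: "Transposition.transpose a b permutes {1..n}" using ab by (auto intro!: permutes_swap_id)
  have "x \<circ> Transposition.transpose a b = (\<lambda>i. x i + 2 * pi * of_int (k i))"
    using ab(3,4) by (auto simp: fun_eq_iff k_def Transposition.transpose_def)
  then have "Ah n q \<mu> x = of_real (inv_sign n (Transposition.transpose a b)) * Ah n q \<mu> x"
    using Ah_antisym[OF t, of q \<mu> x] Ah_periodic[OF q n \<mu> k, of x] by simp
  then show ?thesis using inv_sign_transpose[OF ab(1-3)] by simp
qed

lemma hl_phase_perm:
  assumes q: "\<bar>q\<bar> < 1" and s: "\<sigma> permutes {1..n}"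
  shows "hl_phase n q \<mu> (x \<circ> \<sigma>) = (\<Sum>j\<in>{1..n}. \<mu> (inv \<sigma> j) * x j) +
     (\<Sum>(j,k)\<in>prs n. (if inv \<sigma> j < inv \<sigma> k then 1 else -1) * vq q (x j - x k)) / 2"
proof -
  have "(\<Sum>k\<in>{1..n}. \<mu> k * x (\<sigma> k)) = (\<Sum>j\<in>{1..n}. \<mu> (inv \<sigma> j) * x j)"
    using sum.permute[OF permutes_inv[OF s], of "\<lambda>k. \<mu> k * x (\<sigma> k)"] permutes_inverses[OF s] by (simp add: o_def)
  moreover have "(\<Sum>(i,j)\<in>prs n. vq q (x (\<sigma> i) - x (\<sigma> j))) =
    (\<Sum>(j,k)\<in>prs n. if inv \<sigma> j < inv \<sigma> k then vq q (x j - x k) else vq q (x k - x j))"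
    by (rule sum.pairs_reindex[OF s])
  moreover have "(if b then vq q (x j - x k) else vq q (x k - x j)) = (if b then 1 else -1) * vq q (x j - x k)" for b j k
    using vq_minus[OF q, of "x j - x k"] by simp
  ultimately show ?thesis by (simp add: hl_phase_def)
qed

text \<open>Half the difference of two orientation signs. It lies in {-1, 0, 1}, just what
  \<open>nonres_Tmon\<close> tolerates.\<close>

definition eps2 :: "(nat \<Rightarrow> nat) \<Rightarrow> (nat \<Rightarrow> nat) \<Rightarrow> nat \<Rightarrow> nat \<Rightarrow> int" where
  "eps2 \<sigma> \<tau> j k = (if inv \<sigma> j < inv \<sigma> k then (if inv \<tau> j < inv \<tau> k then 0 else 1)
      else (if inv \<tau> j < inv \<tau> k then -1 else 0))"

lemma cis_hl_phase_mult_cnj: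
  assumes q: "\<bar>q\<bar> < 1" and s: "\<sigma> permutes {1..n}" and t: "\<tau> permutes {1..n}"
  shows "cis (hl_phase n q \<mu> (x \<circ> \<sigma>)) * cnj (cis (hl_phase n q \<nu> (x \<circ> \<tau>))) =
    Tmon n q (\<lambda>j. \<mu> (inv \<sigma> j) - \<nu> (inv \<tau> j)) (eps2 \<sigma> \<tau>) x"
proof -
  have "(\<Sum>(j,k)\<in>prs n. of_int (eps2 \<sigma> \<tau> j k) * vq q (x j - x k)) =
     (\<Sum>(j,k)\<in>prs n. (if inv \<sigma> j < inv \<sigma> k then 1 else -1) * vq q (x j - x k) / 2 
         - (if inv \<tau> j < inv \<tau> k then 1 else -1) * vq q (x j - x k) / 2)"
    by (intro sum.cong refl) (auto simp: eps2_def)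
  then show ?thesis
    unfolding hl_phase_perm[OF q s] hl_phase_perm[OF q t] cis_cnj cis_mult Tmon_def
    by (intro arg_cong[where f = cis])
       (simp add: left_diff_distrib sum_subtractf case_prod_unfold sum_divide_distrib)
qed

lemma intdiff_perm_diff:
  assumes "intdiff n \<mu>" "intdiff n \<nu>" "\<sigma> permutes {1..n}" "\<tau> permutes {1..n}"
  shows "intdiff n (\<lambda>j. \<mu> (\<sigma> j) - \<nu> (\<tau> j))"
  unfolding intdiff_def
proof (intro ballI)
  fix i j assume ij: "i \<in> {1..n}" "j \<in> {1..n}"
  have "\<mu> (\<sigma> i) - \<mu> (\<sigma> j) \<in> \<int>" "\<nu> (\<tau> i) - \<nu> (\<tau> j) \<in> \<int>"
    using assms(1,2) ij permutes_in_image[OF assms(3)] permutes_in_image[OF assms(4)] unfolding intdiff_def by blast+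
  then have "(\<mu> (\<sigma> i) - \<mu> (\<sigma> j)) - (\<nu> (\<tau> i) - \<nu> (\<tau> j)) \<in> \<int>" by (rule Ints_diff)
  then show "\<mu> (\<sigma> i) - \<nu> (\<tau> i) - (\<mu> (\<sigma> j) - \<nu> (\<tau> j)) \<in> \<int>" by (simp add: algebra_simps)
qed

lemma Ah_mult_cnj:
  assumes q: "\<bar>q\<bar> < 1"
  shows "Ah n q \<mu> x * cnj (Ah n q \<nu> x) = (\<Sum>\<sigma>\<in>{\<sigma>. \<sigma> permutes {1..n}}. \<Sum>\<tau>\<in>{\<tau>. \<tau> permutes {1..n}}.
     of_real (inv_sign n \<sigma> * inv_sign n \<tau>) * Tmon n q (\<lambda>j. \<mu> (inv \<sigma> j) - \<nu> (inv \<tau> j)) (eps2 \<sigma> \<tau>) x)"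
  unfolding Ah_def cnj_sum sum_product
proof (intro sum.cong refl)
  fix \<sigma> \<tau> assume "\<sigma> \<in> {\<sigma>. \<sigma> permutes {1..n}}" "\<tau> \<in> {\<tau>. \<tau> permutes {1..n}}"
  then show "of_real (inv_sign n \<sigma>) * cis (hl_phase n q \<mu> (x \<circ> \<sigma>)) * cnj (of_real (inv_sign n \<tau>) * cis (hl_phase n q \<nu> (x \<circ> \<tau>))) =
     of_real (inv_sign n \<sigma> * inv_sign n \<tau>) * Tmon n q (\<lambda>j. \<mu> (inv \<sigma> j) - \<nu> (inv \<tau> j)) (eps2 \<sigma> \<tau>) x"
    using cis_hl_phase_mult_cnj[OF q, of \<sigma> n \<tau> \<mu> x \<nu>] by (simp add: mult_ac)
qed

lemma continuous_Ah: "\<bar>q\<bar> < 1 \<Longrightarrow> continuous_on S (Ah n q \<mu>)"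
  unfolding Ah_def[abs_def] hl_phase_def case_prod_unfold o_def by (intro continuous_intros) auto

subsection \<open>The class of admissible integrands\<close>

text \<open>\<open>nonres\<close> and continuity feed the kernel argument; symmetry and vanishing on
  the walls allow passing between torus and alcove.\<close>

definition admissible :: "nat \<Rightarrow> nat \<Rightarrow> real \<Rightarrow> ((nat \<Rightarrow> real) \<Rightarrow> complex) \<Rightarrow> bool" where
  "admissible m n q h \<longleftrightarrow> nonres m n q h \<and> continuous_on UNIV h \<and>
     (\<forall>\<sigma> x. \<sigma> permutes {1..n} \<longrightarrow> h (x \<circ> \<sigma>) = h x) \<and> (\<forall>x. wall n x \<longrightarrow> h x = 0)"

lemma admissible_add:
  "\<lbrakk>\<bar>q\<bar> < 1; n \<ge> 2; admissible m n q g; admissible m n q h\<rbrakk> \<Longrightarrow> admissible m n q (\<lambda>x. g x + h x)"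
  unfolding admissible_def by (auto intro!: nonres_add continuous_intros)

lemma admissible_cmult:
  "admissible m n q h \<Longrightarrow> admissible m n q (\<lambda>x. c * h x)"
  unfolding admissible_def by (auto intro!: nonres_cmult continuous_intros)

lemma admissible_sum:
  assumes "\<bar>q\<bar> < 1" "n \<ge> 2" "\<And>a. a \<in> A \<Longrightarrow> admissible m n q (F a)"
  shows "admissible m n q (\<lambda>x. \<Sum>a\<in>A. F a x)"
  using assms(3)
proof (induction A rule: infinite_finite_induct)
  case (insert a A)
  then show ?case using admissible_add[OF assms(1,2)] by auto
qed (auto simp: admissible_def nonres_def)

text \<open>The levels m and m - 1 add up to the critical degree 2m - 1; two weights of level m
  would exceed it.\<close>

lemma admissible_Ah:
  assumes q: "\<bar>q\<bar> < 1" and n: "n \<ge> 2" and m: "m > 0" and \<mu>: "intdiff n \<mu>" and \<nu>: "intdiff n \<nu>"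
    and lm: "\<And>i j. \<lbrakk>i \<in> {1..n}; j \<in> {1..n}\<rbrakk> \<Longrightarrow> \<mu> i - \<mu> j \<le> real m"
    and ln: "\<And>i j. \<lbrakk>i \<in> {1..n}; j \<in> {1..n}\<rbrakk> \<Longrightarrow> \<nu> i - \<nu> j \<le> real m - 1"
  shows "admissible m n q (\<lambda>x. Ah n q \<mu> x * cnj (Ah n q \<nu> x))"
  unfolding admissible_def
proof (intro conjI allI impI)
  show "nonres m n q (\<lambda>x. Ah n q \<mu> x * cnj (Ah n q \<nu> x))"
    unfolding Ah_mult_cnj[OF q]
  proof (intro nonres_sum[OF q n] nonres_cmult nonres_Tmon[OF q n m])
    fix \<sigma> \<tau> assume "\<sigma> \<in> {\<sigma>. \<sigma> permutes {1..n}}" "\<tau> \<in> {\<tau>. \<tau> permutes {1..n}}"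
    then have p: "inv \<sigma> permutes {1..n}" "inv \<tau> permutes {1..n}" by (auto intro: permutes_inv)
    show "intdiff n (\<lambda>j. \<mu> (inv \<sigma> j) - \<nu> (inv \<tau> j))" by (rule intdiff_perm_diff[OF \<mu> \<nu> p])
    fix j k assume jk: "j \<in> {1..n}" "k \<in> {1..n}"
    show "\<mu> (inv \<sigma> j) - \<nu> (inv \<tau> j) - (\<mu> (inv \<sigma> k) - \<nu> (inv \<tau> k)) \<le> 2 * real m - 1"
      using lm[of "inv \<sigma> j" "inv \<sigma> k"] ln[of "inv \<tau> k" "inv \<tau> j"] jk
        permutes_in_image[OF p(1)] permutes_in_image[OF p(2)] by fastforce
  qed (auto simp: eps2_def)
  show "continuous_on UNIV (\<lambda>x. Ah n q \<mu> x * cnj (Ah n q \<nu> x))"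
    by (intro continuous_intros continuous_Ah q)
  show "Ah n q \<mu> x * cnj (Ah n q \<nu> x) = 0" if "wall n x" for x
    using Ah_wall[OF q _ \<mu> that] n by simp
  fix \<sigma> x assume s: "\<sigma> permutes {1..n}"
  have "Ah n q \<mu> (x \<circ> \<sigma>) * cnj (Ah n q \<nu> (x \<circ> \<sigma>)) = of_real (inv_sign n \<sigma> * inv_sign n \<sigma>) * (Ah n q \<mu> x * cnj (Ah n q \<nu> x))"
    unfolding Ah_antisym[OF s] by (simp only: complex_cnj_mult complex_cnj_complex_of_real of_real_mult mult_ac)
  then show "Ah n q \<mu> (x \<circ> \<sigma>) * cnj (Ah n q \<nu> (x \<circ> \<sigma>)) = Ah n q \<mu> x * cnj (Ah n q \<nu> x)" by simp
qed

text \<open>The product of |1 - cis(vq)|^2 over pairs, which is |C|^-2 up to a factor (1+q)^2 per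
  pair.\<close>

definition Wt :: "nat \<Rightarrow> real \<Rightarrow> (nat \<Rightarrow> real) \<Rightarrow> real" where
  "Wt n q x = (\<Prod>(j,k)\<in>prs n. 2 - 2 * cos (vq q (x j - x k)))"

text \<open>Each factor is 2 - cis(v) - cis(-v), so every pair phase occurs with exponent -1, 0 or
  1.\<close>

lemma Wt_expand:
  "cis (\<Sum>j\<in>{1..n}. \<nu> j * x j) * complex_of_real (Wt n q x) =
     (\<Sum>e\<in>PiE (prs n) (\<lambda>_. {-1, 0, 1}). of_real (\<Prod>p\<in>prs n. if e p = 0 then 2 else -1) * Tmon n q \<nu> (\<lambda>j k. e (j, k)) x)"
proof -
  have 1: "complex_of_real (2 - 2 * cos v) = (\<Sum>e\<in>{-1, 0, 1::int}. of_real (if e = 0 then 2 else -1) * cis (of_int e * v))" for v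
    by (simp add: complex_eq_iff)
  have "complex_of_real (Wt n q x) = (\<Prod>p\<in>prs n. \<Sum>e\<in>{-1, 0, 1::int}. of_real (if e = 0 then 2 else -1) * cis (of_int e * vq q (x (fst p) - x (snd p))))"
    unfolding Wt_def of_real_prod case_prod_unfold 1 ..
  also have "\<dots> = (\<Sum>e\<in>PiE (prs n) (\<lambda>_. {-1, 0, 1}). \<Prod>p\<in>prs n. of_real (if e p = 0 then 2 else -1) * cis (of_int (e p) * vq q (x (fst p) - x (snd p))))"
    by (rule prod_sum_PiE) auto
  also have "\<dots> = (\<Sum>e\<in>PiE (prs n) (\<lambda>_. {-1, 0, 1}). of_real (\<Prod>p\<in>prs n. if e p = 0 then 2 else -1) * cis (\<Sum>(j,k)\<in>prs n. of_int (e (j, k)) * vq q (x j - x k)))"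
    unfolding prod.distrib cis_sum of_real_prod by (simp add: case_prod_unfold)
  finally show ?thesis
    unfolding Tmon_def cis_mult[symmetric] by (simp add: sum_distrib_left mult_ac)
qed

lemma exp_eq_cis: "exp (\<i> * complex_of_real r) = cis r"
  by (simp add: cis_conv_exp)

lemma Msym_perm:
  assumes s: "\<sigma> permutes {1..n}"
  shows "Msym n \<mu> (x \<circ> \<sigma>) = Msym n \<mu> x"
proof -
  let ?O = "{\<mu> \<circ> \<tau> | \<tau>. \<tau> permutes {1..n}}"
  have si: "inv \<sigma> permutes {1..n}" by (rule permutes_inv[OF s])
  have O: "\<nu> \<circ> \<pi> \<in> ?O" if "\<nu> \<in> ?O" "\<pi> permutes {1..n}" for \<nu> \<pi>
    using that permutes_compose by (smt (verit, best) mem_Collect_eq comp_assoc)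
  show ?thesis unfolding Msym_def
  proof (rule sum.reindex_bij_witness[where i = "\<lambda>\<nu>. \<nu> \<circ> \<sigma>" and j = "\<lambda>\<nu>. \<nu> \<circ> inv \<sigma>"])
    fix \<nu> assume \<nu>: "\<nu> \<in> ?O"
    show "\<nu> \<circ> inv \<sigma> \<in> ?O" "\<nu> \<circ> \<sigma> \<in> ?O" using O[OF \<nu>] s si by blast+
    show "\<nu> \<circ> inv \<sigma> \<circ> \<sigma> = \<nu>" "\<nu> \<circ> \<sigma> \<circ> inv \<sigma> = \<nu>"
      using permutes_inv_o[OF s] by (simp_all add: comp_assoc)
    have "(\<Sum>k\<in>{1..n}. (\<nu> \<circ> inv \<sigma>) k * x k) = (\<Sum>k\<in>{1..n}. \<nu> k * (x \<circ> \<sigma>) k)"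
      using sum.permute[OF s, of "\<lambda>k. \<nu> (inv \<sigma> k) * x k"] permutes_inverses[OF s] by (simp add: o_def)
    then show "exp (\<i> * complex_of_real (\<Sum>k\<in>{1..n}. (\<nu> \<circ> inv \<sigma>) k * x k)) = exp (\<i> * complex_of_real (\<Sum>k\<in>{1..n}. \<nu> k * (x \<circ> \<sigma>) k))"
      by simp
  qed
qed

lemma continuous_Msym: "continuous_on S (Msym n \<mu>)"
  unfolding Msym_def[abs_def] by (intro continuous_intros)

lemma continuous_Wt: "\<bar>q\<bar> < 1 \<Longrightarrow> continuous_on S (Wt n q)"
  unfolding Wt_def[abs_def] case_prod_unfold by (intro continuous_intros)

lemma Wt_perm:
  assumes q: "\<bar>q\<bar> < 1" and s: "\<sigma> permutes {1..n}"
  shows "Wt n q (x \<circ> \<sigma>) = Wt n q x"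
proof -
  have "cos (vq q (x k - x j)) = cos (vq q (x j - x k))" for j k
    using vq_minus[OF q, of "x j - x k"] by simp
  then have "(if b then 2 - 2 * cos (vq q (x j - x k)) else 2 - 2 * cos (vq q (x k - x j))) = 2 - 2 * cos (vq q (x j - x k))"
    for b j k by simp
  then show ?thesis unfolding Wt_def o_def
    using prod.pairs_reindex[OF s, of "\<lambda>i j. 2 - 2 * cos (vq q (x i - x j))"] by (simp only:)
qed

lemma Wt_wall:
  assumes q: "\<bar>q\<bar> < 1" and w: "wall n x"
  shows "Wt n q x = 0"
proof -
  obtain a b z where ab: "a \<in> {1..n}" "b \<in> {1..n}" "a \<noteq> b" "x a - x b = 2 * pi * of_int z"
    using w unfolding wall_def by blast
  have v: "cos (vq q (2 * pi * of_int z)) = 1" for z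
    using vq_add_int[OF q, of 0 z] by (simp add: cos_int_2pin)
  have "x b - x a = 2 * pi * of_int (- z)" using ab(4) by simp
  then have "cos (vq q (x a - x b)) = 1" "cos (vq q (x b - x a)) = 1" using v[of z] v[of "- z"] ab(4) by metis+
  moreover have "(a, b) \<in> prs n \<or> (b, a) \<in> prs n" using ab by (auto simp: prs_mem)
  ultimately show ?thesis unfolding Wt_def by (force simp: prod_zero_iff)
qed

lemma admissible_Msym:
  assumes q: "\<bar>q\<bar> < 1" and n: "n \<ge> 2" and m: "m > 0" and \<mu>: "intdiff n \<mu>"
    and lm: "\<And>i j. \<lbrakk>i \<in> {1..n}; j \<in> {1..n}\<rbrakk> \<Longrightarrow> \<mu> i - \<mu> j \<le> 2 * real m - 1"
  shows "admissible m n q (\<lambda>x. Msym n \<mu> x * complex_of_real (Wt n q x))"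
  unfolding admissible_def
proof (intro conjI allI impI)
  show "nonres m n q (\<lambda>x. Msym n \<mu> x * complex_of_real (Wt n q x))"
    unfolding Msym_def sum_distrib_right exp_eq_cis Wt_expand
  proof (intro nonres_sum[OF q n] nonres_cmult nonres_Tmon[OF q n m])
    fix \<nu> assume "\<nu> \<in> {\<mu> \<circ> \<tau> | \<tau>. \<tau> permutes {1..n}}"
    then obtain \<tau> where t: "\<nu> = \<mu> \<circ> \<tau>" "\<tau> permutes {1..n}" by blast
    show "intdiff n \<nu>" using \<mu> permutes_in_image[OF t(2)] unfolding intdiff_def t(1) by (simp del: atLeastAtMost_iff)
    show "\<nu> j - \<nu> k \<le> 2 * real m - 1" if "j \<in> {1..n}" "k \<in> {1..n}" for j k
      using lm that permutes_in_image[OF t(2)] unfolding t(1) by (simp del: atLeastAtMost_iff)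
    fix e j k assume "e \<in> PiE (prs n) (\<lambda>_. {-1, 0, 1::int})" "(j, k) \<in> prs n"
    then have "e (j, k) \<in> {-1, 0, 1}" by (rule PiE_mem)
    then show "\<bar>e (j, k)\<bar> \<le> 1" by auto
  qed
  show "continuous_on UNIV (\<lambda>x. Msym n \<mu> x * complex_of_real (Wt n q x))"
    by (intro continuous_intros continuous_Msym continuous_Wt q)
qed (simp_all add: Msym_perm Wt_perm[OF q] Wt_wall[OF q])

lemma nonres_one:
  assumes q: "\<bar>q\<bar> < 1" and n: "n \<ge> 2" and m: "m > 0"
  shows "nonres m n q (\<lambda>_. 1)"
proof -
  have "nonres m n q (Tmon n q (\<lambda>_. 0) (\<lambda>_ _. 0))"
    by (rule nonres_Tmon[OF q n m]) (use m in \<open>auto simp: intdiff_def\<close>)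
  then show ?thesis by (simp add: Tmon_def[abs_def])
qed

subsection \<open>Comparison with the Hall-Littlewood polynomials\<close>

definition cfac :: "real \<Rightarrow> real \<Rightarrow> complex" where
  "cfac q t = (1 - of_real q * cis (- t)) / (1 - cis (- t))"

lemma Ca_eq: "Ca n q x = (\<Prod>(j,k)\<in>prs n. cfac q (x j - x k))"
proof -
  have e: "exp (- \<i> * complex_of_real t) = cis (- t)" for t by (simp add: cis_conv_exp)
  show ?thesis unfolding Ca_def e cfac_def[symmetric] prs_Sigma by (rule prod.Sigma) auto
qed

lemma one_minus_q_cis_ne: "\<bar>q\<bar> < 1 \<Longrightarrow> 1 - of_real q * cis t \<noteq> 0"
  using one_minus_q_cos_pos[of q t] by (auto simp: complex_eq_iff)

text \<open>With z = cis(t), \<open>cfac\<close> is (z - q)/(z - 1), and reversing a pair costs only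
  a sign and a phase. The modulus follows from 1 - cis(vq) = (1 + q)(1 - z)/(1 - q z) together with
  |1 - q z| = |z - q|.\<close>

lemma cfac_props:
  assumes q: "\<bar>q\<bar> < 1" and t: "cis t \<noteq> 1"
  shows "cfac q (- t) = - cis (- vq q t) * cfac q t" "cfac q t \<noteq> 0"
    "inverse ((cmod (cfac q t))\<^sup>2) = (2 - 2 * cos (vq q t)) / (1 + q)\<^sup>2"
proof -
  define z where "z = cis t"
  have z: "z \<noteq> 0" "z \<noteq> 1" using t by (auto simp: z_def)
  have z3: "cis (-t) = 1 / z" unfolding z_def by (simp only: inverse_eq_divide[symmetric] cis_inverse)
  have n1: "1 - of_real q * z \<noteq> 0" "1 - of_real q / z \<noteq> 0"
    using one_minus_q_cis_ne[OF q, of t] one_minus_q_cis_ne[OF q, of "-t"] z3 by (auto simp: z_def)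
  then have n2: "z - of_real q \<noteq> 0" using z by (auto simp: field_simps)
  have c: "cfac q t = (z - of_real q) / (z - 1)" unfolding cfac_def z3 using z by (simp add: field_simps)
  have c': "cfac q (-t) = (1 - of_real q * z) / (1 - z)" unfolding cfac_def by (simp add: z_def)
  have v: "cis (vq q t) = (z - of_real q) / (1 - of_real q * z)" using cis_vq[OF q, of t] by (simp add: z_def)
  have v': "cis (- vq q t) = (1 - of_real q * z) / (z - of_real q)"
    unfolding cis_inverse[symmetric] v by (rule inverse_divide)
  show "cfac q t \<noteq> 0" unfolding c using n2 z by simp
  show "cfac q (- t) = - cis (- vq q t) * cfac q t" 
  proof -
    have "- cis (- vq q t) * cfac q t = - ((1 - of_real q * z) / (z - 1))" unfolding c v' using n2 by (simp add: minus_divide_left)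
    also have "\<dots> = (1 - of_real q * z) / (1 - z)" by (simp only: minus_divide_right minus_diff_eq)
    finally show ?thesis unfolding c' ..
  qed
  have qp: "1 + q > 0" using q by auto
  have "1 - cis (vq q t) = of_real (1 + q) * ((1 - z) / (1 - of_real q * z))"
    unfolding v using n1 by (simp add: field_simps)
  then have "cmod (1 - cis (vq q t)) = (1 + q) * (cmod (1 - z) / cmod (1 - of_real q * z))"
    using qp by (simp add: norm_mult norm_divide del: of_real_add)
  also have "cmod (1 - of_real q * z) = cmod (z - of_real q)"
  proof -
    have "cmod (cis (vq q t)) = 1" by simp
    then show ?thesis unfolding v using n1 by (simp add: norm_divide field_simps)
  qed
  also have "cmod (1 - z) / cmod (z - of_real q) = inverse (cmod (cfac q t))"
    unfolding c norm_divide norm_minus_commute[of 1 z] inverse_divide ..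
  finally have "(cmod (1 - cis (vq q t)))\<^sup>2 = (1 + q)\<^sup>2 * inverse ((cmod (cfac q t))\<^sup>2)"
    by (simp add: power_mult_distrib power_inverse)
  moreover have "(cmod (1 - cis (vq q t)))\<^sup>2 = 2 - 2 * cos (vq q t)"
  proof -
    have "(cmod (1 - cis (vq q t)))\<^sup>2 = (1 - cos (vq q t))\<^sup>2 + (sin (vq q t))\<^sup>2" by (simp add: cmod_power2)
    also have "\<dots> = 2 - 2 * cos (vq q t)" by (simp add: sin_squared_eq power2_eq_square algebra_simps)
    finally show ?thesis .
  qed
  ultimately show "inverse ((cmod (cfac q t))\<^sup>2) = (2 - 2 * cos (vq q t)) / (1 + q)\<^sup>2"
    using qp by (simp add: field_simps)
qed

lemma not_wall_cis:
  assumes "\<not> wall n x" "j \<in> {1..n}" "k \<in> {1..n}" "j \<noteq> k"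
  shows "cis (x j - x k) \<noteq> 1"
proof
  assume "cis (x j - x k) = 1"
  then have "cos (x j - x k) = 1" by (simp add: complex_eq_iff)
  then obtain z :: int where "x j - x k = of_int z * 2 * pi" using cos_one_2pi_int by blast
  then have "x j - x k = 2 * pi * of_int z" by simp
  then show False using assms unfolding wall_def by blast
qed

lemma inverse_Ca:
  assumes q: "\<bar>q\<bar> < 1" and nw: "\<not> wall n x"
  shows "Ca n q x \<noteq> 0" "inverse ((cmod (Ca n q x))\<^sup>2) = Wt n q x / (\<Prod>p\<in>prs n. (1 + q)\<^sup>2)"
proof -
  have c: "cis (x j - x k) \<noteq> 1" if "(j, k) \<in> prs n" for j k
    using not_wall_cis[OF nw, of j k] that by (auto simp: prs_mem)
  show "Ca n q x \<noteq> 0" unfolding Ca_eq using c cfac_props(2)[OF q] by (auto simp: prod_zero_iff)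
  have "inverse ((cmod (Ca n q x))\<^sup>2) = (\<Prod>(j,k)\<in>prs n. inverse ((cmod (cfac q (x j - x k)))\<^sup>2))"
    unfolding Ca_eq by (simp add: prod_norm[symmetric] prod_power_distrib prod_inversef[symmetric] case_prod_unfold)
  also have "\<dots> = (\<Prod>(j,k)\<in>prs n. (2 - 2 * cos (vq q (x j - x k))) / (1 + q)\<^sup>2)"
    by (intro prod.cong refl) (use cfac_props(3)[OF q] c in auto)
  also have "\<dots> = Wt n q x / (\<Prod>p\<in>prs n. (1 + q)\<^sup>2)"
    unfolding Wt_def case_prod_unfold prod_dividef ..
  finally show "inverse ((cmod (Ca n q x))\<^sup>2) = Wt n q x / (\<Prod>p\<in>prs n. (1 + q)\<^sup>2)" .
qed

text \<open>Splitting half of its phase off every factor of \<open>Ca\<close> leaves an odd function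
  of each difference, whose product transforms by the sign. That \<open>K\<close> is the same for
  all \<open>\<mu>\<close> lets it be pulled out of the Christoffel sum.\<close>

lemma HL_eq_Ah:
  assumes q: "\<bar>q\<bar> < 1" and nw: "\<not> wall n x"
  obtains K where "cmod K = cmod (Ca n q x)" "\<And>\<mu>. HL n q \<mu> x = K * Ah n q \<mu> x"
proof
  let ?ch = "\<lambda>t. cfac q t * cis (- vq q t / 2)"
  let ?K = "\<Prod>(j,k)\<in>prs n. ?ch (x j - x k)"
  show "cmod ?K = cmod (Ca n q x)"
    unfolding Ca_eq by (simp add: prod_norm[symmetric] norm_mult case_prod_unfold)
  have odd: "?ch (x k - x j) = - ?ch (x j - x k)" if "j \<in> {1..n}" "k \<in> {1..n}" "j \<noteq> k" for j k
  proof -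
    have "cfac q (x k - x j) = - cis (- vq q (x j - x k)) * cfac q (x j - x k)"
      using cfac_props(1)[OF q not_wall_cis[OF nw that]] by simp
    moreover have "vq q (x k - x j) = - vq q (x j - x k)" using vq_minus[OF q, of "x j - x k"] by simp
    ultimately have "?ch (x k - x j) = - (cfac q (x j - x k) * (cis (- vq q (x j - x k)) * cis (vq q (x j - x k) / 2)))"
      by simp
    also have "cis (- vq q (x j - x k)) * cis (vq q (x j - x k) / 2) = cis (- vq q (x j - x k) / 2)"
      unfolding cis_mult by (intro arg_cong[where f = cis]) simp
    finally show ?thesis .
  qed
  fix \<mu>
  show "HL n q \<mu> x = ?K * Ah n q \<mu> x"
    unfolding HL_def Ah_def sum_distrib_left
  proof (intro sum.cong refl)
    fix \<sigma> assume "\<sigma> \<in> {\<sigma>. \<sigma> permutes {1..n}}"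
    then have s: "\<sigma> permutes {1..n}" by simp
    have "Ca n q (x \<circ> \<sigma>) = (\<Prod>(i,j)\<in>prs n. ?ch (x (\<sigma> i) - x (\<sigma> j)) * cis (vq q (x (\<sigma> i) - x (\<sigma> j)) / 2))"
      unfolding Ca_eq by (intro prod.cong refl) (auto simp: mult.assoc cis_mult)
    also have "\<dots> = (\<Prod>(i,j)\<in>prs n. ?ch (x (\<sigma> i) - x (\<sigma> j))) * cis ((\<Sum>(i,j)\<in>prs n. vq q (x (\<sigma> i) - x (\<sigma> j))) / 2)"
      by (simp add: prod.distrib cis_sum sum_divide_distrib case_prod_unfold)
    also have "(\<Prod>(i,j)\<in>prs n. ?ch (x (\<sigma> i) - x (\<sigma> j))) = of_real (inv_sign n \<sigma>) * ?K"
      by (rule prod_antisym_reindex[OF s]) (rule odd)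
    finally have C: "Ca n q (x \<circ> \<sigma>) = of_real (inv_sign n \<sigma>) * ?K * cis ((\<Sum>(i,j)\<in>prs n. vq q (x (\<sigma> i) - x (\<sigma> j))) / 2)" .
    show "Ca n q (x \<circ> \<sigma>) * exp (\<i> * complex_of_real (\<Sum>k\<in>{1..n}. x (\<sigma> k) * \<mu> k)) =
       ?K * (of_real (inv_sign n \<sigma>) * cis (hl_phase n q \<mu> (x \<circ> \<sigma>)))"
      unfolding C exp_eq_cis hl_phase_def cis_mult[symmetric] by (simp add: mult_ac)
  qed
qed

subsection \<open>Dominant weights of bounded level\<close>

definition dominant :: "nat \<Rightarrow> (nat \<Rightarrow> real) \<Rightarrow> bool" where
  "dominant n \<mu> \<longleftrightarrow> \<mu> \<in> vecs n \<and> (\<Sum>j\<in>{1..n}. \<mu> j) = 0 \<and> (\<forall>j\<in>{1..n-1}. \<mu> j - \<mu> (Suc j) \<in> \<nat>)"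

lemma sum_omega: "n \<ge> 1 \<Longrightarrow> j \<le> n \<Longrightarrow> (\<Sum>k\<in>{1..n}. omega n j k) = 0"
proof -
  assume n: "n \<ge> 1" "j \<le> n"
  have "(\<Sum>k\<in>{1..n}. omega n j k) = (\<Sum>k\<in>{1..n}. if k \<le> j then 1 else 0) - real n * (real j / real n)"
    by (simp add: omega_def sum_subtractf)
  also have "(\<Sum>k\<in>{1..n}. if k \<le> j then 1 else 0 :: real) = real (card {k \<in> {1..n}. k \<le> j})"
    by (simp add: sum.If_cases Int_def)
  also have "{k \<in> {1..n}. k \<le> j} = {1..j}" using n by auto
  finally show ?thesis using n by simp
qed

lemma omega_diff:
  assumes "k \<in> {1..n-1}"
  shows "omega n j k - omega n j (Suc k) = (if j = k then 1 else 0)"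
  using assms by (auto simp: omega_def)

lemma omega_sum_facts:
  fixes l :: "nat \<Rightarrow> nat"
  assumes n: "n \<ge> 1" and x_def: "x = (\<lambda>k. \<Sum>j\<in>{1..n-1}. real (l j) * omega n j k)"
  shows "x \<in> vecs n" "(\<Sum>k\<in>{1..n}. x k) = 0" "k \<in> {1..n-1} \<Longrightarrow> x k - x (Suc k) = real (l k)"
proof -
  show "x \<in> vecs n" by (auto simp: x_def vecs_def omega_def)
  have "(\<Sum>k\<in>{1..n}. x k) = (\<Sum>j\<in>{1..n-1}. real (l j) * (\<Sum>k\<in>{1..n}. omega n j k))"
    unfolding x_def by (subst sum.swap) (simp add: sum_distrib_left)
  also have "\<dots> = 0" using n by (intro sum.neutral) (auto simp: sum_omega simp del: One_nat_def)
  finally show "(\<Sum>k\<in>{1..n}. x k) = 0" .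
  assume k: "k \<in> {1..n-1}"
  have "x k - x (Suc k) = (\<Sum>j\<in>{1..n-1}. real (l j) * (omega n j k - omega n j (Suc k)))"
    unfolding x_def by (simp add: sum_subtractf right_diff_distrib)
  also have "\<dots> = (\<Sum>j\<in>{1..n-1}. if j = k then real (l k) else 0)"
    unfolding omega_diff[OF k] by (intro sum.cong) auto
  also have "\<dots> = real (l k)" using k by simp
  finally show "x k - x (Suc k) = real (l k)" .
qed

lemma telescope_diffs:
  fixes x :: "nat \<Rightarrow> real"
  assumes "i \<le> j"
  shows "x i - x j = (\<Sum>k\<in>{i..<j}. x k - x (Suc k))"
  using assms by (induction j rule: dec_induct) auto

lemma vecs_eqI:
  assumes n: "n \<ge> 1" and "x \<in> vecs n" "y \<in> vecs n" "(\<Sum>j\<in>{1..n}. x j) = (\<Sum>j\<in>{1..n}. y j)"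
    and d: "\<And>k. k \<in> {1..n-1} \<Longrightarrow> x k - x (Suc k) = y k - y (Suc k)"
  shows "x = y"
proof -
  have e: "x j - y j = x 1 - y 1" if j: "j \<in> {1..n}" for j
  proof -
    have "(\<Sum>k\<in>{1..<j}. x k - x (Suc k)) = (\<Sum>k\<in>{1..<j}. y k - y (Suc k))"
      using d j by (intro sum.cong) auto
    then show ?thesis using telescope_diffs[of 1 j x] telescope_diffs[of 1 j y] j by simp
  qed
  have "0 = (\<Sum>j\<in>{1..n}. x j - y j)" using assms(4) by (simp add: sum_subtractf)
  also have "\<dots> = (\<Sum>j\<in>{1..n}. x 1 - y 1)" by (rule sum.cong[OF refl e])
  finally have "x 1 = y 1" using n by simp
  then have "x j = y j" for j using e[of j] assms(2,3) by (cases "j \<in> {1..n}") (auto simp: vecs_def)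
  then show ?thesis by blast
qed

text \<open>The coefficient of the j-th fundamental weight is the j-th consecutive difference, and
  these telescope to the difference of the extreme entries, the level.\<close>

lemma Lam_iff:
  assumes n: "n \<ge> 1"
  shows "x \<in> Lam D n \<longleftrightarrow> dominant n x \<and> x 1 - x n \<le> real D"
proof
  assume "x \<in> Lam D n"
  then obtain l where x: "x = (\<lambda>k. \<Sum>j\<in>{1..n-1}. real (l j) * omega n j k)" and l: "(\<Sum>j\<in>{1..n-1}. l j) \<le> D"
    by (auto simp: Lam_def)
  note f = omega_sum_facts[OF n x]
  have "{1..n-1} = {1..<n}" using n by auto
  then have "x 1 - x n = (\<Sum>k\<in>{1..n-1}. x k - x (Suc k))" using telescope_diffs[of 1 n x] n by simp
  also have "\<dots> = (\<Sum>k\<in>{1..n-1}. real (l k))" by (rule sum.cong[OF refl f(3)])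
  finally have "x 1 - x n \<le> real D" using l by (simp flip: of_nat_sum)
  then show "dominant n x \<and> x 1 - x n \<le> real D" using f unfolding dominant_def by auto
next
  assume x: "dominant n x \<and> x 1 - x n \<le> real D"
  then have "\<forall>j\<in>{1..n-1}. \<exists>l. x j - x (Suc j) = real l" by (auto simp: dominant_def Nats_def)
  then obtain l where l: "\<And>j. j \<in> {1..n-1} \<Longrightarrow> x j - x (Suc j) = real (l j)" by metis
  define y where "y = (\<lambda>k. \<Sum>j\<in>{1..n-1}. real (l j) * omega n j k)"
  note f = omega_sum_facts[OF n y_def]
  have "x = y" by (rule vecs_eqI[OF n]) (use x f l in \<open>auto simp: dominant_def\<close>)
  have "{1..n-1} = {1..<n}" using n by auto
  then have "x 1 - x n = (\<Sum>k\<in>{1..n-1}. x k - x (Suc k))" using telescope_diffs[of 1 n x] n by simp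
  also have "\<dots> = (\<Sum>k\<in>{1..n-1}. real (l k))" by (rule sum.cong[OF refl l])
  finally have "real (\<Sum>k\<in>{1..n-1}. l k) \<le> real D" using x by simp
  then have "(\<Sum>k\<in>{1..n-1}. l k) \<le> D" by (simp only: of_nat_le_iff)
  then show "x \<in> Lam D n" unfolding Lam_def \<open>x = y\<close> y_def by blast
qed

lemma finite_Lam: "finite (Lam D n)"
proof -
  have "Lam D n \<subseteq> (\<lambda>l k. \<Sum>j\<in>{1..n-1}. real (l j) * omega n j k) ` PiE {1..n-1} (\<lambda>_. {..D})"
  proof
    fix x assume "x \<in> Lam D n"
    then obtain l where x: "x = (\<lambda>k. \<Sum>j\<in>{1..n-1}. real (l j) * omega n j k)" and l: "(\<Sum>j\<in>{1..n-1}. l j) \<le> D"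
      by (auto simp: Lam_def)
    have "l j \<le> D" if "j \<in> {1..n-1}" for j
      using member_le_sum[OF that, of l] l by simp
    then have "restrict l {1..n-1} \<in> PiE {1..n-1} (\<lambda>_. {..D})" by auto
    moreover have "x = (\<lambda>k. \<Sum>j\<in>{1..n-1}. real (restrict l {1..n-1} j) * omega n j k)"
      unfolding x by (intro ext sum.cong) auto
    ultimately show "x \<in> (\<lambda>l k. \<Sum>j\<in>{1..n-1}. real (l j) * omega n j k) ` PiE {1..n-1} (\<lambda>_. {..D})" by blast
  qed
  moreover have "finite (PiE {1..n-1} (\<lambda>_. {..D}))" by (intro finite_PiE) auto
  ultimately show ?thesis by (meson finite_subset finite_imageI)
qed

lemma dominant_antimono:
  assumes d: "dominant n \<mu>" and ij: "1 \<le> i" "i \<le> j" "j \<le> n"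
  shows "\<mu> j \<le> \<mu> i"
proof -
  have "\<mu> k - \<mu> (Suc k) \<ge> 0" if "k \<in> {i..<j}" for k
  proof -
    have "k \<in> {1..n-1}" using that ij by auto
    then have "\<mu> k - \<mu> (Suc k) \<in> \<nat>" using d unfolding dominant_def by blast
    then show ?thesis by (auto simp: Nats_def)
  qed
  then have "0 \<le> (\<Sum>k\<in>{i..<j}. \<mu> k - \<mu> (Suc k))" by (intro sum_nonneg)
  then show ?thesis using telescope_diffs[OF ij(2), of \<mu>] by simp
qed

lemma dominant_intdiff:
  assumes d: "dominant n \<mu>" shows "intdiff n \<mu>"
proof -
  have le: "\<mu> i - \<mu> j \<in> \<int>" if ij: "1 \<le> i" "i \<le> j" "j \<le> n" for i j
    unfolding telescope_diffs[OF ij(2), of \<mu>]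
  proof (rule Ints_sum)
    fix k assume "k \<in> {i..<j}"
    then have "k \<in> {1..n-1}" using ij by auto
    then have "\<mu> k - \<mu> (Suc k) \<in> \<nat>" using d unfolding dominant_def by blast
    then show "\<mu> k - \<mu> (Suc k) \<in> \<int>" using Nats_subset_Ints by blast
  qed
  have "\<mu> i - \<mu> j \<in> \<int>" if "i \<in> {1..n}" "j \<in> {1..n}" for i j
  proof (cases "i \<le> j")
    case False
    then have "\<mu> j - \<mu> i \<in> \<int>" using le[of j i] that by auto
    then have "- (\<mu> j - \<mu> i) \<in> \<int>" by (rule Ints_minus)
    then show ?thesis by simp
  qed (use le that in auto)
  then show ?thesis by (simp add: intdiff_def)
qed

lemma dominant_level:
  assumes d: "dominant n \<mu>" and ij: "i \<in> {1..n}" "j \<in> {1..n}"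
  shows "\<mu> i - \<mu> j \<le> \<mu> 1 - \<mu> n"
  using dominant_antimono[OF d, of 1 i] dominant_antimono[OF d, of j n] ij by simp

subsection \<open>Continuous orthogonality\<close>

text \<open>Dominance of a decreasing vector over its permutations: indices beyond p are exchanged
  for the missing ones up to p, and the value at p separates the two groups.\<close>

lemma partial_sum_perm_le:
  fixes \<nu> :: "nat \<Rightarrow> real"
  assumes anti: "\<And>i j. \<lbrakk>1 \<le> i; i \<le> j; j \<le> n\<rbrakk> \<Longrightarrow> \<nu> j \<le> \<nu> i" and t: "\<tau> permutes {1..n}" and p: "1 \<le> p" "p \<le> n"
  shows "(\<Sum>i\<in>{1..p}. \<nu> (\<tau> i)) \<le> (\<Sum>i\<in>{1..p}. \<nu> i)"
proof -
  let ?P = "{1..p}" let ?T = "\<tau> ` {1..p}"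
  have inj: "inj_on \<tau> ?P" using permutes_inj[OF t] by (rule inj_on_subset) auto
  have T: "?T \<subseteq> {1..n}" using permutes_in_image[OF t] p by fastforce
  have cT: "card ?T = card ?P" by (rule card_image[OF inj])
  have fT: "finite ?T" by simp
  have cd: "card (?T - ?P) = card (?P - ?T)"
    using card_Diff_subset_Int[of ?T ?P] card_Diff_subset_Int[of ?P ?T] cT by (simp add: Int_commute)
  have "(\<Sum>i\<in>?P. \<nu> (\<tau> i)) = (\<Sum>i\<in>?T. \<nu> i)" using sum.reindex[OF inj, of \<nu>] by (simp add: o_def)
  also have "\<dots> = (\<Sum>i\<in>?T \<inter> ?P. \<nu> i) + (\<Sum>i\<in>?T - ?P. \<nu> i)" by (rule sum.Int_Diff) simp
  also have "(\<Sum>i\<in>?T - ?P. \<nu> i) \<le> (\<Sum>i\<in>?T - ?P. \<nu> p)"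
  proof (rule sum_mono)
    fix i assume "i \<in> ?T - ?P"
    then have "1 \<le> i" "i \<le> n" "p < i" using T by auto
    then show "\<nu> i \<le> \<nu> p" using anti[of p i] p by simp
  qed
  also have "\<dots> = (\<Sum>i\<in>?P - ?T. \<nu> p)" using cd by simp
  also have "\<dots> \<le> (\<Sum>i\<in>?P - ?T. \<nu> i)"
  proof (rule sum_mono)
    fix i assume "i \<in> ?P - ?T"
    then show "\<nu> p \<le> \<nu> i" using anti[of i p] p by simp
  qed
  also have "(\<Sum>i\<in>?T \<inter> ?P. \<nu> i) + (\<Sum>i\<in>?P - ?T. \<nu> i) = (\<Sum>i\<in>?P. \<nu> i)"
    using sum.Int_Diff[of ?P \<nu> ?T] by (simp add: Int_commute)
  finally show ?thesis by simp
qed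

lemma eq_if_partial_sums_eq:
  fixes x y :: "nat \<Rightarrow> real"
  assumes "\<And>p. \<lbrakk>1 \<le> p; p \<le> n\<rbrakk> \<Longrightarrow> (\<Sum>i\<in>{1..p}. x i) = (\<Sum>i\<in>{1..p}. y i)" "i \<in> {1..n}"
  shows "x i = y i"
proof -
  obtain k where k: "i = Suc k" using assms(2) by (cases i) auto
  have "(\<Sum>i\<in>{1..k}. x i) = (\<Sum>i\<in>{1..k}. y i)" using assms(1)[of k] assms(2) k by (cases "k = 0") auto
  then show ?thesis using assms(1)[of i] assms(2) unfolding k by simp
qed

text \<open>The direction is n times the p-th fundamental weight. It is weakly decreasing, matching
  exponents >= 0, and pairs with a sum-zero weight to n times its p-th partial sum.\<close>

lemma tint_Tmon_partial_sum:
  assumes q: "\<bar>q\<bar> < 1" and n: "n \<ge> 2" and \<nu>: "intdiff n \<nu>" "(\<Sum>j\<in>{1..n}. \<nu> j) = 0"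
    and p: "p \<in> {1..n-1}" "(\<Sum>j\<in>{1..p}. \<nu> j) > 0"
    and e: "\<And>j k. (j, k) \<in> prs n \<Longrightarrow> e j k \<ge> 0"
  shows "tint n (Tmon n q \<nu> e) = 0"
proof -
  define u where "u i = (if i \<in> {1..p} then int n - int p else if i \<in> {1..n} then - int p else 0)" for i
  have split: "(\<Sum>i\<in>{1..n}. f i) = (\<Sum>i\<in>{1..p}. f i) + (\<Sum>i\<in>{p<..n}. f i)" for f :: "nat \<Rightarrow> 'a::comm_monoid_add"
  proof -
    have "{1..n} = {1..p} \<union> {p<..n}" using p by auto
    show ?thesis unfolding \<open>{1..n} = _\<close> by (rule sum.union_disjoint) auto
  qed
  have "(\<Sum>i\<in>{1..n}. u i) = (\<Sum>i\<in>{1..p}. int n - int p) + (\<Sum>i\<in>{p<..n}. - int p)"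
    unfolding split by (intro arg_cong2[where f = "(+)"] sum.cong) (auto simp: u_def)
  also have "\<dots> = 0" using p by (auto simp: of_nat_diff algebra_simps)
  finally have u: "u \<in> root_lattice n" using p by (auto simp: root_lattice_def u_def)
  show ?thesis
  proof (rule tint_Tmon_zero[OF q n \<nu>(1) u])
    show "e j k * (u j - u k) \<ge> 0" if "(j, k) \<in> prs n" for j k
      using e[OF that] that p by (intro mult_nonneg_nonneg) (auto simp: u_def prs_mem)
    have "(\<Sum>j\<in>{1..n}. \<nu> j * of_int (u j)) = (\<Sum>j\<in>{1..p}. \<nu> j * (real n - real p)) + (\<Sum>j\<in>{p<..n}. \<nu> j * (- real p))"
      unfolding split by (intro arg_cong2[where f = "(+)"] sum.cong) (auto simp: u_def)
    also have "\<dots> = real n * (\<Sum>j\<in>{1..p}. \<nu> j) - real p * (\<Sum>j\<in>{1..n}. \<nu> j)"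
      unfolding split[of \<nu>] sum_distrib_right[symmetric] by (simp add: algebra_simps)
    finally show "(\<Sum>j\<in>{1..n}. \<nu> j * of_int (u j)) > 0" using \<nu>(2) p(2) n by simp
  qed
qed

text \<open>The product is a symmetrisation over the first permutation; invariance of the integral
  fixes that one to the identity at the price of n!.\<close>

lemma tint_Ah_expand:
  assumes q: "\<bar>q\<bar> < 1" and n: "n \<ge> 2" and \<mu>: "intdiff n \<mu>" and \<nu>: "intdiff n \<nu>"
  shows "tint n (\<lambda>x. Ah n q \<mu> x * cnj (Ah n q \<nu> x)) = of_nat (fact n) *
    (\<Sum>\<tau>\<in>{\<tau>. \<tau> permutes {1..n}}. of_real (inv_sign n \<tau>) * tint n (Tmon n q (\<lambda>j. \<mu> j - \<nu> (inv \<tau> j)) (eps2 id \<tau>)))"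
proof -
  let ?P = "{\<sigma>. \<sigma> permutes {1..n}}"
  define g where "g x = (\<Sum>\<tau>\<in>?P. of_real (inv_sign n \<tau>) * Tmon n q (\<lambda>j. \<mu> j - \<nu> (inv \<tau> j)) (eps2 id \<tau>) x)" for x
  have tT: "torusfun n (Tmon n q (\<lambda>j. \<mu> j - \<nu> (inv \<tau> j)) (eps2 id \<tau>))" if "\<tau> \<in> ?P" for \<tau>
    using torusfun_Tmon[OF q] intdiff_perm_diff[OF \<mu> \<nu> permutes_id permutes_inv, of \<tau>] that n by simp
  have tg: "torusfun n g" unfolding g_def[abs_def] by (intro torusfun_sum torusfun_mult torusfun_const tT)
  have g: "g x = cis (hl_phase n q \<mu> x) * cnj (Ah n q \<nu> x)" for x
    unfolding g_def Ah_def cnj_sum sum_distrib_left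
  proof (intro sum.cong refl)
    fix \<tau> assume "\<tau> \<in> ?P"
    then show "of_real (inv_sign n \<tau>) * Tmon n q (\<lambda>j. \<mu> j - \<nu> (inv \<tau> j)) (eps2 id \<tau>) x =
       cis (hl_phase n q \<mu> x) * cnj (of_real (inv_sign n \<tau>) * cis (hl_phase n q \<nu> (x \<circ> \<tau>)))"
      using cis_hl_phase_mult_cnj[OF q permutes_id, of \<tau> n \<mu> x \<nu>] by (simp add: mult_ac)
  qed
  have "Ah n q \<mu> x * cnj (Ah n q \<nu> x) = (\<Sum>\<sigma>\<in>?P. g (x \<circ> \<sigma>))" for x
    unfolding Ah_def[of n q \<mu>] sum_distrib_right
  proof (intro sum.cong refl)
    fix \<sigma> assume "\<sigma> \<in> ?P"
    then have s: "\<sigma> permutes {1..n}" by simp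
    have "g (x \<circ> \<sigma>) = cis (hl_phase n q \<mu> (x \<circ> \<sigma>)) * (of_real (inv_sign n \<sigma>) * cnj (Ah n q \<nu> x))"
      unfolding g Ah_antisym[OF s] by simp
    then show "of_real (inv_sign n \<sigma>) * cis (hl_phase n q \<mu> (x \<circ> \<sigma>)) * cnj (Ah n q \<nu> x) = g (x \<circ> \<sigma>)"
      by (simp add: mult_ac)
  qed
  then have "tint n (\<lambda>x. Ah n q \<mu> x * cnj (Ah n q \<nu> x)) = tint n (\<lambda>x. \<Sum>\<sigma>\<in>?P. g (x \<circ> \<sigma>))"
    by (simp only:)
  also have "\<dots> = (\<Sum>\<sigma>\<in>?P. tint n (\<lambda>x. g (x \<circ> \<sigma>)))"
    by (rule tint_sum) (use torusfun_perm[OF tg] in blast)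
  also have "\<dots> = (\<Sum>\<sigma>\<in>?P. tint n g)" by (intro sum.cong refl) (use tint_perm[OF tg] in auto)
  also have "\<dots> = of_nat (fact n) * tint n g"
  proof -
    have "card ?P = fact n" by (rule card_permutations) auto
    then show ?thesis by (simp only: sum_constant)
  qed
  also have "tint n g = (\<Sum>\<tau>\<in>?P. of_real (inv_sign n \<tau>) * tint n (Tmon n q (\<lambda>j. \<mu> j - \<nu> (inv \<tau> j)) (eps2 id \<tau>)))"
    unfolding g_def[abs_def] by (subst tint_sum) (auto intro!: torusfun_mult tT simp only: tint_cmult mem_Collect_eq)
  finally show ?thesis .
qed

lemma eps2_id: "(j, k) \<in> prs n \<Longrightarrow> eps2 id \<tau> j k = (if inv \<tau> j < inv \<tau> k then 0 else 1)"
  by (auto simp: eps2_def prs_mem)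

lemma sum_perm_eq: "\<tau> permutes {1..n} \<Longrightarrow> (\<Sum>j\<in>{1..n}. f (\<tau> j)) = (\<Sum>j\<in>{1..n}. f j)"
  using sum.permute[of \<tau> "{1..n}" f] by (simp add: o_def)

text \<open>Distinct weights differ in some partial sum, up to conjugation in favour of
  \<open>\<mu>\<close>. Permuting \<open>\<nu>\<close> can only lower its partial sums, so one
  direction kills all terms of the expansion.\<close>

lemma tint_Ah_orth:
  assumes q: "\<bar>q\<bar> < 1" and n: "n \<ge> 2" and \<mu>: "dominant n \<mu>" and \<nu>: "dominant n \<nu>" and ne: "\<mu> \<noteq> \<nu>"
  shows "tint n (\<lambda>x. Ah n q \<mu> x * cnj (Ah n q \<nu> x)) = 0"
proof -
  note di = dominant_intdiff
  have main: "tint n (\<lambda>x. Ah n q \<mu> x * cnj (Ah n q \<nu> x)) = 0"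
    if \<mu>: "dominant n \<mu>" and \<nu>: "dominant n \<nu>" and p: "p \<in> {1..n-1}" "(\<Sum>i\<in>{1..p}. \<nu> i) < (\<Sum>i\<in>{1..p}. \<mu> i)" for \<mu> \<nu> p
    unfolding tint_Ah_expand[OF q n di[OF \<mu>] di[OF \<nu>]]
  proof (simp only: mult_eq_0_iff, rule disjI2, intro sum.neutral ballI)
    fix \<tau> assume "\<tau> \<in> {\<tau>. \<tau> permutes {1..n}}"
    then have t: "inv \<tau> permutes {1..n}" by (auto intro: permutes_inv)
    have "tint n (Tmon n q (\<lambda>j. \<mu> j - \<nu> (inv \<tau> j)) (eps2 id \<tau>)) = 0"
    proof (rule tint_Tmon_partial_sum[OF q n _ _ p(1)])
      show "intdiff n (\<lambda>j. \<mu> j - \<nu> (inv \<tau> j))" 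
        using intdiff_perm_diff[OF di[OF \<mu>] di[OF \<nu>] permutes_id t] by simp
      show "(\<Sum>j\<in>{1..n}. \<mu> j - \<nu> (inv \<tau> j)) = 0"
        using \<mu> \<nu> sum_perm_eq[OF t, of \<nu>] by (simp add: sum_subtractf dominant_def)
      have "(\<Sum>i\<in>{1..p}. \<nu> (inv \<tau> i)) \<le> (\<Sum>i\<in>{1..p}. \<nu> i)"
        by (rule partial_sum_perm_le[OF dominant_antimono[OF \<nu>] t]) (use p in auto)
      then show "(\<Sum>j\<in>{1..p}. \<mu> j - \<nu> (inv \<tau> j)) > 0" using p(2) by (simp add: sum_subtractf)
    qed (auto simp: eps2_id)
    then show "of_real (inv_sign n \<tau>) * tint n (Tmon n q (\<lambda>j. \<mu> j - \<nu> (inv \<tau> j)) (eps2 id \<tau>)) = 0" by simp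
  qed
  have "\<exists>p\<in>{1..n-1}. (\<Sum>i\<in>{1..p}. \<mu> i) \<noteq> (\<Sum>i\<in>{1..p}. \<nu> i)"
  proof (rule ccontr)
    assume c: "\<not> ?thesis"
    have "(\<Sum>i\<in>{1..p}. \<mu> i) = (\<Sum>i\<in>{1..p}. \<nu> i)" if "1 \<le> p" "p \<le> n" for p
      using c that \<mu> \<nu> by (cases "p = n") (auto simp: dominant_def)
    then have "\<mu> i = \<nu> i" for i
      using eq_if_partial_sums_eq[of n \<mu> \<nu> i] \<mu> \<nu> by (cases "i \<in> {1..n}") (auto simp: dominant_def vecs_def)
    then show False using ne by blast
  qed
  then obtain p where p: "p \<in> {1..n-1}" "(\<Sum>i\<in>{1..p}. \<mu> i) \<noteq> (\<Sum>i\<in>{1..p}. \<nu> i)" by blast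
  show ?thesis
  proof (cases "(\<Sum>i\<in>{1..p}. \<nu> i) < (\<Sum>i\<in>{1..p}. \<mu> i)")
    case True then show ?thesis using main[OF \<mu> \<nu> p(1)] by blast
  next
    case False
    then have "tint n (\<lambda>x. Ah n q \<nu> x * cnj (Ah n q \<mu> x)) = 0" using main[OF \<nu> \<mu> p(1)] p(2) by linarith
    then have "tint n (\<lambda>x. cnj (Ah n q \<nu> x * cnj (Ah n q \<mu> x))) = 0" unfolding tint_cnj by simp
    then show ?thesis by (simp add: mult.commute)
  qed
qed

lemma Tmon_cong: "(\<And>j. j \<in> {1..n} \<Longrightarrow> \<nu> j = \<nu>' j) \<Longrightarrow> Tmon n q \<nu> e = Tmon n q \<nu>' e"
  unfolding Tmon_def by (intro ext arg_cong[where f = cis] arg_cong2[where f = "(+)"] sum.cong) auto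

text \<open>By the same averaging only permutations fixing \<open>\<mu>\<close> survive. Each
  contributes -q per inversion, and its sign turns this into q per inversion.\<close>

lemma tint_Ah_norm:
  assumes q: "\<bar>q\<bar> < 1" and n: "n \<ge> 2" and \<mu>: "dominant n \<mu>"
  shows "tint n (\<lambda>x. Ah n q \<mu> x * cnj (Ah n q \<mu> x)) = of_real (fact n * (2 * pi) ^ (n-1) *
    (\<Sum>w\<in>{w. w permutes {1..n} \<and> (\<forall>i\<in>{1..n}. \<mu> (w i) = \<mu> i)}. \<Prod>(j,k)\<in>prs n. if w j < w k then 1 else q))"
proof -
  let ?P = "{\<sigma>. \<sigma> permutes {1..n}}" let ?S = "{w. w permutes {1..n} \<and> (\<forall>i\<in>{1..n}. \<mu> (w i) = \<mu> i)}"
  note di = dominant_intdiff[OF \<mu>]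
  let ?t = "\<lambda>\<tau>. of_real (inv_sign n \<tau>) * tint n (Tmon n q (\<lambda>j. \<mu> j - \<mu> (inv \<tau> j)) (eps2 id \<tau>))"
  have fP: "finite ?P" by (rule finite_permutations) simp
  have z: "?t \<tau> = 0" if t: "\<tau> permutes {1..n}" and ni: "\<not> (\<forall>i\<in>{1..n}. \<mu> (inv \<tau> i) = \<mu> i)" for \<tau>
  proof -
    have it: "inv \<tau> permutes {1..n}" by (rule permutes_inv[OF t])
    have le: "(\<Sum>i\<in>{1..p}. \<mu> (inv \<tau> i)) \<le> (\<Sum>i\<in>{1..p}. \<mu> i)" if "1 \<le> p" "p \<le> n" for p
      by (rule partial_sum_perm_le[OF dominant_antimono[OF \<mu>] it that])
    have "\<exists>p. 1 \<le> p \<and> p \<le> n \<and> (\<Sum>i\<in>{1..p}. \<mu> (inv \<tau> i)) \<noteq> (\<Sum>i\<in>{1..p}. \<mu> i)"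
      using ni eq_if_partial_sums_eq[of n "\<lambda>i. \<mu> (inv \<tau> i)" \<mu>] by blast
    then obtain p where p: "1 \<le> p" "p \<le> n" "(\<Sum>i\<in>{1..p}. \<mu> (inv \<tau> i)) \<noteq> (\<Sum>i\<in>{1..p}. \<mu> i)" by blast
    then have "p \<noteq> n" using sum_perm_eq[OF it, of \<mu>] by auto
    then have p1: "p \<in> {1..n-1}" using p by auto
    have "tint n (Tmon n q (\<lambda>j. \<mu> j - \<mu> (inv \<tau> j)) (eps2 id \<tau>)) = 0"
    proof (rule tint_Tmon_partial_sum[OF q n _ _ p1])
      show "intdiff n (\<lambda>j. \<mu> j - \<mu> (inv \<tau> j))"
        using intdiff_perm_diff[OF di di permutes_id it] by simp
      show "(\<Sum>j\<in>{1..n}. \<mu> j - \<mu> (inv \<tau> j)) = 0"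
        using sum_perm_eq[OF it, of \<mu>] by (simp add: sum_subtractf)
      show "(\<Sum>j\<in>{1..p}. \<mu> j - \<mu> (inv \<tau> j)) > 0" using le[OF p(1,2)] p(3) by (simp add: sum_subtractf)
    qed (auto simp: eps2_id)
    then show ?thesis by simp
  qed
  have nz: "?t \<tau> = of_real ((2 * pi) ^ (n-1) * (\<Prod>(j,k)\<in>prs n. if inv \<tau> j < inv \<tau> k then 1 else q))"
    if t: "\<tau> permutes {1..n}" and i: "\<forall>i\<in>{1..n}. \<mu> (inv \<tau> i) = \<mu> i" for \<tau>
  proof -
    have "Tmon n q (\<lambda>j. \<mu> j - \<mu> (inv \<tau> j)) (eps2 id \<tau>) = Tmon n q (\<lambda>_. 0) (eps2 id \<tau>)"
      by (rule Tmon_cong) (use i in simp)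
    then have "tint n (Tmon n q (\<lambda>j. \<mu> j - \<mu> (inv \<tau> j)) (eps2 id \<tau>)) =
       (2 * pi) ^ (n-1) * (\<Prod>(j,k)\<in>prs n. (- complex_of_real q) ^ nat (eps2 id \<tau> j k))"
      using tint_Tmon_const[OF q n, of "eps2 id \<tau>"] by (simp add: eps2_id)
    also have "(\<Prod>(j,k)\<in>prs n. (- complex_of_real q) ^ nat (eps2 id \<tau> j k)) =
       of_real (\<Prod>(j,k)\<in>prs n. if inv \<tau> j < inv \<tau> k then 1 else - q)"
      unfolding of_real_prod by (intro prod.cong refl) (auto simp: eps2_id)
    finally have "?t \<tau> = of_real ((2 * pi) ^ (n-1) * (inv_sign n \<tau> * (\<Prod>(j,k)\<in>prs n. if inv \<tau> j < inv \<tau> k then 1 else - q)))"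
      by (simp only: of_real_mult of_real_power of_real_numeral mult_ac)
    also have "inv_sign n \<tau> * (\<Prod>(j,k)\<in>prs n. if inv \<tau> j < inv \<tau> k then 1 else - q) =
        (\<Prod>(j,k)\<in>prs n. if inv \<tau> j < inv \<tau> k then 1 else q)"
      unfolding inv_sign_def prod.distrib[symmetric] by (intro prod.cong refl) auto
    finally show ?thesis .
  qed
  have "(\<Sum>\<tau>\<in>?P. ?t \<tau>) = (\<Sum>w\<in>?P. ?t (inv w))"
    by (rule sum_permutations_inverse)
  also have "\<dots> = (\<Sum>w\<in>?S. ?t (inv w))"
  proof (rule sum.mono_neutral_right[OF fP])
    show "\<forall>w\<in>?P - ?S. ?t (inv w) = 0"
    proof
      fix w assume w: "w \<in> ?P - ?S"
      then have "w permutes {1..n}" "inv (inv w) = w" by (auto simp: permutes_inv_inv)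
      then show "?t (inv w) = 0" using z[OF permutes_inv, of w] w by auto
    qed
  qed auto
  also have "\<dots> = (\<Sum>w\<in>?S. of_real ((2 * pi) ^ (n-1) * (\<Prod>(j,k)\<in>prs n. if w j < w k then 1 else q)))"
  proof (rule sum.cong[OF refl])
    fix w assume w: "w \<in> ?S"
    then have "w permutes {1..n}" "inv (inv w) = w" by (auto simp: permutes_inv_inv)
    then show "?t (inv w) = of_real ((2 * pi) ^ (n-1) * (\<Prod>(j,k)\<in>prs n. if w j < w k then 1 else q))"
      using nz[OF permutes_inv, of w] w by simp
  qed
  also have "\<dots> = of_real ((2 * pi) ^ (n-1) * (\<Sum>w\<in>?S. \<Prod>(j,k)\<in>prs n. if w j < w k then 1 else q))"
    unfolding sum_distrib_left of_real_sum ..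
  finally have *: "(\<Sum>\<tau>\<in>?P. ?t \<tau>) = of_real ((2 * pi) ^ (n-1) * (\<Sum>w\<in>?S. \<Prod>(j,k)\<in>prs n. if w j < w k then 1 else q))" .
  show ?thesis unfolding tint_Ah_expand[OF q n di di] *
    by (simp only: of_real_mult of_real_fact of_nat_fact mult.assoc)
qed

subsection \<open>The norms: inversion generating function of a Young subgroup\<close>

text \<open>The q-integer; \<open>qfact\<close> is the q-factorial built from it.\<close>

definition qbr :: "real \<Rightarrow> nat \<Rightarrow> real" where
  "qbr q b = (\<Sum>d<b. q ^ d)"

definition qfact :: "real \<Rightarrow> nat \<Rightarrow> real" where
  "qfact q b = (\<Prod>i\<in>{1..b}. qbr q i)"

lemma qfact_Suc: "qfact q (Suc b) = qbr q (Suc b) * qfact q b"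
  by (simp add: qfact_def mult.commute)

text \<open>q to the number of inversions, counted by peeling off the head.\<close>

fun qweight :: "real \<Rightarrow> nat list \<Rightarrow> real" where
  "qweight q [] = 1"
| "qweight q (x # xs) = q ^ card {y \<in> set xs. y < x} * qweight q xs"

lemma sum_q_rank:
  fixes T :: "nat set"
  assumes "finite T"
  shows "(\<Sum>x\<in>T. q ^ card {y \<in> T. y < x}) = qbr q (card T)"
  using assms
proof (induction T rule: finite_linorder_max_induct)
  case (insert b T)
  have "b \<notin> T" using insert.hyps by blast
  have "{y \<in> insert b T. y < b} = T" using insert.hyps by auto
  moreover have "{y \<in> insert b T. y < x} = {y \<in> T. y < x}" if "x \<in> T" for x
    using insert.hyps that by fastforce
  ultimately show ?case using insert \<open>b \<notin> T\<close> by (simp add: qbr_def add.commute)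
qed (simp add: qbr_def)

text \<open>Arrangements along which \<open>\<mu>\<close> decreases weakly; for dominant
  \<open>\<mu>\<close> on 1..n they are the one-line forms of its stabiliser.\<close>

abbreviation decperms :: "(nat \<Rightarrow> real) \<Rightarrow> nat set \<Rightarrow> nat list set" where
  "decperms \<mu> A \<equiv> {xs \<in> permutations_of_set A. sorted_wrt (\<lambda>x y. \<mu> y \<le> \<mu> x) xs}"

text \<open>The head must come from the block of maximal value, and its inversions involve that
  block only, so it contributes the q-integer of the block size. \<open>V\<close> may exceed the set
  of values, as empty blocks contribute 1; this keeps it fixed during the induction.\<close>

lemma sum_qweight:
  assumes "finite A" "\<And>x y. \<lbrakk>x \<in> A; y \<in> A; x \<le> y\<rbrakk> \<Longrightarrow> \<mu> y \<le> \<mu> x" "finite V" "\<mu> ` A \<subseteq> V"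
  shows "(\<Sum>xs\<in>decperms \<mu> A. qweight q xs) = (\<Prod>v\<in>V. qfact q (card {y \<in> A. \<mu> y = v}))"
  using assms
proof (induction A rule: finite_psubset_induct)
  case (psubset A)
  show ?case
  proof (cases "A = {}")
    case True
    then have "decperms \<mu> A = {[]}" by auto
    then show ?thesis using True by (simp add: qfact_def)
  next
    case False
    define T where "T = {x \<in> A. \<forall>y\<in>A. \<mu> y \<le> \<mu> x}"
    define v0 where "v0 = Max (\<mu> ` A)"
    have Tv: "T = {y \<in> A. \<mu> y = v0}"
    proof -
      have "\<mu> y \<le> v0" if "y \<in> A" for y unfolding v0_def using that psubset.hyps(1) by (intro Max_ge) auto
      moreover have "v0 \<in> \<mu> ` A" unfolding v0_def using False psubset.hyps(1) by (intro Max_in) auto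
      ultimately show ?thesis unfolding T_def by force
    qed
    have "v0 \<in> \<mu> ` A" unfolding v0_def using False psubset.hyps(1) by (intro Max_in) auto
    then have v0V: "v0 \<in> V" using psubset.prems(3) by blast
    have TA: "T \<subseteq> A" by (auto simp: T_def)
    have fT: "finite T" using TA psubset.hyps(1) finite_subset by blast
    have "T \<noteq> {}" using \<open>v0 \<in> \<mu> ` A\<close> unfolding Tv by auto
    then obtain b where b: "card T = Suc b" using fT by (metis card_eq_0_iff not0_implies_Suc)
    define R where "R = qfact q b * (\<Prod>v\<in>V - {v0}. qfact q (card {y \<in> A. \<mu> y = v}))"
    have IH: "(\<Sum>xs\<in>decperms \<mu> (A - {x}). qweight q xs) = R" if x: "x \<in> T" for x
    proof -
      have xA: "x \<in> A" "\<mu> x = v0" using x by (auto simp: Tv)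
      have "(\<Sum>xs\<in>decperms \<mu> (A - {x}). qweight q xs) = (\<Prod>v\<in>V. qfact q (card {y \<in> A - {x}. \<mu> y = v}))"
        by (rule psubset.IH) (use xA psubset.prems in auto)
      also have "\<dots> = qfact q (card {y \<in> A - {x}. \<mu> y = v0}) * (\<Prod>v\<in>V - {v0}. qfact q (card {y \<in> A - {x}. \<mu> y = v}))"
        by (rule prod.remove[OF psubset.prems(2) v0V])
      also have "{y \<in> A - {x}. \<mu> y = v0} = T - {x}" unfolding Tv by auto
      also have "card (T - {x}) = b" using x b by simp
      also have "(\<Prod>v\<in>V - {v0}. qfact q (card {y \<in> A - {x}. \<mu> y = v})) = (\<Prod>v\<in>V - {v0}. qfact q (card {y \<in> A. \<mu> y = v}))"
      proof (rule prod.cong[OF refl])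
        fix v assume "v \<in> V - {v0}"
        then have "{y \<in> A - {x}. \<mu> y = v} = {y \<in> A. \<mu> y = v}" using xA by auto
        then show "qfact q (card {y \<in> A - {x}. \<mu> y = v}) = qfact q (card {y \<in> A. \<mu> y = v})" by simp
      qed
      finally show ?thesis unfolding R_def .
    qed
    have dec: "decperms \<mu> A = (\<Union>x\<in>T. (#) x ` decperms \<mu> (A - {x}))"
    proof (intro equalityI subsetI)
      fix xs assume xs: "xs \<in> decperms \<mu> A"
      then obtain x ys where x: "xs = x # ys" "x \<in> A" "ys \<in> permutations_of_set (A - {x})"
        unfolding permutations_of_set_nonempty[OF False] by auto
      then have "set ys = A - {x}" by (simp add: permutations_of_set_def)
      then have "x \<in> T" "ys \<in> decperms \<mu> (A - {x})" using xs x by (auto simp: T_def)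
      then show "xs \<in> (\<Union>x\<in>T. (#) x ` decperms \<mu> (A - {x}))" using x(1) by blast
    next
      fix xs assume "xs \<in> (\<Union>x\<in>T. (#) x ` decperms \<mu> (A - {x}))"
      then obtain x ys where x: "xs = x # ys" "x \<in> T" "ys \<in> decperms \<mu> (A - {x})" by blast
      then show "xs \<in> decperms \<mu> A" by (auto simp: T_def permutations_of_set_def)
    qed
    have fd: "finite (decperms \<mu> B)" if "finite B" for B
      using finite_permutations_of_set by simp
    have "(\<Sum>xs\<in>decperms \<mu> A. qweight q xs) = (\<Sum>x\<in>T. \<Sum>xs\<in>(#) x ` decperms \<mu> (A - {x}). qweight q xs)"
      unfolding dec by (rule sum.UNION_disjoint) (use fT fd psubset.hyps(1) in auto)
    also have "\<dots> = (\<Sum>x\<in>T. q ^ card {y \<in> T. y < x} * R)"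
    proof (rule sum.cong[OF refl])
      fix x assume x: "x \<in> T"
      have "(\<Sum>xs\<in>(#) x ` decperms \<mu> (A - {x}). qweight q xs) = (\<Sum>xs\<in>decperms \<mu> (A - {x}). qweight q (x # xs))"
        by (subst sum.reindex) (auto simp: inj_on_def)
      also have "\<dots> = (\<Sum>xs\<in>decperms \<mu> (A - {x}). q ^ card {y \<in> T. y < x} * qweight q xs)"
      proof (rule sum.cong[OF refl])
        fix xs assume "xs \<in> decperms \<mu> (A - {x})"
        then have "set xs = A - {x}" by (auto simp: permutations_of_set_def)
        \<comment> \<open>A smaller index has at least the value of \<open>\<mu>\<close> at x, which
          is already maximal.\<close>
        moreover have "{y \<in> A - {x}. y < x} = {y \<in> T. y < x}"
        proof -
          have "\<mu> y = v0" if "y \<in> A" "y < x" for y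
          proof -
            have "\<mu> x \<le> \<mu> y" using psubset.prems(1)[of y x] that x TA by auto
            moreover have "\<mu> x = v0" using x by (auto simp: Tv)
            moreover have "\<mu> y \<le> \<mu> x" using x that unfolding T_def by blast
            ultimately show ?thesis by simp
          qed
          then show ?thesis using TA unfolding Tv by auto
        qed
        ultimately show "qweight q (x # xs) = q ^ card {y \<in> T. y < x} * qweight q xs" by simp
      qed
      also have "\<dots> = q ^ card {y \<in> T. y < x} * R" unfolding sum_distrib_left[symmetric] IH[OF x] ..
      finally show "(\<Sum>xs\<in>(#) x ` decperms \<mu> (A - {x}). qweight q xs) = q ^ card {y \<in> T. y < x} * R" .
    qed
    also have "\<dots> = qbr q (card T) * R" unfolding sum_distrib_right[symmetric] sum_q_rank[OF fT] ..
    also have "\<dots> = qfact q (card T) * (\<Prod>v\<in>V - {v0}. qfact q (card {y \<in> A. \<mu> y = v}))"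
      unfolding R_def b qfact_Suc by (simp add: mult.assoc)
    also have "\<dots> = (\<Prod>v\<in>V. qfact q (card {y \<in> A. \<mu> y = v}))"
      unfolding prod.remove[OF psubset.prems(2) v0V] Tv ..
    finally show ?thesis .
  qed
qed

lemma perms_lists_bij:
  "bij_betw (\<lambda>w. map w [1..<Suc n]) {w. w permutes {1..n}} (permutations_of_set {1..n})"
proof -
  let ?f = "\<lambda>w. map w [1..<Suc n]"
  have set: "set [1..<Suc n] = {1..n}" by auto
  have inj: "inj_on ?f {w. w permutes {1..n}}"
  proof (rule inj_onI, rule ext)
    fix v w i assume v: "v \<in> {w. w permutes {1..n}}" and w: "w \<in> {w. w permutes {1..n}}" and e: "?f v = ?f w"
    then have "\<forall>i\<in>{1..n}. v i = w i" unfolding map_eq_conv set by blast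
    then show "v i = w i" using v w permutes_not_in[of v "{1..n}" i] permutes_not_in[of w "{1..n}" i] by (cases "i \<in> {1..n}") auto
  qed
  have img: "?f ` {w. w permutes {1..n}} \<subseteq> permutations_of_set {1..n}"
  proof (clarify)
    fix w assume w: "w permutes {1..n}"
    have "distinct (?f w)" 
      unfolding distinct_map using inj_on_subset[OF permutes_inj[OF w] subset_UNIV] distinct_upt by blast
    moreover have "set (?f w) = {1..n}" unfolding set_map set using permutes_image[OF w] .
    ultimately show "?f w \<in> permutations_of_set {1..n}" by (simp add: permutations_of_set_def)
  qed
  have "card (?f ` {w. w permutes {1..n}}) = card (permutations_of_set {1..n})"
    unfolding card_image[OF inj] by (simp add: card_permutations[of _ n] card_permutations_of_set del: One_nat_def)
  then have "?f ` {w. w permutes {1..n}} = permutations_of_set {1..n}"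
    by (intro card_subset_eq[OF _ img]) auto
  then show ?thesis using inj by (simp add: bij_betw_def)
qed

lemma qweight_map:
  assumes inj: "inj w" and "a \<le> Suc n"
  shows "qweight q (map w [a..<Suc n]) = (\<Prod>j\<in>{a..n}. \<Prod>k\<in>{j<..n}. if w j < w k then 1 else q)"
  using assms(2)
proof (induction a rule: inc_induct)
  case (step a)
  have a: "[a..<Suc n] = a # [Suc a..<Suc n]" using step.hyps by (simp add: upt_conv_Cons del: upt_Suc)
  have s: "{a..n} = insert a {Suc a..n}" using step.hyps by auto
  have "{y \<in> set (map w [Suc a..<Suc n]). y < w a} = w ` {k \<in> {a<..n}. w k < w a}" by auto
  then have "card {y \<in> set (map w [Suc a..<Suc n]). y < w a} = card {k \<in> {a<..n}. w k < w a}"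
    using inj by (simp add: card_image inj_on_subset)
  moreover have "(\<Prod>k\<in>{a<..n}. if w a < w k then 1 else q) = q ^ card {k \<in> {a<..n}. w k < w a}"
  proof -
    have "(\<Prod>k\<in>{a<..n}. if w a < w k then 1 else q) = (\<Prod>k\<in>{a<..n}. if w k < w a then q else 1)"
    proof (rule prod.cong[OF refl])
      fix k assume "k \<in> {a<..n}"
      then have "w a \<noteq> w k" using inj by (auto dest: injD)
      then show "(if w a < w k then 1 else q) = (if w k < w a then q else 1)" by auto
    qed
    also have "\<dots> = (\<Prod>k\<in>{k \<in> {a<..n}. w k < w a}. q)" by (rule prod.inter_filter[symmetric]) simp
    finally show ?thesis by simp
  qed
  ultimately show ?case using step.IH unfolding a s by simp
qed simp

text \<open>If \<open>\<mu>\<close> decreases along the values of \<open>w\<close>, then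
  \<open>\<mu>\<close> and its rearrangement by \<open>w\<close> are both decreasing, so each
  dominates the other and they agree.\<close>

lemma sum_stab_qweight:
  assumes \<mu>: "dominant n \<mu>"
  shows "(\<Sum>w\<in>{w. w permutes {1..n} \<and> (\<forall>i\<in>{1..n}. \<mu> (w i) = \<mu> i)}. \<Prod>(j,k)\<in>prs n. if w j < w k then 1 else q)
     = (\<Prod>v\<in>\<mu> ` {1..n}. qfact q (card {y \<in> {1..n}. \<mu> y = v}))"
proof -
  let ?f = "\<lambda>w. map w [1..<Suc n]"
  let ?S = "{w. w permutes {1..n} \<and> (\<forall>i\<in>{1..n}. \<mu> (w i) = \<mu> i)}"
  note anti = dominant_antimono[OF \<mu>]
  have sorted: "sorted_wrt (\<lambda>x y. \<mu> y \<le> \<mu> x) (?f w) \<longleftrightarrow> (\<forall>i\<in>{1..n}. \<mu> (w i) = \<mu> i)" if w: "w permutes {1..n}" for w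
  proof
    assume s: "sorted_wrt (\<lambda>x y. \<mu> y \<le> \<mu> x) (?f w)"
    have anti': "\<mu> (w j) \<le> \<mu> (w i)" if "1 \<le> i" "i \<le> j" "j \<le> n" for i j
    proof (cases "i = j")
      case False
      then show ?thesis using that sorted_wrt_nth_less[OF s, of "i - 1" "j - 1"] by (simp add: nth_map del: upt_Suc)
    qed simp
    have "(\<Sum>i\<in>{1..p}. \<mu> (w i)) = (\<Sum>i\<in>{1..p}. \<mu> i)" if p: "1 \<le> p" "p \<le> n" for p
    proof (rule antisym)
      show "(\<Sum>i\<in>{1..p}. \<mu> (w i)) \<le> (\<Sum>i\<in>{1..p}. \<mu> i)" by (rule partial_sum_perm_le[OF anti w p])
      have "(\<Sum>i\<in>{1..p}. (\<lambda>i. \<mu> (w i)) (inv w i)) \<le> (\<Sum>i\<in>{1..p}. \<mu> (w i))"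
        by (rule partial_sum_perm_le[OF anti' permutes_inv[OF w] p])
      then show "(\<Sum>i\<in>{1..p}. \<mu> i) \<le> (\<Sum>i\<in>{1..p}. \<mu> (w i))" using permutes_inverses[OF w] by simp
    qed
    then show "\<forall>i\<in>{1..n}. \<mu> (w i) = \<mu> i" using eq_if_partial_sums_eq[of n "\<lambda>i. \<mu> (w i)" \<mu>] by blast
  next
    assume e: "\<forall>i\<in>{1..n}. \<mu> (w i) = \<mu> i"
    show "sorted_wrt (\<lambda>x y. \<mu> y \<le> \<mu> x) (?f w)"
      unfolding sorted_wrt_iff_nth_less
    proof (intro allI impI)
      fix i j assume "i < j" "j < length (?f w)"
      then show "\<mu> (?f w ! j) \<le> \<mu> (?f w ! i)" using e anti[of "Suc i" "Suc j"] by (simp add: nth_map del: upt_Suc)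
    qed
  qed
  have bij: "bij_betw ?f ?S (decperms \<mu> {1..n})"
  proof -
    have "bij_betw ?f {w \<in> {w. w permutes {1..n}}. \<forall>i\<in>{1..n}. \<mu> (w i) = \<mu> i} {xs \<in> permutations_of_set {1..n}. sorted_wrt (\<lambda>x y. \<mu> y \<le> \<mu> x) xs}"
    proof -
      have B: "?f ` {w. w permutes {1..n}} = permutations_of_set {1..n}" "inj_on ?f {w. w permutes {1..n}}"
        using perms_lists_bij[of n] by (auto simp: bij_betw_def)
      have "?f ` {w \<in> {w. w permutes {1..n}}. \<forall>i\<in>{1..n}. \<mu> (w i) = \<mu> i} = {xs \<in> permutations_of_set {1..n}. sorted_wrt (\<lambda>x y. \<mu> y \<le> \<mu> x) xs}"
        unfolding B(1)[symmetric] using sorted by blast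
      moreover have "inj_on ?f {w \<in> {w. w permutes {1..n}}. \<forall>i\<in>{1..n}. \<mu> (w i) = \<mu> i}"
        by (rule inj_on_subset[OF B(2)]) auto
      ultimately show ?thesis by (simp only: bij_betw_def)
    qed
    then show ?thesis by simp
  qed
  have "(\<Sum>w\<in>?S. \<Prod>(j,k)\<in>prs n. if w j < w k then 1 else q) = (\<Sum>w\<in>?S. qweight q (?f w))"
  proof (rule sum.cong[OF refl])
    fix w assume "w \<in> ?S"
    then have "inj w" using permutes_inj by blast
    then have "qweight q (?f w) = (\<Prod>j\<in>{1..n}. \<Prod>k\<in>{j<..n}. if w j < w k then 1 else q)"
      by (rule qweight_map) simp
    also have "\<dots> = (\<Prod>(j,k)\<in>prs n. if w j < w k then 1 else q)"
      unfolding prs_Sigma by (rule prod.Sigma) auto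
    finally show "(\<Prod>(j,k)\<in>prs n. if w j < w k then 1 else q) = qweight q (?f w)" ..
  qed
  also have "\<dots> = (\<Sum>xs\<in>decperms \<mu> {1..n}. qweight q xs)"
    by (rule sum.reindex_bij_betw[OF bij])
  also have "\<dots> = (\<Prod>v\<in>\<mu> ` {1..n}. qfact q (card {y \<in> {1..n}. \<mu> y = v}))"
    by (rule sum_qweight) (use anti in auto)
  finally show ?thesis .
qed

section \<open>Matching the norms with the factors of \<open>delta\<close>\<close>

lemma qbr_closed:
  assumes "q \<noteq> 1" shows "qbr q b = (1 - q ^ b) / (1 - q)"
  unfolding qbr_def using sum_gp_strict[of q b] assms by simp

lemma one_minus_power_ne:
  fixes q :: real
  assumes "\<bar>q\<bar> < 1" "d > 0"
  shows "1 - q ^ d \<noteq> 0"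
proof
  assume "1 - q ^ d = 0"
  then have "\<bar>q ^ d\<bar> = 1" by simp
  moreover have "\<bar>q\<bar> ^ d \<le> \<bar>q\<bar> ^ 1" using assms by (intro power_decreasing) auto
  ultimately show False using assms by (simp add: power_abs)
qed

text \<open>Adding one index multiplies by its pairs inside its own block. Their index distances run
  through 1, 2, ..., block size, and the quotients telescope to a q-integer.\<close>

lemma prod_blocks:
  assumes q: "\<bar>q\<bar> < 1" and anti: "\<And>i j. \<lbrakk>1 \<le> i; i \<le> j; j \<le> n\<rbrakk> \<Longrightarrow> \<mu> j \<le> (\<mu> i :: real)"
    and V: "finite V" "\<mu> ` {1..n} \<subseteq> V"
  shows "(\<Prod>(j,k)\<in>prs n. if \<mu> j = \<mu> k then (1 - q ^ (1 + (k - j))) / (1 - q ^ (k - j)) else 1) =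
    (\<Prod>v\<in>V. qfact q (card {y \<in> {1..n}. \<mu> y = v}))"
  using anti V(2)
proof (induction n)
  case 0
  have "prs 0 = {}" by (auto simp: prs_def)
  then show ?case by (simp add: qfact_def)
next
  case (Suc n)
  let ?g = "\<lambda>j k. if \<mu> j = \<mu> k then (1 - q ^ (1 + (k - j))) / (1 - q ^ (k - j)) else 1"
  define v0 where "v0 = \<mu> (Suc n)"
  define Bl where "Bl = {y \<in> {1..n}. \<mu> y = v0}"
  have v0V: "v0 \<in> V" using Suc.prems(2) by (auto simp: v0_def)
  have IH: "(\<Prod>(j,k)\<in>prs n. ?g j k) = (\<Prod>v\<in>V. qfact q (card {y \<in> {1..n}. \<mu> y = v}))"
    by (rule Suc.IH) (use Suc.prems in auto)
  have p: "prs (Suc n) = prs n \<union> (\<lambda>j. (j, Suc n)) ` {1..n}" by (auto simp: prs_def)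
  have "(\<Prod>(j,k)\<in>prs (Suc n). ?g j k) = (\<Prod>(j,k)\<in>prs n. ?g j k) * (\<Prod>(j,k)\<in>(\<lambda>j. (j, Suc n)) ` {1..n}. ?g j k)"
    unfolding p by (rule prod.union_disjoint) (simp, simp, auto simp: prs_mem)
  also have "(\<Prod>(j,k)\<in>(\<lambda>j. (j, Suc n)) ` {1..n}. ?g j k) = (\<Prod>j\<in>{1..n}. ?g j (Suc n))"
    by (subst prod.reindex) (auto simp: inj_on_def)
  also have "\<dots> = qbr q (Suc (card Bl))"
  proof -
    \<comment> \<open>The block is a final segment of 1..n because \<open>\<mu>\<close> is weakly
      decreasing; c is the position just before it.\<close>
    define c where "c = n - card Bl"
    have "card Bl \<le> card {1..n}" by (intro card_mono) (auto simp: Bl_def)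
    then have cBl: "card Bl \<le> n" by simp
    have up: "j \<in> Bl" if "i \<in> Bl" "i \<le> j" "j \<le> n" for i j
      using that Suc.prems(1)[of i j] Suc.prems(1)[of j "Suc n"] by (auto simp: Bl_def v0_def)
    have Bl: "Bl = {Suc c..n}"
    proof (cases "Bl = {}")
      case True then show ?thesis by (simp add: c_def)
    next
      case False
      have fB: "finite Bl" by (simp add: Bl_def)
      define a where "a = Min Bl"
      have a: "a \<in> Bl" "\<And>i. i \<in> Bl \<Longrightarrow> a \<le> i" using Min_in[OF fB False] fB by (auto simp: a_def)
      have e: "Bl = {a..n}"
      proof (intro equalityI subsetI)
        fix i assume i: "i \<in> Bl"
        then have "i \<le> n" by (simp add: Bl_def)
        then show "i \<in> {a..n}" using a(2)[OF i] by simp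
      next
        fix i assume "i \<in> {a..n}"
        then show "i \<in> Bl" using up[OF a(1), of i] by simp
      qed
      have "1 \<le> a" "a \<le> n" using a(1) by (auto simp: Bl_def)
      then have "Suc c = a" unfolding c_def e by simp
      then show ?thesis using e by simp
    qed
    have "(\<Prod>j\<in>{1..n}. ?g j (Suc n)) = (\<Prod>j\<in>Bl. (1 - q ^ (1 + (Suc n - j))) / (1 - q ^ (Suc n - j)))"
      unfolding Bl_def v0_def by (rule prod.inter_filter[symmetric]) simp
    also have "\<dots> = (\<Prod>d\<in>{1..card Bl}. (1 - q ^ (1 + d)) / (1 - q ^ d))"
    proof -
      have cb: "card Bl = n - c" "c \<le> n" using cBl by (auto simp: c_def)
      show ?thesis unfolding cb(1) unfolding Bl
        by (rule prod.reindex_bij_witness[where i = "\<lambda>d. Suc n - d" and j = "\<lambda>j. Suc n - j"])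
           (use cb(2) in auto)
    qed
    also have "\<dots> = qbr q (Suc (card Bl))"
    proof -
      have tel: "(\<Prod>d\<in>{1..b}. (1 - q ^ (1 + d)) / (1 - q ^ d)) = (1 - q ^ Suc b) / (1 - q)" for b
      proof (induction b)
        case 0 show ?case using q by simp
      next
        case (Suc b)
        then show ?case using one_minus_power_ne[OF q, of "Suc b"] by simp
      qed
      have "q \<noteq> 1" using q by auto
      then show ?thesis unfolding tel by (rule qbr_closed[symmetric])
    qed
    finally show ?thesis .
  qed
  also have "(\<Prod>(j,k)\<in>prs n. ?g j k) * qbr q (Suc (card Bl)) =
     qbr q (Suc (card Bl)) * qfact q (card Bl) * (\<Prod>v\<in>V - {v0}. qfact q (card {y \<in> {1..n}. \<mu> y = v}))"
    unfolding IH prod.remove[OF V(1) v0V] Bl_def by (simp add: mult_ac)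
  also have "qbr q (Suc (card Bl)) * qfact q (card Bl) = qfact q (card {y \<in> {1..Suc n}. \<mu> y = v0})"
  proof -
    have "{y \<in> {1..Suc n}. \<mu> y = v0} = insert (Suc n) Bl" by (auto simp: Bl_def v0_def)
    then show ?thesis by (simp add: Bl_def qfact_Suc)
  qed
  also have "(\<Prod>v\<in>V - {v0}. qfact q (card {y \<in> {1..n}. \<mu> y = v})) = (\<Prod>v\<in>V - {v0}. qfact q (card {y \<in> {1..Suc n}. \<mu> y = v}))"
  proof (rule prod.cong[OF refl])
    fix v assume "v \<in> V - {v0}"
    then have "{y \<in> {1..n}. \<mu> y = v} = {y \<in> {1..Suc n}. \<mu> y = v}" by (auto simp: v0_def le_Suc_eq)
    then show "qfact q (card {y \<in> {1..n}. \<mu> y = v}) = qfact q (card {y \<in> {1..Suc n}. \<mu> y = v})" by simp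
  qed
  also have "qfact q (card {y \<in> {1..Suc n}. \<mu> y = v0}) * \<dots> = (\<Prod>v\<in>V. qfact q (card {y \<in> {1..Suc n}. \<mu> y = v}))"
    by (rule prod.remove[OF V(1) v0V, symmetric])
  finally show ?case .
qed

text \<open>The pair factor of \<open>delta\<close> in terms of index distance d and gap t; this
  form shows its symmetry under replacing (d, t) by (n - d, m - t).\<close>

definition dfac :: "nat \<Rightarrow> nat \<Rightarrow> real \<Rightarrow> nat \<Rightarrow> real \<Rightarrow> real" where
  "dfac m n q d t = (if t = 0 then (1 - q ^ d) / (1 - q ^ (1 + d))
     else if t = real m then (1 - q ^ (n - d)) / (1 - q ^ (n + 1 - d)) else 1)"

lemma delta_eq:
  assumes "m > 0"
  shows "delta m n q \<mu> = (\<Prod>(j,k)\<in>prs n. dfac m n q (k - j) (\<mu> j - \<mu> k))"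
proof -
  have 1: "(\<Prod>j\<in>{1..n}. \<Prod>k\<in>{k\<in>{j<..n}. P j k}. g j k) = (\<Prod>(j,k)\<in>prs n. if P j k then g j k else 1)"
    for P :: "nat \<Rightarrow> nat \<Rightarrow> bool" and g :: "nat \<Rightarrow> nat \<Rightarrow> real"
  proof -
    have "(\<Prod>j\<in>{1..n}. \<Prod>k\<in>{k\<in>{j<..n}. P j k}. g j k) = (\<Prod>j\<in>{1..n}. \<Prod>k\<in>{j<..n}. if P j k then g j k else 1)"
      by (rule prod.cong[OF refl], rule prod.inter_filter) simp
    also have "\<dots> = (\<Prod>(j,k)\<in>prs n. if P j k then g j k else 1)"
      unfolding prs_Sigma by (rule prod.Sigma) auto
    finally show ?thesis .
  qed
  show ?thesis unfolding delta_def 1 prod.distrib[symmetric] dfac_def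
  proof (rule prod.cong[OF refl], clarify)
    fix j k assume "(j, k) \<in> prs n"
    then have "n - k + j = n - (k - j)" "n + 1 - k + j = n + 1 - (k - j)" "1 + k - j = 1 + (k - j)" by (auto simp: prs_mem)
    then show "(if \<mu> j - \<mu> k = 0 then (1 - q ^ (k - j)) / (1 - q ^ (1 + k - j)) else 1) *
       (if \<mu> j - \<mu> k = real m then (1 - q ^ (n - k + j)) / (1 - q ^ (n + 1 - k + j)) else 1) =
       (if \<mu> j - \<mu> k = 0 then (1 - q ^ (k - j)) / (1 - q ^ (1 + (k - j)))
        else if \<mu> j - \<mu> k = real m then (1 - q ^ (n - (k - j))) / (1 - q ^ (n + 1 - (k - j))) else 1)"
      using assms by auto
  qed
qed

lemma dfac_ne:
  assumes q: "\<bar>q\<bar> < 1" and "0 < d" "d < n"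
  shows "dfac m n q d t \<noteq> 0"
  using one_minus_power_ne[OF q, of d] one_minus_power_ne[OF q, of "1 + d"]
    one_minus_power_ne[OF q, of "n - d"] one_minus_power_ne[OF q, of "n + 1 - d"] assms
  by (auto simp: dfac_def)

lemma delta_ne:
  assumes "\<bar>q\<bar> < 1" "m > 0"
  shows "delta m n q \<mu> \<noteq> 0"
  unfolding delta_eq[OF assms(2)] prod_zero_iff[OF finite_prs]
  using dfac_ne[OF assms(1)] by (auto simp: prs_mem)

text \<open>Below level m no gap equals m, so only the factors from equal entries remain, and these
  are the block products.\<close>

lemma tint_Ah_norm_delta:
  assumes q: "\<bar>q\<bar> < 1" and n: "n \<ge> 2" and m: "m > 0" and \<mu>: "dominant n \<mu>" and lev: "\<mu> 1 - \<mu> n < real m"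
  shows "tint n (\<lambda>x. Ah n q \<mu> x * cnj (Ah n q \<mu> x)) = of_real (fact n * (2 * pi) ^ (n-1) / delta m n q \<mu>)"
proof -
  let ?g = "\<lambda>j k. if \<mu> j = \<mu> k then (1 - q ^ (1 + (k - j))) / (1 - q ^ (k - j)) else 1"
  have "inverse (delta m n q \<mu>) = (\<Prod>(j,k)\<in>prs n. ?g j k)"
    unfolding delta_eq[OF m] prod_inversef[symmetric] o_def
  proof (rule prod.cong[OF refl], clarify)
    fix j k assume jk: "(j, k) \<in> prs n"
    then have "\<mu> j - \<mu> k \<le> \<mu> 1 - \<mu> n" by (intro dominant_level[OF \<mu>]) (auto simp: prs_mem)
    then have "\<mu> j - \<mu> k \<noteq> real m" using lev by simp
    then show "inverse (dfac m n q (k - j) (\<mu> j - \<mu> k)) = ?g j k" by (simp add: dfac_def)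
  qed
  also have "\<dots> = (\<Prod>v\<in>\<mu> ` {1..n}. qfact q (card {y \<in> {1..n}. \<mu> y = v}))"
    by (rule prod_blocks[OF q dominant_antimono[OF \<mu>]]) auto
  finally show ?thesis
    unfolding tint_Ah_norm[OF q n \<mu>] sum_stab_qweight[OF \<mu>] by (simp add: divide_inverse)
qed

subsection \<open>Cyclic rotation of the weights\<close>

lemma (in comm_monoid_set) pairs_split_first:
  assumes "n \<ge> 1"
  shows "F (\<lambda>(j,k). g j k) (prs n) = f (F (\<lambda>k. g 1 (Suc k)) {1..n-1}) (F (\<lambda>(j,k). g (Suc j) (Suc k)) (prs (n-1)))"
proof -
  let ?A = "(\<lambda>k. (1, Suc k)) ` {1..n-1}" and ?B = "(\<lambda>(j,k). (Suc j, Suc k)) ` prs (n-1)"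
  have "prs n = ?A \<union> ?B"
  proof (intro equalityI subsetI)
    fix p assume "p \<in> prs n"
    then obtain j k where p: "p = (j, k)" "1 \<le> j" "j < k" "k \<le> n" by (auto simp: prs_def)
    then have k: "k = Suc (k - 1)" and j: "j = Suc (j - 1)" by auto
    show "p \<in> ?A \<union> ?B"
    proof (cases "j = 1")
      case True then show ?thesis using p k by (auto intro!: image_eqI[of _ _ "k - 1"])
    next
      case False
      then have "(j - 1, k - 1) \<in> prs (n-1)" using p by (auto simp: prs_mem)
      then show ?thesis using p j k by (auto intro!: image_eqI[of _ _ "(j - 1, k - 1)"])
    qed
  qed (use assms in \<open>auto simp: prs_def\<close>)
  then have "F (\<lambda>(j,k). g j k) (prs n) = f (F (\<lambda>(j,k). g j k) ?A) (F (\<lambda>(j,k). g j k) ?B)"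
    by (simp only:) (rule union_disjoint; auto simp: prs_mem)
  also have "F (\<lambda>(j,k). g j k) ?A = F (\<lambda>k. g 1 (Suc k)) {1..n-1}"
    by (subst reindex) (auto simp: inj_on_def o_def)
  also have "F (\<lambda>(j,k). g j k) ?B = F (\<lambda>(j,k). g (Suc j) (Suc k)) (prs (n-1))"
    by (subst reindex) (auto simp: inj_on_def intro!: cong)
  finally show ?thesis .
qed

lemma (in comm_monoid_set) pairs_split_last:
  assumes "n \<ge> 1"
  shows "F (\<lambda>(j,k). g j k) (prs n) = f (F (\<lambda>j. g j n) {1..n-1}) (F (\<lambda>(j,k). g j k) (prs (n-1)))"
proof -
  let ?A = "(\<lambda>j. (j, n)) ` {1..n-1}"
  have "prs n = ?A \<union> prs (n-1)" using assms by (auto simp: prs_def)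
  then have "F (\<lambda>(j,k). g j k) (prs n) = f (F (\<lambda>(j,k). g j k) ?A) (F (\<lambda>(j,k). g j k) (prs (n-1)))"
    by (simp only:) (rule union_disjoint; use assms in \<open>auto simp: prs_mem\<close>)
  also have "F (\<lambda>(j,k). g j k) ?A = F (\<lambda>j. g j n) {1..n-1}"
    by (subst reindex) (auto simp: inj_on_def o_def)
  finally show ?thesis .
qed

lemma sum_first_shift:
  fixes f :: "nat \<Rightarrow> 'a::comm_monoid_add"
  assumes "n \<ge> 1" shows "(\<Sum>k\<in>{1..n}. f k) = f 1 + (\<Sum>k\<in>{1..n-1}. f (Suc k))"
proof -
  have "{1..n} = insert 1 (Suc ` {1..n-1})"
    using assms by (auto simp: image_iff)
  then have "(\<Sum>k\<in>{1..n}. f k) = (\<Sum>k\<in>insert 1 (Suc ` {1..n-1}). f k)" by simp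
  also have "\<dots> = f 1 + (\<Sum>k\<in>Suc ` {1..n-1}. f k)" by (rule sum.insert) auto
  also have "(\<Sum>k\<in>Suc ` {1..n-1}. f k) = (\<Sum>k\<in>{1..n-1}. f (Suc k))" by (subst sum.reindex) (auto simp: o_def)
  finally show ?thesis .
qed

lemma sum_last_split:
  fixes f :: "nat \<Rightarrow> 'a::comm_monoid_add"
  assumes "n \<ge> 2" shows "(\<Sum>k\<in>{1..n}. f k) = (\<Sum>k\<in>{1..n-1}. f k) + f n"
proof -
  have "(\<Sum>k\<in>{1..n}. f k) = (\<Sum>k\<in>insert n {1..n-1}. f k)" using atLeast1_insert_last[OF assms] by simp
  also have "\<dots> = f n + (\<Sum>k\<in>{1..n-1}. f k)" using assms by (intro sum.insert) auto
  finally show ?thesis by (simp add: add.commute)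
qed

text \<open>Rotation of the affine Dynkin diagram at level m: the first entry moves to the end
  lowered by m, and m/n restores sum zero.\<close>

definition rotw :: "nat \<Rightarrow> nat \<Rightarrow> (nat \<Rightarrow> real) \<Rightarrow> nat \<Rightarrow> real" where
  "rotw m n \<mu> j = (if j \<in> {1..n-1} then \<mu> (Suc j) + real m / real n
     else if j = n then \<mu> 1 - real m + real m / real n else 0)"

definition cyc :: "nat \<Rightarrow> nat \<Rightarrow> nat" where
  "cyc n k = (if k = 1 then n else if k \<in> {2..n} then k - 1 else k)"

lemma cyc_permutes:
  assumes "n \<ge> 2" shows "cyc n permutes {1..n}"
proof (rule bij_imp_permutes)
  have "inj_on (cyc n) {1..n}" by (auto simp: inj_on_def cyc_def)
  moreover have "cyc n ` {1..n} \<subseteq> {1..n}" using assms by (auto simp: cyc_def)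
  ultimately show "bij_betw (cyc n) {1..n} {1..n}"
    using endo_inj_surj[of "{1..n}" "cyc n"] by (simp add: bij_betw_def)
qed (use assms in \<open>auto simp: cyc_def\<close>)

text \<open>Moving one coordinate from the last to the first place reverses all its pairs, which
  changes the half sum by the full sum of its phases. With the term -m from the rotated weight this
  is a Bethe phase; the shift m/n drops out since \<open>x\<close> has sum zero.\<close>

lemma hl_phase_rotw:
  assumes q: "\<bar>q\<bar> < 1" and n: "n \<ge> 2" and x: "(\<Sum>j\<in>{1..n}. x j) = 0" and s: "\<sigma> permutes {1..n}"
  shows "hl_phase n q (rotw m n \<mu>) (x \<circ> \<sigma>) = hl_phase n q \<mu> (x \<circ> (\<sigma> \<circ> cyc n)) - bethe m n q x (\<sigma> n)"
proof -
  have n1: "n \<ge> 1" using n by simp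
  define y where "y = x \<circ> \<sigma>"
  define z where "z = x \<circ> (\<sigma> \<circ> cyc n)"
  have z1: "z 1 = y n" by (simp add: z_def y_def cyc_def)
  have zS: "z (Suc k) = y k" if "k \<in> {1..n-1}" for k
    using that n by (auto simp: z_def y_def cyc_def)
  have sy: "(\<Sum>k\<in>{1..n}. y k) = 0" using sum_perm_eq[OF s, of x] x by (simp add: y_def)
  let ?I = "{1..n-1}"
  have nI: "n \<notin> ?I" using n by auto
  define A where "A = (\<Sum>k\<in>?I. \<mu> (Suc k) * y k)"
  have L: "(\<Sum>k\<in>{1..n}. rotw m n \<mu> k * y k) = A + \<mu> 1 * y n - real m * y n"
  proof -
    have "(\<Sum>k\<in>{1..n}. rotw m n \<mu> k * y k) = (\<Sum>k\<in>?I. rotw m n \<mu> k * y k) + rotw m n \<mu> n * y n"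
      by (rule sum_last_split[OF n])
    also have "(\<Sum>k\<in>?I. rotw m n \<mu> k * y k) = (\<Sum>k\<in>?I. \<mu> (Suc k) * y k + real m / real n * y k)"
      by (rule sum.cong[OF refl]) (simp add: rotw_def distrib_right)
    also have "\<dots> = A + real m / real n * (\<Sum>k\<in>?I. y k)" by (simp add: sum.distrib sum_distrib_left A_def)
    also have "rotw m n \<mu> n = \<mu> 1 - real m + real m / real n" by (simp only: rotw_def nI if_False if_True refl)
    also have "(\<Sum>k\<in>?I. y k) = - y n" using sy sum_last_split[OF n, of y] by simp
    finally show ?thesis by (simp add: algebra_simps)
  qed
  have R: "(\<Sum>k\<in>{1..n}. \<mu> k * z k) = A + \<mu> 1 * y n"
  proof -
    have "(\<Sum>k\<in>{1..n}. \<mu> k * z k) = \<mu> 1 * z 1 + (\<Sum>k\<in>?I. \<mu> (Suc k) * z (Suc k))"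
      by (rule sum_first_shift[OF n1])
    also have "(\<Sum>k\<in>?I. \<mu> (Suc k) * z (Suc k)) = A" unfolding A_def
      by (rule sum.cong[OF refl]) (simp add: zS)
    finally show ?thesis by (simp add: z1[simplified])
  qed
  define Q where "Q = (\<Sum>k\<in>?I. vq q (y n - y k))"
  define B where "B = (\<Sum>(i,j)\<in>prs (n-1). vq q (y i - y j))"
  have Py: "(\<Sum>(i,j)\<in>prs n. vq q (y i - y j)) = - Q + B"
  proof -
    have "(\<Sum>(i,j)\<in>prs n. vq q (y i - y j)) = (\<Sum>k\<in>?I. vq q (y k - y n)) + B"
      unfolding B_def by (rule sum.pairs_split_last[OF n1])
    also have "(\<Sum>k\<in>?I. vq q (y k - y n)) = (\<Sum>k\<in>?I. - vq q (y n - y k))"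
      using vq_minus[OF q, of "y n - y k" for k] by (intro sum.cong refl) (metis minus_diff_eq)
    finally show ?thesis by (simp add: Q_def sum_negf)
  qed
  have Pz: "(\<Sum>(i,j)\<in>prs n. vq q (z i - z j)) = Q + B"
  proof -
    have "(\<Sum>(i,j)\<in>prs n. vq q (z i - z j)) = (\<Sum>k\<in>?I. vq q (z 1 - z (Suc k))) + (\<Sum>(i,j)\<in>prs (n-1). vq q (z (Suc i) - z (Suc j)))"
      by (rule sum.pairs_split_first[OF n1])
    also have "(\<Sum>k\<in>?I. vq q (z 1 - z (Suc k))) = Q" unfolding Q_def
      by (rule sum.cong[OF refl]) (simp add: zS z1[simplified])
    also have "(\<Sum>(i,j)\<in>prs (n-1). vq q (z (Suc i) - z (Suc j))) = B" unfolding B_def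
    proof (intro sum.cong refl, clarify)
      fix i j assume "(i, j) \<in> prs (n-1)"
      then have "i \<in> ?I" "j \<in> ?I" by (auto simp: prs_mem)
      then show "vq q (z (Suc i) - z (Suc j)) = vq q (y i - y j)" by (simp only: zS)
    qed
    finally show ?thesis .
  qed
  have Bt: "bethe m n q x (\<sigma> n) = real m * y n + Q"
  proof -
    have inj: "inj_on \<sigma> S" for S using permutes_inj[OF s] by (rule inj_on_subset) simp
    have "{1..n} - {\<sigma> n} = \<sigma> ` {1..n} - \<sigma> ` {n}" using permutes_image[OF s] by simp
    also have "\<dots> = \<sigma> ` ({1..n} - {n})" using n by (intro inj_on_image_set_diff[symmetric, OF inj[of "{1..n}"]]) auto
    also have "{1..n} - {n} = ?I" using n by auto
    finally have "(\<Sum>k\<in>{1..n} - {\<sigma> n}. vq q (x (\<sigma> n) - x k)) = Q"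
      unfolding Q_def y_def by (simp only:) (subst sum.reindex[OF inj], simp add: o_def)
    then show ?thesis by (simp add: bethe_def y_def)
  qed
  show ?thesis unfolding hl_phase_def y_def[symmetric] z_def[symmetric] L R Py Pz Bt by simp
qed

definition bethe_pt :: "nat \<Rightarrow> nat \<Rightarrow> real \<Rightarrow> (nat \<Rightarrow> real) \<Rightarrow> bool" where
  "bethe_pt m n q x \<longleftrightarrow> (\<forall>j\<in>{1..n}. \<forall>k\<in>{1..n}. cis (bethe m n q x j) = cis (bethe m n q x k))"

text \<open>At a Bethe point the phase left over by \<open>hl_phase_rotw\<close> is the same for
  every permutation, so it factors out of the sum.\<close>

lemma Ah_rotw:
  assumes q: "\<bar>q\<bar> < 1" and n: "n \<ge> 2" and x: "(\<Sum>j\<in>{1..n}. x j) = 0" and b: "bethe_pt m n q x"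
  obtains \<omega> where "\<omega> * cnj \<omega> = 1" "\<And>\<mu>. Ah n q (rotw m n \<mu>) x = \<omega> * Ah n q \<mu> x"
proof
  let ?P = "{\<sigma>. \<sigma> permutes {1..n}}"
  let ?s = "complex_of_real (inv_sign n (cyc n))"
  let ?z = "cis (- bethe m n q x n)"
  have "?s * ?z * cnj (?s * ?z) = of_real (inv_sign n (cyc n) * inv_sign n (cyc n)) * (?z * cnj ?z)"
    by (simp only: complex_cnj_mult complex_cnj_complex_of_real of_real_mult mult_ac)
  also have "\<dots> = 1" unfolding cis_cnj cis_mult by simp
  finally show "?s * ?z * cnj (?s * ?z) = 1" .
  fix \<mu>
  have zz: "cis (- bethe m n q x (\<sigma> n)) = ?z" if "\<sigma> permutes {1..n}" for \<sigma>
  proof -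
    have "\<sigma> n \<in> {1..n}" "n \<in> {1..n}" using permutes_in_image[OF that] n by auto
    then have "cis (bethe m n q x (\<sigma> n)) = cis (bethe m n q x n)" using b unfolding bethe_pt_def by blast
    then have "cnj (cis (bethe m n q x (\<sigma> n))) = cnj (cis (bethe m n q x n))" by simp
    then show ?thesis by (simp add: cis_cnj)
  qed
  have "Ah n q \<mu> x = (\<Sum>\<sigma>\<in>?P. of_real (inv_sign n (\<sigma> \<circ> cyc n)) * cis (hl_phase n q \<mu> (x \<circ> (\<sigma> \<circ> cyc n))))"
    unfolding Ah_def by (rule sum_permutations_compose_right[OF cyc_permutes[OF n]])
  then have "?s * ?z * Ah n q \<mu> x = (\<Sum>\<sigma>\<in>?P. ?s * ?z * (of_real (inv_sign n (\<sigma> \<circ> cyc n)) * cis (hl_phase n q \<mu> (x \<circ> (\<sigma> \<circ> cyc n)))))"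
    by (simp only: sum_distrib_left)
  also have "\<dots> = Ah n q (rotw m n \<mu>) x"
    unfolding Ah_def[of n q "rotw m n \<mu>"]
  proof (rule sum.cong[OF refl])
    fix \<sigma> assume "\<sigma> \<in> ?P"
    then have s: "\<sigma> permutes {1..n}" by simp
    have "?s * ?z * (of_real (inv_sign n (\<sigma> \<circ> cyc n)) * cis (hl_phase n q \<mu> (x \<circ> (\<sigma> \<circ> cyc n)))) =
      of_real (inv_sign n (cyc n) * inv_sign n (cyc n)) * (of_real (inv_sign n \<sigma>) * (cis (hl_phase n q \<mu> (x \<circ> (\<sigma> \<circ> cyc n))) * cis (- bethe m n q x (\<sigma> n))))"
      unfolding inv_sign_compose[OF s cyc_permutes[OF n]] zz[OF s] by (simp only: of_real_mult mult_ac)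
    also have "\<dots> = of_real (inv_sign n \<sigma>) * cis (hl_phase n q (rotw m n \<mu>) (x \<circ> \<sigma>))"
      unfolding hl_phase_rotw[OF q n x s] cis_mult by simp
    finally show "?s * ?z * (of_real (inv_sign n (\<sigma> \<circ> cyc n)) * cis (hl_phase n q \<mu> (x \<circ> (\<sigma> \<circ> cyc n)))) =
      of_real (inv_sign n \<sigma>) * cis (hl_phase n q (rotw m n \<mu>) (x \<circ> \<sigma>))" .
  qed
  finally show "Ah n q (rotw m n \<mu>) x = ?s * ?z * Ah n q \<mu> x" ..
qed

lemma rotw_simps:
  assumes "n \<ge> 2"
  shows "j \<in> {1..n-1} \<Longrightarrow> rotw m n \<mu> j = \<mu> (Suc j) + real m / real n"
    "rotw m n \<mu> n = \<mu> 1 - real m + real m / real n"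
proof -
  have "n \<notin> {1..n-1}" using assms by auto
  then show "rotw m n \<mu> n = \<mu> 1 - real m + real m / real n" by (simp only: rotw_def if_False if_True refl)
qed (simp add: rotw_def)

text \<open>The level after rotation shows the purpose: it falls below m as soon as the first two
  entries differ.\<close>

lemma rotw_Lam:
  assumes n: "n \<ge> 2" and \<mu>: "\<mu> \<in> Lam m n"
  shows "rotw m n \<mu> \<in> Lam m n" "rotw m n \<mu> 1 - rotw m n \<mu> n = real m - (\<mu> 1 - \<mu> 2)"
proof -
  have n1: "n \<ge> 1" using n by simp
  have d: "dominant n \<mu>" and l: "\<mu> 1 - \<mu> n \<le> real m" using \<mu> Lam_iff[OF n1] by auto
  have i1: "1 \<in> {1..n-1}" using n by auto
  show lev: "rotw m n \<mu> 1 - rotw m n \<mu> n = real m - (\<mu> 1 - \<mu> 2)"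
    unfolding rotw_simps(1)[OF n i1] rotw_simps(2)[OF n] by (simp add: numeral_2_eq_2)
  have "(\<Sum>j\<in>{1..n}. rotw m n \<mu> j) = (\<Sum>j\<in>{1..n-1}. rotw m n \<mu> j) + rotw m n \<mu> n" by (rule sum_last_split[OF n])
  also have "(\<Sum>j\<in>{1..n-1}. rotw m n \<mu> j) = (\<Sum>j\<in>{1..n-1}. \<mu> (Suc j) + real m / real n)"
    by (rule sum.cong[OF refl rotw_simps(1)[OF n]])
  also have "\<dots> = (\<Sum>j\<in>{1..n-1}. \<mu> (Suc j)) + real (n-1) * (real m / real n)" by (simp add: sum.distrib)
  also have "(\<Sum>j\<in>{1..n-1}. \<mu> (Suc j)) = - \<mu> 1" using d sum_first_shift[OF n1, of \<mu>] by (simp add: dominant_def)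
  finally have s0: "(\<Sum>j\<in>{1..n}. rotw m n \<mu> j) = 0" using n by (simp add: rotw_simps[OF n] of_nat_diff field_simps)
  have v: "rotw m n \<mu> \<in> vecs n" using n by (auto simp: vecs_def rotw_def)
  have dif: "rotw m n \<mu> j - rotw m n \<mu> (Suc j) \<in> \<nat>" if j: "j \<in> {1..n-1}" for j
  proof (cases "Suc j = n")
    case True
    have "\<mu> 1 - \<mu> n \<in> \<int>" using dominant_intdiff[OF d] n by (auto simp: intdiff_def)
    then have "real m - (\<mu> 1 - \<mu> n) \<in> \<int>" by (rule Ints_diff[OF Ints_of_nat])
    moreover have "real m - (\<mu> 1 - \<mu> n) \<ge> 0" using l by simp
    ultimately have "real m - (\<mu> 1 - \<mu> n) \<in> \<nat>" by (simp add: Nats_altdef2)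
    moreover have "rotw m n \<mu> j - rotw m n \<mu> (Suc j) = real m - (\<mu> 1 - \<mu> n)"
      unfolding rotw_simps(1)[OF n j] True rotw_simps(2)[OF n] by simp
    ultimately show ?thesis by simp
  next
    case False
    then have j': "Suc j \<in> {1..n-1}" using j by auto
    have "\<mu> (Suc j) - \<mu> (Suc (Suc j)) \<in> \<nat>" using d j' unfolding dominant_def by blast
    then show ?thesis unfolding rotw_simps(1)[OF n j] rotw_simps(1)[OF n j'] by simp
  qed
  have "\<mu> 2 \<le> \<mu> 1" using dominant_antimono[OF d, of 1 2] n by simp
  then show "rotw m n \<mu> \<in> Lam m n" unfolding Lam_iff[OF n1] dominant_def using s0 v dif lev by auto
qed

lemma rotw_inj:
  assumes n: "n \<ge> 2" and "\<mu> \<in> vecs n" "\<nu> \<in> vecs n" and e: "rotw m n \<mu> = rotw m n \<nu>"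
  shows "\<mu> = \<nu>"
proof
  fix j
  consider "j \<notin> {1..n}" | "j = 1" | i where "j = Suc i" "i \<in> {1..n-1}"
    by (metis Suc_diff_1 Suc_leI Suc_le_mono atLeastAtMost_iff diff_le_mono le_antisym not_less One_nat_def Suc_pred le_zero_eq not_less_eq_eq zero_less_diff)
  then show "\<mu> j = \<nu> j"
  proof cases
    case 1 then show ?thesis using assms by (auto simp: vecs_def)
  next
    case 2 then show ?thesis using fun_cong[OF e, of n] by (simp add: rotw_simps[OF n])
  next
    case 3 then show ?thesis using fun_cong[OF e, of i] by (simp only: rotw_simps(1)[OF n 3(2)])
  qed
qed

lemma dfac_rot:
  assumes "1 \<le> d" "d < n" "m > 0"
  shows "dfac m n q (n - d) (real m - t) = dfac m n q d t"
proof -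
  have e: "n - (n - d) = d" "n + 1 - (n - d) = 1 + d" "n + 1 - d = 1 + (n - d)" using assms by auto
  show ?thesis unfolding dfac_def e using assms(3) by auto
qed

text \<open>Pairs containing the moved index change from (d, t) to (n - d, m - t), where
  \<open>dfac_rot\<close> applies; the others keep distance and gap.\<close>

lemma delta_rotw:
  assumes n: "n \<ge> 2" and m: "m > 0"
  shows "delta m n q (rotw m n \<mu>) = delta m n q \<mu>"
proof -
  have n1: "n \<ge> 1" using n by simp
  let ?r = "rotw m n \<mu>"
  have "delta m n q ?r = (\<Prod>j\<in>{1..n-1}. dfac m n q (n - j) (?r j - ?r n)) * (\<Prod>(j,k)\<in>prs (n-1). dfac m n q (k - j) (?r j - ?r k))"
    unfolding delta_eq[OF m] by (rule prod.pairs_split_last[OF n1])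
  also have "(\<Prod>j\<in>{1..n-1}. dfac m n q (n - j) (?r j - ?r n)) = (\<Prod>k\<in>{1..n-1}. dfac m n q (Suc k - 1) (\<mu> 1 - \<mu> (Suc k)))"
  proof (rule prod.cong[OF refl])
    fix j assume j: "j \<in> {1..n-1}"
    have "?r j - ?r n = real m - (\<mu> 1 - \<mu> (Suc j))"
      unfolding rotw_simps(1)[OF n j] rotw_simps(2)[OF n] by simp
    then show "dfac m n q (n - j) (?r j - ?r n) = dfac m n q (Suc j - 1) (\<mu> 1 - \<mu> (Suc j))"
      using dfac_rot[of j n m q] j m by auto
  qed
  also have "(\<Prod>(j,k)\<in>prs (n-1). dfac m n q (k - j) (?r j - ?r k)) = (\<Prod>(j,k)\<in>prs (n-1). dfac m n q (Suc k - Suc j) (\<mu> (Suc j) - \<mu> (Suc k)))"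
  proof (rule prod.cong[OF refl], clarify)
    fix j k assume "(j, k) \<in> prs (n-1)"
    then have "j \<in> {1..n-1}" "k \<in> {1..n-1}" by (auto simp: prs_mem)
    then show "dfac m n q (k - j) (?r j - ?r k) = dfac m n q (Suc k - Suc j) (\<mu> (Suc j) - \<mu> (Suc k))"
      by (simp only: rotw_simps(1)[OF n] diff_Suc_Suc add_diff_cancel_right)
  qed
  also have "(\<Prod>k\<in>{1..n-1}. dfac m n q (Suc k - 1) (\<mu> 1 - \<mu> (Suc k))) * \<dots> = delta m n q \<mu>"
    unfolding delta_eq[OF m] by (rule prod.pairs_split_first[OF n1, symmetric])
  finally show ?thesis .
qed

subsection \<open>The Bethe points in the alcove\<close>

definition nodes :: "nat \<Rightarrow> nat \<Rightarrow> real \<Rightarrow> (nat \<Rightarrow> real) set" where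
  "nodes m n q = {x \<in> alcove n. bethe_pt m n q x}"

definition weight_of :: "nat \<Rightarrow> nat \<Rightarrow> real \<Rightarrow> (nat \<Rightarrow> real) \<Rightarrow> nat \<Rightarrow> real" where
  "weight_of m n q x j = (if j \<in> {1..n} then bethe m n q x j / (2 * pi) - rho n j else 0)"

lemma bethe_alt: "j \<in> {1..n} \<Longrightarrow> bethe m n q x j = real m * x j + (\<Sum>k\<in>{1..n}. vq q (x j - x k))"
  unfolding bethe_def by (subst (2) sum.remove[of _ j]) auto

text \<open>Strict convexity in gradient form: the scalar product of the difference of gradients
  with x - y is m |x - y|^2 plus a nonnegative term.\<close>

lemma bethe_inj:
  assumes q: "\<bar>q\<bar> < 1" and m: "m > 0" and xy: "x \<in> vecs n" "y \<in> vecs n"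
    and e: "\<And>j. j \<in> {1..n} \<Longrightarrow> bethe m n q x j = bethe m n q y j"
  shows "x = y"
proof -
  let ?I = "{1..n}"
  define d where "d j = x j - y j" for j
  define D where "D j k = vq q (x j - x k) - vq q (y j - y k)" for j k
  have anti: "D k j = - D j k" for j k
    using vq_minus[OF q, of "x j - x k"] vq_minus[OF q, of "y j - y k"] by (simp add: D_def)
  have "(\<Sum>j\<in>?I. (real m * d j + (\<Sum>k\<in>?I. D j k)) * d j) = 0"
  proof (intro sum.neutral ballI)
    fix j assume "j \<in> ?I"
    then show "(real m * d j + (\<Sum>k\<in>?I. D j k)) * d j = 0"
      using e[of j] by (simp add: bethe_alt d_def D_def sum_subtractf algebra_simps)
  qed
  then have 0: "real m * (\<Sum>j\<in>?I. (d j)\<^sup>2) + (\<Sum>j\<in>?I. \<Sum>k\<in>?I. D j k * d j) = 0"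
    by (simp add: distrib_right sum.distrib sum_distrib_left sum_distrib_right power2_eq_square mult.assoc)
  \<comment> \<open>Symmetrising in j and k gives half the sum of D_jk (d_j - d_k), nonnegative as
    \<open>vq\<close> is increasing.\<close>
  have "(\<Sum>j\<in>?I. \<Sum>k\<in>?I. D j k * d j) = (\<Sum>j\<in>?I. \<Sum>k\<in>?I. D k j * d k)" by (rule sum.swap)
  also have "\<dots> = - (\<Sum>j\<in>?I. \<Sum>k\<in>?I. D j k * d k)" by (subst anti) (simp add: sum_negf)
  finally have "2 * (\<Sum>j\<in>?I. \<Sum>k\<in>?I. D j k * d j) = (\<Sum>j\<in>?I. \<Sum>k\<in>?I. D j k * (d j - d k))"
    by (simp add: right_diff_distrib sum_subtractf)
  also have "\<dots> \<ge> 0"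
  proof (intro sum_nonneg)
    fix j k
    have dd: "d j - d k = (x j - x k) - (y j - y k)" by (simp add: d_def)
    show "0 \<le> D j k * (d j - d k)"
    proof (cases "x j - x k \<le> y j - y k")
      case True
      then show ?thesis unfolding dd using vq_mono[OF q True] by (intro mult_nonpos_nonpos) (auto simp: D_def)
    next
      case False
      then show ?thesis unfolding dd using vq_mono[OF q, of "y j - y k" "x j - x k"] by (intro mult_nonneg_nonneg) (auto simp: D_def)
    qed
  qed
  finally have "real m * (\<Sum>j\<in>?I. (d j)\<^sup>2) \<le> 0" using 0 by simp
  then have "(\<Sum>j\<in>?I. (d j)\<^sup>2) \<le> 0" using m by (simp add: mult_le_0_iff)
  then have "(\<Sum>j\<in>?I. (d j)\<^sup>2) = 0" by (intro antisym sum_nonneg) auto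
  then have "\<forall>j\<in>?I. d j = 0" by (subst (asm) sum_nonneg_eq_0_iff) auto
  then have "x j = y j" for j using xy by (cases "j \<in> ?I") (auto simp: d_def vecs_def)
  then show ?thesis by blast
qed

text \<open>Injectivity settles uniqueness in the definite description; existence is supplied by the
  given Bethe point, so only weights that come from one are covered here.\<close>

lemma node_weight_of:
  assumes q: "\<bar>q\<bar> < 1" and n: "n \<ge> 2" and m: "m > 0" and x: "x \<in> nodes m n q"
  shows "node m n q (weight_of m n q x) = x"
proof -
  have xv: "x \<in> vecs n" using x by (auto simp: nodes_def alcove_def)
  have w: "2 * pi * (weight_of m n q x j + rho n j) = bethe m n q x j" if "j \<in> {1..n}" for j
    using that by (simp add: weight_of_def)
  show ?thesis unfolding node_def bethe_def[symmetric]
  proof (rule the_equality)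
    show "x \<in> vecs n \<and> (\<forall>j\<in>{1..n}. bethe m n q x j = 2 * pi * (weight_of m n q x j + rho n j))"
      using xv w by simp
    fix y assume y: "y \<in> vecs n \<and> (\<forall>j\<in>{1..n}. bethe m n q y j = 2 * pi * (weight_of m n q x j + rho n j))"
    show "y = x" by (rule bethe_inj[OF q m]) (use y xv w in auto)
  qed
qed

lemma cis_eq_imp:
  assumes "cis a = cis b" obtains z :: int where "a - b = 2 * pi * of_int z"
proof -
  have "cis (a - b) = 1" using assms by (simp flip: cis_divide)
  then have "cos (a - b) = 1" by (simp add: complex_eq_iff)
  then obtain z :: int where "a - b = of_int z * 2 * pi" using cos_one_2pi_int by blast
  then show ?thesis using that[of z] by simp
qed

lemma sum_rho: "(\<Sum>j\<in>{1..n}. rho n j) = 0"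
proof -
  have "2 * (\<Sum>j\<in>{1..n}. real j) = real n * (real n + 1)"
    by (induction n) (auto simp: algebra_simps)
  moreover have "2 * (\<Sum>j\<in>{1..n}. rho n j) = (\<Sum>j\<in>{1..n}. real n + 1 - 2 * real j)"
    unfolding sum_distrib_left by (intro sum.cong) (auto simp: rho_def)
  moreover have "(\<Sum>j\<in>{1..n}. real n + 1 - 2 * real j) = real n * (real n + 1) - 2 * (\<Sum>j\<in>{1..n}. real j)"
    by (simp add: sum_subtractf sum_distrib_left algebra_simps)
  ultimately show ?thesis by simp
qed

text \<open>In the alcove \<open>bethe\<close> decreases strictly in j. Its gaps are integral
  multiples of 2 pi, so strict inequalities sharpen to the bounds that define \<open>Lam m n\<close>
  once \<open>rho\<close> is subtracted.\<close>

lemma weight_of_Lam: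
  assumes q: "\<bar>q\<bar> < 1" and n: "n \<ge> 2" and x: "x \<in> nodes m n q"
  shows "weight_of m n q x \<in> Lam m n"
proof -
  have n1: "n \<ge> 1" using n by simp
  let ?w = "weight_of m n q x" let ?I = "{1..n}"
  have xa: "x \<in> alcove n" and xb: "bethe_pt m n q x" using x by (auto simp: nodes_def)
  have xc: "x \<in> chamber n" and x0: "(\<Sum>j\<in>?I. x j) = 0" using xa by (auto simp: alcove_eq_chamber[OF n])
  have "(\<Sum>j\<in>?I. bethe m n q x j) = (\<Sum>j\<in>?I. of_int 1 * bethe m n q x j)" by simp
  also have "\<dots> = real m * (\<Sum>j\<in>?I. x j)" unfolding sum_bethe[OF q, of "\<lambda>_. 1"] by (simp add: sum_distrib_left case_prod_unfold)
  finally have sb: "(\<Sum>j\<in>?I. bethe m n q x j) = 0" using x0 by simp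
  have "(\<Sum>j\<in>?I. ?w j) = (\<Sum>j\<in>?I. bethe m n q x j) / (2 * pi) - (\<Sum>j\<in>?I. rho n j)"
    by (simp add: weight_of_def sum_subtractf sum_divide_distrib)
  then have s0: "(\<Sum>j\<in>?I. ?w j) = 0" using sb sum_rho by simp
  have v: "?w \<in> vecs n" by (auto simp: vecs_def weight_of_def)
  have dif: "?w j - ?w (Suc j) \<in> \<nat>" if j: "j \<in> {1..n-1}" for j
  proof -
    have jj: "j \<in> ?I" "Suc j \<in> ?I" using j by auto
    have lt: "x (Suc j) < x j" using chamberD[OF xc, of j "Suc j"] jj by auto
    have "(\<Sum>k\<in>?I. vq q (x (Suc j) - x k)) < (\<Sum>k\<in>?I. vq q (x j - x k))"
      using n lt by (intro sum_strict_mono vq_strict_mono[OF q]) auto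
    moreover have "real m * x (Suc j) \<le> real m * x j" using lt by (intro mult_left_mono) auto
    ultimately have bl: "bethe m n q x (Suc j) < bethe m n q x j" unfolding bethe_alt[OF jj(1)] bethe_alt[OF jj(2)] by linarith
    obtain z where z: "bethe m n q x j - bethe m n q x (Suc j) = 2 * pi * of_int z"
      using xb jj cis_eq_imp unfolding bethe_pt_def by metis
    then have "2 * pi * of_int z > 0" using bl by simp
    then have "z \<ge> 1" by (simp add: zero_less_mult_iff)
    have "?w j - ?w (Suc j) = (bethe m n q x j - bethe m n q x (Suc j)) / (2 * pi) - (rho n j - rho n (Suc j))"
      using jj by (simp add: weight_of_def diff_divide_distrib del: atLeastAtMost_iff)
    \<comment> \<open>The unit drop of \<open>rho\<close> uses up one of the z >= 1 periods.\<close>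
    also have "\<dots> = of_int (z - 1)" unfolding z by (simp add: rho_def field_simps)
    also have "\<dots> = of_nat (nat (z - 1))" using \<open>z \<ge> 1\<close> by simp
    finally show ?thesis by simp
  qed
  have d: "dominant n ?w" unfolding dominant_def using v s0 dif by blast
  have lev: "?w 1 - ?w n \<le> real m"
  proof -
    have jj: "1 \<in> ?I" "n \<in> ?I" using n by auto
    have x2: "x 1 < x n + 2 * pi" "x n < x 1" using chamberD[OF xc, of 1 n] n by auto
    \<comment> \<open>Each of the n phases gains less than 2 pi. Subtracting the drop n - 1 of
      \<open>rho\<close> leaves a level below m + 1, hence at most m.\<close>
    have "(\<Sum>k\<in>?I. vq q (x 1 - x k)) < (\<Sum>k\<in>?I. vq q (x n - x k) + 2 * pi)"
    proof (rule sum_strict_mono)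
      fix k
      have "vq q (x 1 - x k) < vq q ((x n - x k) + 2 * pi * of_int 1)"
        by (rule vq_strict_mono[OF q]) (use x2 in simp)
      then show "vq q (x 1 - x k) < vq q (x n - x k) + 2 * pi" unfolding vq_add_int[OF q] by simp
    qed (use n in auto)
    moreover have "real m * x 1 \<le> real m * (x n + 2 * pi)" using x2 by (intro mult_left_mono) auto
    ultimately have "bethe m n q x 1 - bethe m n q x n < 2 * pi * (real m + real n)"
      unfolding bethe_alt[OF jj(1)] bethe_alt[OF jj(2)] by (simp add: sum.distrib algebra_simps)
    then have "(bethe m n q x 1 - bethe m n q x n) / (2 * pi) < real m + real n" by (simp add: field_simps)
    moreover have "?w 1 - ?w n = (bethe m n q x 1 - bethe m n q x n) / (2 * pi) - (real n - 1)"
      using jj n by (simp add: weight_of_def rho_def diff_divide_distrib del: atLeastAtMost_iff)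
    ultimately have lt: "?w 1 - ?w n < real m + 1" by simp
    have "?w 1 - ?w n \<in> \<int>" using dominant_intdiff[OF d] jj unfolding intdiff_def by blast
    then obtain z :: int where z: "?w 1 - ?w n = of_int z" by (auto elim: Ints_cases)
    then have "real_of_int z < real_of_int (int m + 1)" using lt by simp
    then have "z \<le> int m" by linarith
    then have "real_of_int z \<le> real_of_int (int m)" by (simp only: of_int_le_iff)
    then show ?thesis using z by simp
  qed
  show ?thesis unfolding Lam_iff[OF n1] using d lev by blast
qed

lemma inj_weight_of:
  assumes "\<bar>q\<bar> < 1" "n \<ge> 2" "m > 0"
  shows "inj_on (weight_of m n q) (nodes m n q)"
  by (rule inj_on_inverseI[where g = "node m n q"]) (rule node_weight_of[OF assms])

lemma finite_nodes:
  assumes "\<bar>q\<bar> < 1" "n \<ge> 2" "m > 0"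
  shows "finite (nodes m n q)"
  using finite_imageD[OF _ inj_weight_of[OF assms]] finite_subset[OF _ finite_Lam] weight_of_Lam[OF assms(1,2)]
  by (metis image_subsetI)

subsection \<open>Existence of cubature weights\<close>

text \<open>Induction on the points: if some function separates \<open>a\<close> from the rest, it
  determines the weight of \<open>a\<close>; otherwise vanishing at \<open>a\<close> is automatic
  and its weight is 0. Only closure of \<open>V\<close> is used, no dimension.\<close>

lemma functional_eq_sum_of_evaluations:
  fixes V :: "('a \<Rightarrow> complex) set" and L :: "('a \<Rightarrow> complex) \<Rightarrow> complex"
  assumes "finite X"
    and "\<And>f g. \<lbrakk>f \<in> V; g \<in> V\<rbrakk> \<Longrightarrow> (\<lambda>x. f x + g x) \<in> V" "\<And>f c. f \<in> V \<Longrightarrow> (\<lambda>x. c * f x) \<in> V"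
    and "\<And>f g. \<lbrakk>f \<in> V; g \<in> V\<rbrakk> \<Longrightarrow> L (\<lambda>x. f x + g x) = L f + L g" "\<And>f c. f \<in> V \<Longrightarrow> L (\<lambda>x. c * f x) = c * L f"
    and "\<And>f. \<lbrakk>f \<in> V; \<And>x. x \<in> X \<Longrightarrow> f x = 0\<rbrakk> \<Longrightarrow> L f = 0"
  shows "\<exists>w. \<forall>f\<in>V. L f = (\<Sum>x\<in>X. w x * f x)"
  using assms
proof (induction X arbitrary: V)
  case empty then show ?case by auto
next
  case (insert a X)
  show ?case
  proof (cases "\<exists>g\<in>V. (\<forall>x\<in>X. g x = 0) \<and> g a \<noteq> 0")
    case True
    then obtain g0 where g0: "g0 \<in> V" "\<And>x. x \<in> X \<Longrightarrow> g0 x = 0" "g0 a \<noteq> 0" by blast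
    \<comment> \<open>A Lagrange function for \<open>a\<close>: subtracting f(a) g makes
      \<open>f\<close> vanish at \<open>a\<close> and keeps its values on \<open>X\<close>.\<close>
    define g where "g = (\<lambda>x. inverse (g0 a) * g0 x)"
    have g: "g \<in> V" "\<And>x. x \<in> X \<Longrightarrow> g x = 0" "g a = 1" 
      using insert.prems(2)[OF g0(1)] g0 by (auto simp: g_def)
    have "\<exists>w. \<forall>f\<in>{f \<in> V. f a = 0}. L f = (\<Sum>x\<in>X. w x * f x)"
    proof (rule insert.IH)
      fix f assume f: "f \<in> {f \<in> V. f a = 0}" "\<And>x. x \<in> X \<Longrightarrow> f x = 0"
      show "L f = 0" by (rule insert.prems(5)) (use f in auto)
    qed (use insert.prems in auto)
    then obtain w where w: "\<And>f. \<lbrakk>f \<in> V; f a = 0\<rbrakk> \<Longrightarrow> L f = (\<Sum>x\<in>X. w x * f x)" by blast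
    have "L f = (\<Sum>x\<in>insert a X. (w(a := L g)) x * f x)" if f: "f \<in> V" for f
    proof -
      let ?f = "\<lambda>x. f x + (- f a) * g x"
      have gV: "(\<lambda>x. (- f a) * g x) \<in> V" by (rule insert.prems(2)[OF g(1)])
      have "L ?f = (\<Sum>x\<in>X. w x * ?f x)"
        by (rule w) (use insert.prems(1)[OF f gV] g in auto)
      also have "\<dots> = (\<Sum>x\<in>X. w x * f x)" by (rule sum.cong) (use g in auto)
      finally have "L f + (- f a) * L g = (\<Sum>x\<in>X. w x * f x)"
        using insert.prems(3)[OF f gV] insert.prems(4)[OF g(1), of "- f a"] by simp
      moreover have "(\<Sum>x\<in>X. (w(a := L g)) x * f x) = (\<Sum>x\<in>X. w x * f x)"
        by (rule sum.cong) (use insert.hyps in auto)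
      ultimately show ?thesis using insert.hyps by (simp add: algebra_simps)
    qed
    then show ?thesis by blast
  next
    case False
    have "\<exists>w. \<forall>f\<in>V. L f = (\<Sum>x\<in>X. w x * f x)"
    proof (rule insert.IH[OF insert.prems(1-4)])
      fix f assume f: "f \<in> V" "\<And>x. x \<in> X \<Longrightarrow> f x = 0"
      then have "f a = 0" using False by blast
      then show "L f = 0" using insert.prems(5)[OF f(1)] f(2) by blast
    qed auto
    then obtain w where w: "\<And>f. f \<in> V \<Longrightarrow> L f = (\<Sum>x\<in>X. w x * f x)" by blast
    have "L f = (\<Sum>x\<in>insert a X. (w(a := 0)) x * f x)" if f: "f \<in> V" for f
    proof -
      have "(\<Sum>x\<in>X. (w(a := 0)) x * f x) = (\<Sum>x\<in>X. w x * f x)"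
        by (rule sum.cong) (use insert.hyps in auto)
      then show ?thesis using w[OF f] insert.hyps by simp
    qed
    then show ?thesis by blast
  qed
qed

section \<open>Reduction of Bethe points to the alcove\<close>

lemma bethe_perm:
  assumes s: "\<sigma> permutes {1..n}" and j: "j \<in> {1..n}"
  shows "bethe m n q (x \<circ> \<sigma>) j = bethe m n q x (\<sigma> j)"
proof -
  have "\<sigma> j \<in> {1..n}" using permutes_in_image[OF s] j by blast
  then show ?thesis unfolding bethe_alt[OF j] bethe_alt[OF \<open>\<sigma> j \<in> {1..n}\<close>]
    using sum_perm_eq[OF s, of "\<lambda>k. vq q (x (\<sigma> j) - x k)"] by simp
qed

lemma cis_bethe_shift:
  assumes q: "\<bar>q\<bar> < 1" and j: "j \<in> {1..n}"
  shows "cis (bethe m n q (\<lambda>i. x i + 2 * pi * of_int (k i)) j) = cis (bethe m n q x j)"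
proof (rule cis_cong_2pi)
  let ?r = "real m * of_int (k j) + (\<Sum>l\<in>{1..n}. of_int (k j - k l))"
  show "?r \<in> \<int>" by (intro Ints_add Ints_mult Ints_sum) auto
  have "vq q (x j + 2 * pi * of_int (k j) - (x l + 2 * pi * of_int (k l))) = vq q (x j - x l) + 2 * pi * of_int (k j - k l)" for l
    using vq_add_int[OF q, of "x j - x l" "k j - k l"] by (simp add: algebra_simps)
  then have "(\<Sum>l\<in>{1..n}. vq q (x j + 2 * pi * of_int (k j) - (x l + 2 * pi * of_int (k l)))) =
      (\<Sum>l\<in>{1..n}. vq q (x j - x l)) + 2 * pi * (\<Sum>l\<in>{1..n}. of_int (k j - k l))"
    by (simp only: sum.distrib sum_distrib_left)
  then show "bethe m n q (\<lambda>i. x i + 2 * pi * of_int (k i)) j = bethe m n q x j + 2 * pi * ?r"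
    unfolding bethe_alt[OF j] by (simp only:) (simp add: distrib_left mult_ac)
qed

text \<open>The kernel argument asks for vanishing at every Bethe point. On walls it is automatic;
  the others move to the alcove by a permutation and a lattice shift, which do not change
  \<open>h\<close>.\<close>

lemma admissible_tint_eq_0:
  assumes q: "\<bar>q\<bar> < 1" and n: "n \<ge> 2" and m: "m > 0" and h: "admissible m n q h"
    and van: "\<And>x. x \<in> nodes m n q \<Longrightarrow> h x = 0"
  shows "tint n h = 0"
proof (rule tint_eq_0_if_vanishes_on_bethe[OF q n _ nonres_one[OF q n m]])
  show "nonres m n q h" "continuous_on UNIV h" using h by (auto simp: admissible_def)
  fix x assume x: "x \<in> vecs n" "(\<Sum>j\<in>{1..n}. x j) = 0" "kap m n q x = 1"
  show "h x = 0"
  proof (cases "wall n x")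
    case True then show ?thesis using h by (simp add: admissible_def)
  next
    case False
    obtain \<sigma> k where s: "\<sigma> permutes {1..n}" and k: "k \<in> root_lattice n"
      and p: "(\<lambda>i. x (\<sigma> i) + 2 * pi * of_int (k i)) \<in> alcove n"
      using ex_affine_to_alcove[OF n x(1,2) False] by blast
    let ?p = "\<lambda>i. (x \<circ> \<sigma>) i + 2 * pi * of_int (k i)"
    have c: "cis (bethe m n q x j) = cis (bethe m n q x n)" if "j \<in> {1..n}" for j
    proof (cases "j = n")
      case False
      then have "j \<in> {1..n-1}" using that by auto
      then have c1: "cos (bethe m n q x j - bethe m n q x n) = 1" by (rule kap_eq_1_cos[OF x(3)])
      then obtain z :: int where "bethe m n q x j - bethe m n q x n = of_int z * 2 * pi" using cos_one_2pi_int by blast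
      then have "bethe m n q x j = bethe m n q x n + 2 * pi * of_int z" by (simp add: algebra_simps)
      then show ?thesis by (rule cis_cong_2pi) simp
    qed simp
    have "cis (bethe m n q ?p j) = cis (bethe m n q x n)" if j: "j \<in> {1..n}" for j
      unfolding cis_bethe_shift[OF q j] bethe_perm[OF s j] using c permutes_in_image[OF s] j by blast
    then have "?p \<in> nodes m n q" using p by (auto simp: nodes_def bethe_pt_def)
    then have "h ?p = 0" by (rule van)
    moreover have "h ?p = h (x \<circ> \<sigma>)"
      by (rule torusfunD(3)[OF _ k]) (use h in \<open>simp add: admissible_def nonres_def\<close>)
    moreover have "h (x \<circ> \<sigma>) = h x" using h s by (simp add: admissible_def)
    ultimately show ?thesis by simp
  qed
qed

lemma ex_cubature_weights:
  assumes q: "\<bar>q\<bar> < 1" and n: "n \<ge> 2" and m: "m > 0"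
  shows "\<exists>w. \<forall>h. admissible m n q h \<longrightarrow> tint n h = (\<Sum>x\<in>nodes m n q. w x * h x)"
proof -
  have t: "torusfun n h" if "admissible m n q h" for h using that by (simp add: admissible_def nonres_def)
  have "\<exists>w. \<forall>h\<in>{h. admissible m n q h}. tint n h = (\<Sum>x\<in>nodes m n q. w x * h x)"
    by (rule functional_eq_sum_of_evaluations[OF finite_nodes[OF assms]])
       (use admissible_add[OF q n] admissible_cmult tint_add[OF t t] tint_cmult admissible_tint_eq_0[OF assms] in auto)
  then show ?thesis by simp
qed

subsection \<open>Discrete orthogonality and the Christoffel weights\<close>

text \<open>Rotating both weights changes neither the products at the nodes nor
  \<open>delta\<close>. Enough rotations bring \<open>\<nu>\<close> below level m, where cubature is
  exact.\<close>

lemma discrete_orthogonality: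
  assumes q: "\<bar>q\<bar> < 1" and n: "n \<ge> 2" and m: "m > 0"
    and w: "\<And>h. admissible m n q h \<Longrightarrow> tint n h = (\<Sum>x\<in>nodes m n q. w x * h x)"
    and \<mu>: "\<mu> \<in> Lam m n" and \<nu>: "\<nu> \<in> Lam m n"
  shows "(\<Sum>x\<in>nodes m n q. w x * (Ah n q \<mu> x * cnj (Ah n q \<nu> x))) =
     (if \<mu> = \<nu> then of_real (fact n * (2 * pi) ^ (n-1) / delta m n q \<mu>) else 0)"
proof -
  have n1: "n \<ge> 1" using n by simp
  let ?C = "\<lambda>\<mu> \<nu>. (\<Sum>x\<in>nodes m n q. w x * (Ah n q \<mu> x * cnj (Ah n q \<nu> x))) =
     (if \<mu> = \<nu> then of_real (fact n * (2 * pi) ^ (n-1) / delta m n q \<mu>) else 0)"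
  \<comment> \<open>The product has degree at most 2m - 1, so continuous orthogonality transfers to
    the nodes.\<close>
  have base: "?C \<mu> \<nu>" if \<mu>: "\<mu> \<in> Lam m n" and \<nu>: "\<nu> \<in> Lam m n" and l: "\<nu> 1 - \<nu> n < real m" for \<mu> \<nu>
  proof -
    have d: "dominant n \<mu>" "dominant n \<nu>" and lm: "\<mu> 1 - \<mu> n \<le> real m" using \<mu> \<nu> Lam_iff[OF n1] by auto
    have "\<nu> 1 - \<nu> n \<in> \<int>" using dominant_intdiff[OF d(2)] n by (auto simp: intdiff_def)
    then obtain z :: int where z: "\<nu> 1 - \<nu> n = of_int z" by (auto elim: Ints_cases)
    then have "real_of_int z < real_of_int (int m)" using l by simp
    then have "z \<le> int m - 1" by linarith
    then have "real_of_int z \<le> real_of_int (int m - 1)" by (simp only: of_int_le_iff)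
    then have ln: "\<nu> 1 - \<nu> n \<le> real m - 1" using z by simp
    have "admissible m n q (\<lambda>x. Ah n q \<mu> x * cnj (Ah n q \<nu> x))"
    proof (rule admissible_Ah[OF q n m dominant_intdiff[OF d(1)] dominant_intdiff[OF d(2)]])
      show "\<mu> i - \<mu> j \<le> real m" if "i \<in> {1..n}" "j \<in> {1..n}" for i j
        using dominant_level[OF d(1) that] lm by simp
      show "\<nu> i - \<nu> j \<le> real m - 1" if "i \<in> {1..n}" "j \<in> {1..n}" for i j
        using dominant_level[OF d(2) that] ln by simp
    qed
    from w[OF this] show ?thesis
      using tint_Ah_orth[OF q n d] tint_Ah_norm_delta[OF q n m d(2) l] by (cases "\<mu> = \<nu>") simp_all
  qed
  have step: "?C \<mu> \<nu>" if \<mu>: "\<mu> \<in> Lam m n" and \<nu>: "\<nu> \<in> Lam m n" and c: "?C (rotw m n \<mu>) (rotw m n \<nu>)" for \<mu> \<nu>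
  proof -
    have "(\<Sum>x\<in>nodes m n q. w x * (Ah n q \<mu> x * cnj (Ah n q \<nu> x))) =
       (\<Sum>x\<in>nodes m n q. w x * (Ah n q (rotw m n \<mu>) x * cnj (Ah n q (rotw m n \<nu>) x)))"
    proof (rule sum.cong[OF refl])
      fix x assume x: "x \<in> nodes m n q"
      then have "(\<Sum>j\<in>{1..n}. x j) = 0" "bethe_pt m n q x" by (auto simp: nodes_def alcove_def)
      from Ah_rotw[OF q n this] obtain \<omega> where o: "\<omega> * cnj \<omega> = 1" "\<And>\<mu>. Ah n q (rotw m n \<mu>) x = \<omega> * Ah n q \<mu> x"
        by blast
      have "Ah n q (rotw m n \<mu>) x * cnj (Ah n q (rotw m n \<nu>) x) = (\<omega> * cnj \<omega>) * (Ah n q \<mu> x * cnj (Ah n q \<nu> x))"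
        unfolding o(2) complex_cnj_mult by (simp only: mult_ac)
      then show "w x * (Ah n q \<mu> x * cnj (Ah n q \<nu> x)) = w x * (Ah n q (rotw m n \<mu>) x * cnj (Ah n q (rotw m n \<nu>) x))"
        unfolding o(1) by simp
    qed
    also have "\<dots> = (if rotw m n \<mu> = rotw m n \<nu> then of_real (fact n * (2 * pi) ^ (n-1) / delta m n q (rotw m n \<mu>)) else 0)"
      by (rule c)
    also have "rotw m n \<mu> = rotw m n \<nu> \<longleftrightarrow> \<mu> = \<nu>"
      using rotw_inj[OF n, of \<mu> \<nu> m] \<mu> \<nu> Lam_iff[OF n1] by (auto simp: dominant_def)
    finally show ?thesis unfolding delta_rotw[OF n m] .
  qed
  \<comment> \<open>Each rotation moves a descent of \<open>\<nu>\<close> one place to the left;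
    from the first place the next rotation lowers the level below m.\<close>
  have desc: "?C \<mu> \<nu>" if "\<mu> \<in> Lam m n" "\<nu> \<in> Lam m n" "Suc t < n" "\<nu> (Suc (Suc t)) < \<nu> (Suc t)" for t \<mu> \<nu>
    using that
  proof (induction t arbitrary: \<mu> \<nu>)
    case 0
    show ?case
    proof (rule step[OF 0(1,2)], rule base[OF rotw_Lam(1)[OF n 0(1)] rotw_Lam(1)[OF n 0(2)]])
      show "rotw m n \<nu> 1 - rotw m n \<nu> n < real m"
        unfolding rotw_Lam(2)[OF n 0(2)] using 0(4) by (simp add: numeral_2_eq_2)
    qed
  next
    case (Suc t)
    have i: "Suc t \<in> {1..n-1}" "Suc (Suc t) \<in> {1..n-1}" using Suc.prems(3) by auto
    show ?case
    proof (rule step[OF Suc.prems(1,2)], rule Suc.IH[OF rotw_Lam(1)[OF n Suc.prems(1)] rotw_Lam(1)[OF n Suc.prems(2)]])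
      show "rotw m n \<nu> (Suc (Suc t)) < rotw m n \<nu> (Suc t)"
        unfolding rotw_simps(1)[OF n i(1)] rotw_simps(1)[OF n i(2)] using Suc.prems(4) by simp
    qed (use Suc.prems in auto)
  qed
  show ?thesis
  proof (cases "\<nu> 1 - \<nu> n < real m")
    case True then show ?thesis by (rule base[OF \<mu> \<nu>])
  next
    case False
    \<comment> \<open>The level is at least m > 0, so \<open>\<nu>\<close> is not constant.\<close>
    have "\<exists>k\<in>{1..<n}. \<nu> (Suc k) < \<nu> k"
    proof (rule ccontr)
      assume "\<not> ?thesis"
      then have "(\<Sum>k\<in>{1..<n}. \<nu> k - \<nu> (Suc k)) \<le> 0" by (intro sum_nonpos) force
      then show False using telescope_diffs[OF n1, of \<nu>] False m by simp
    qed
    then obtain k where k: "k \<in> {1..<n}" "\<nu> (Suc k) < \<nu> k" by blast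
    then obtain t where t: "k = Suc t" by (cases k) auto
    show ?thesis by (rule desc[OF \<mu> \<nu>, of t]) (use k t in auto)
  qed
qed

lemma left_inverse_imp_right_inverse:
  fixes a b :: "'a \<Rightarrow> 'a \<Rightarrow> complex"
  assumes S: "finite S"
    and ba: "\<And>i j. \<lbrakk>i \<in> S; j \<in> S\<rbrakk> \<Longrightarrow> (\<Sum>l\<in>S. b i l * a l j) = (if i = j then 1 else 0)"
    and i: "i \<in> S"
  shows "(\<Sum>l\<in>S. a i l * b l i) = 1"
proof -
  obtain e where e: "bij_betw e {0..<card S} S" using ex_bij_betw_nat_finite[OF S] by blast
  let ?N = "card S"
  define A where "A = mat ?N ?N (\<lambda>(r,c). a (e r) (e c))"
  define B where "B = mat ?N ?N (\<lambda>(r,c). b (e r) (e c))"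
  have AB: "A \<in> carrier_mat ?N ?N" "B \<in> carrier_mat ?N ?N" by (auto simp: A_def B_def)
  have eS: "e r \<in> S" if "r < ?N" for r using e that by (auto simp: bij_betw_def)
  have einj: "e r = e c \<longleftrightarrow> r = c" if "r < ?N" "c < ?N" for r c
    using e that by (auto simp: bij_betw_def dest: inj_onD)
  have sum_e: "(\<Sum>l\<in>{0..<?N}. f (e l)) = (\<Sum>l\<in>S. f l)" for f :: "'a \<Rightarrow> complex"
    by (rule sum.reindex_bij_betw[OF e])
  have "B * A = 1\<^sub>m ?N"
  proof (rule eq_matI)
    fix r c assume rc: "r < dim_row (1\<^sub>m ?N :: complex mat)" "c < dim_col (1\<^sub>m ?N :: complex mat)"
    then have "(B * A) $$ (r, c) = (\<Sum>l\<in>{0..<?N}. b (e r) (e l) * a (e l) (e c))"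
      by (simp add: A_def B_def scalar_prod_def)
    also have "\<dots> = (\<Sum>l\<in>S. b (e r) l * a l (e c))" by (rule sum_e)
    also have "\<dots> = (1\<^sub>m ?N) $$ (r, c)" using rc ba[OF eS eS] einj by simp
    finally show "(B * A) $$ (r, c) = (1\<^sub>m ?N) $$ (r, c)" .
  qed (auto simp: A_def B_def)
  then have 1: "A * B = 1\<^sub>m ?N" by (rule mat_mult_left_right_inverse[OF AB(2,1)])
  have "i \<in> e ` {0..<?N}" using e i by (simp only: bij_betw_def)
  then obtain r where r: "r < ?N" "e r = i" by auto
  have "(\<Sum>l\<in>S. a i l * b l i) = (\<Sum>l\<in>{0..<?N}. a (e r) (e l) * b (e l) (e r))" unfolding r(2) by (rule sum_e[symmetric])
  also have "\<dots> = (A * B) $$ (r, r)" using r by (simp add: A_def B_def scalar_prod_def)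
  also have "\<dots> = 1" unfolding 1 using r by simp
  finally show ?thesis .
qed

text \<open>A square matrix with a left inverse has no zero row, so every weight comes from a node;
  the diagonal entry of the reversed product then contains the cubature weight linearly.\<close>

lemma cubature_weight_formula:
  assumes q: "\<bar>q\<bar> < 1" and n: "n \<ge> 2" and m: "m > 0"
    and w: "\<And>h. admissible m n q h \<Longrightarrow> tint n h = (\<Sum>x\<in>nodes m n q. w x * h x)"
    and \<kappa>: "\<kappa> \<in> Lam m n"
  obtains x where "x \<in> nodes m n q" "weight_of m n q x = \<kappa>"
    "w x * of_real (\<Sum>\<mu>\<in>Lam m n. (cmod (Ah n q \<mu> x))\<^sup>2 * delta m n q \<mu>) = of_real (fact n * (2 * pi) ^ (n-1))"
proof -
  let ?\<Lambda> = "Lam m n" let ?X = "nodes m n q" let ?c = "fact n * (2 * pi) ^ (n-1) :: real"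
  let ?f = "weight_of m n q" and ?g = "node m n q"
  have gf: "?g (?f x) = x" if "x \<in> ?X" for x by (rule node_weight_of[OF q n m that])
  have fL: "?f x \<in> ?\<Lambda>" if "x \<in> ?X" for x by (rule weight_of_Lam[OF q n that])
  \<comment> \<open>Rows of weights without a node are padded with zeros, so the matrix is square
    before the number of nodes is known.\<close>
  define a where "a \<kappa> \<mu> = (if \<kappa> \<in> ?f ` ?X then Ah n q \<mu> (?g \<kappa>) else 0)" for \<kappa> \<mu>
  define b where "b \<nu> \<kappa> = of_real (delta m n q \<nu> / ?c) * (if \<kappa> \<in> ?f ` ?X then w (?g \<kappa>) * cnj (Ah n q \<nu> (?g \<kappa>)) else 0)" for \<nu> \<kappa>
  have c0: "?c > 0" by simp
  have ba: "(\<Sum>\<kappa>\<in>?\<Lambda>. b \<nu> \<kappa> * a \<kappa> \<mu>) = (if \<nu> = \<mu> then 1 else 0)" if \<nu>: "\<nu> \<in> ?\<Lambda>" and \<mu>: "\<mu> \<in> ?\<Lambda>" for \<nu> \<mu>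
  proof -
    have "(\<Sum>\<kappa>\<in>?\<Lambda>. b \<nu> \<kappa> * a \<kappa> \<mu>) = (\<Sum>\<kappa>\<in>?f ` ?X. b \<nu> \<kappa> * a \<kappa> \<mu>)"
      by (rule sum.mono_neutral_right[OF finite_Lam]) (use fL in \<open>auto simp: a_def\<close>)
    also have "\<dots> = (\<Sum>x\<in>?X. b \<nu> (?f x) * a (?f x) \<mu>)"
      by (subst sum.reindex[OF inj_weight_of[OF q n m]]) simp
    also have "\<dots> = of_real (delta m n q \<nu> / ?c) * (\<Sum>x\<in>?X. w x * (Ah n q \<mu> x * cnj (Ah n q \<nu> x)))"
      unfolding sum_distrib_left by (rule sum.cong[OF refl]) (simp add: a_def b_def gf mult_ac)
    also have "\<dots> = of_real (delta m n q \<nu> / ?c) * (if \<mu> = \<nu> then of_real (?c / delta m n q \<mu>) else 0)"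
      using discrete_orthogonality[OF q n m w \<mu> \<nu>] by simp
    also have "\<dots> = (if \<nu> = \<mu> then 1 else 0)"
      using delta_ne[OF q m, of n \<mu>] c0 by (auto simp flip: of_real_mult simp del: of_real_divide)
    finally show ?thesis .
  qed
  have one: "(\<Sum>\<mu>\<in>?\<Lambda>. a \<kappa> \<mu> * b \<mu> \<kappa>) = 1"
    by (rule left_inverse_imp_right_inverse[OF finite_Lam ba \<kappa>])
  have "\<kappa> \<in> ?f ` ?X"
  proof (rule ccontr)
    assume "\<kappa> \<notin> ?f ` ?X"
    then show False using one by (simp add: a_def)
  qed
  then obtain x where x: "x \<in> ?X" "?f x = \<kappa>" by blast
  then have g: "?g \<kappa> = x" using gf by blast
  have "1 = (\<Sum>\<mu>\<in>?\<Lambda>. of_real (1 / ?c) * (w x * of_real ((cmod (Ah n q \<mu> x))\<^sup>2 * delta m n q \<mu>)))"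
    unfolding one[symmetric]
  proof (rule sum.cong[OF refl])
    fix \<mu>
    have "a \<kappa> \<mu> * b \<mu> \<kappa> = of_real (delta m n q \<mu> / ?c) * (w x * (Ah n q \<mu> x * cnj (Ah n q \<mu> x)))"
      using \<open>\<kappa> \<in> ?f ` ?X\<close> by (simp add: a_def b_def g mult_ac)
    also have "Ah n q \<mu> x * cnj (Ah n q \<mu> x) = of_real ((cmod (Ah n q \<mu> x))\<^sup>2)"
      by (rule complex_norm_square[symmetric])
    finally show "a \<kappa> \<mu> * b \<mu> \<kappa> = of_real (1 / ?c) * (w x * of_real ((cmod (Ah n q \<mu> x))\<^sup>2 * delta m n q \<mu>))"
      by (simp add: divide_inverse mult_ac)
  qed
  also have "\<dots> = of_real (1 / ?c) * (w x * of_real (\<Sum>\<mu>\<in>?\<Lambda>. (cmod (Ah n q \<mu> x))\<^sup>2 * delta m n q \<mu>))"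
    unfolding of_real_sum sum_distrib_left ..
  finally have "of_real ?c * 1 = of_real ?c * (of_real (1 / ?c) * (w x * of_real (\<Sum>\<mu>\<in>?\<Lambda>. (cmod (Ah n q \<mu> x))\<^sup>2 * delta m n q \<mu>)))"
    by (rule arg_cong)
  also have "\<dots> = of_real (?c * (1 / ?c)) * (w x * of_real (\<Sum>\<mu>\<in>?\<Lambda>. (cmod (Ah n q \<mu> x))\<^sup>2 * delta m n q \<mu>))"
    by (simp only: of_real_mult mult.assoc)
  also have "?c * (1 / ?c) = 1" using c0 by simp
  finally show ?thesis using that[OF x] by simp
qed

section \<open>Assembling the cubature formula\<close>

lemma alcove_not_wall:
  assumes n: "n \<ge> 2" and x: "x \<in> alcove n" shows "\<not> wall n x"
proof
  assume "wall n x"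
  then obtain a b z where ab: "a \<in> {1..n}" "b \<in> {1..n}" "a \<noteq> b" "x a - x b = 2 * pi * of_int z"
    unfolding wall_def by blast
  have xc: "x \<in> chamber n" using x by (simp add: alcove_eq_chamber[OF n])
  have *: "False" if "0 < 2 * pi * of_int z" "2 * pi * of_int z < 2 * pi * 1" for z :: int
    using that by (simp add: zero_less_mult_iff)
  show False
  proof (cases "a < b")
    case True
    then show False using chamberD[OF xc, of a b] ab *[of z] by simp
  next
    case False
    have "x b - x a = 2 * pi * of_int (- z)" using ab(4) by simp
    then show False using chamberD[OF xc, of b a] ab False *[of "- z"] by simp
  qed
qed

lemma inverse_weight:
  fixes w :: complex and T C r :: real
  assumes "w * of_real T = of_real C" "T \<noteq> 0" "C \<noteq> 0"
  shows "of_real (inverse (r * T)) = w / of_real C * of_real (inverse r)"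
proof -
  have "w = of_real C / of_real T" using assms(1,2) by (simp add: field_simps)
  then show ?thesis using assms(3) by (simp add: divide_inverse)
qed

theorem mainTheorem1:
  fixes n m :: nat and q :: real and c :: "(nat \<Rightarrow> real) \<Rightarrow> complex"
  assumes "n \<ge> 2" and "m > 0" and "-1 < q" and "q < 1"
  defines "f \<equiv> (\<lambda>x. \<Sum>mu\<in>Lam (2 * m - 1) n. c mu * Msym n mu x)"
  shows "complex_of_real (1 / ((2 * pi) ^ (n - 1) * sqrt (real n))) *
           hyp_integral n (\<lambda>x. indicator (alcove n) x * f x *
                                complex_of_real (inverse ((cmod (Ca n q x))\<^sup>2)))
         = (\<Sum>lam\<in>Lam m n. f (node m n q lam) * complex_of_real (chris m n q lam))"
proof -
  note n = assms(1) and m = assms(2)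
  have n1: "n \<ge> 1" using n by simp
  have q: "\<bar>q\<bar> < 1" using assms by auto
  define P where "P = (\<Prod>p\<in>prs n. (1 + q)\<^sup>2)"
  have P0: "P \<noteq> 0" unfolding P_def using assms by (auto simp: prod_zero_iff)
  let ?C = "fact n * (2 * pi) ^ (n-1) :: real"
  have C0: "?C \<noteq> 0" by simp
  \<comment> \<open>The integrand with |C|^-2 replaced, up to the constant \<open>P\<close>, by its
    phase polynomial on the whole torus.\<close>
  define h where "h x = f x * complex_of_real (Wt n q x)" for x
  have adm: "admissible m n q h"
  proof -
    have "h = (\<lambda>x. \<Sum>mu\<in>Lam (2 * m - 1) n. c mu * (Msym n mu x * complex_of_real (Wt n q x)))"
      unfolding h_def f_def by (simp add: sum_distrib_right mult.assoc fun_eq_iff)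
    moreover have "admissible m n q \<dots>"
    proof (intro admissible_sum[OF q n] admissible_cmult admissible_Msym[OF q n m])
      fix mu assume "mu \<in> Lam (2 * m - 1) n"
      then have d: "dominant n mu" "mu 1 - mu n \<le> real (2 * m - 1)" using Lam_iff[OF n1] by auto
      show "intdiff n mu" by (rule dominant_intdiff[OF d(1)])
      show "mu i - mu j \<le> 2 * real m - 1" if "i \<in> {1..n}" "j \<in> {1..n}" for i j
        using dominant_level[OF d(1) that] d(2) m by (simp add: of_nat_diff)
    qed
    ultimately show ?thesis by simp
  qed
  obtain w where w: "\<And>h. admissible m n q h \<Longrightarrow> tint n h = (\<Sum>x\<in>nodes m n q. w x * h x)"
    using ex_cubature_weights[OF q n m] by blast
  have hC: "f x * complex_of_real (inverse ((cmod (Ca n q x))\<^sup>2)) = h x / of_real P" if "x \<in> alcove n" for x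
    using inverse_Ca(2)[OF q alcove_not_wall[OF n that]] by (simp add: h_def P_def)
  have "hyp_integral n (\<lambda>x. indicator (alcove n) x * f x * complex_of_real (inverse ((cmod (Ca n q x))\<^sup>2)))
     = of_real (sqrt (real n)) * (\<integral>y. (1 / of_real P) * (indicator (alcove n) (emb n y) *\<^sub>R h (emb n y)) \<partial>lebs n)"
  proof -
    have "indicator (alcove n) (emb n y) * f (emb n y) * complex_of_real (inverse ((cmod (Ca n q (emb n y)))\<^sup>2)) =
      (1 / of_real P) * (indicator (alcove n) (emb n y) *\<^sub>R h (emb n y))" for y
      using hC[of "emb n y"] by (cases "emb n y \<in> alcove n") (simp_all add: mult.assoc)
    then show ?thesis unfolding hyp_integral_def lebs_def by (simp only:)
  qed
  also have "\<dots> = of_real (sqrt (real n)) * ((1 / of_real P) * (\<integral>y. indicator (alcove n) (emb n y) *\<^sub>R h (emb n y) \<partial>lebs n))"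
    by (simp only: Bochner_Integration.integral_mult_right_zero)
  also have "(\<integral>y. indicator (alcove n) (emb n y) *\<^sub>R h (emb n y) \<partial>lebs n) = tint n h / of_nat (fact n)"
    using alcove_integral[OF n, of h] adm by (simp add: admissible_def nonres_def field_simps)
  finally have I: "hyp_integral n (\<lambda>x. indicator (alcove n) x * f x * complex_of_real (inverse ((cmod (Ca n q x))\<^sup>2)))
     = of_real (sqrt (real n)) * ((1 / of_real P) * (tint n h / of_nat (fact n)))" .
  have "complex_of_real (1 / ((2 * pi) ^ (n - 1) * sqrt (real n))) *
           hyp_integral n (\<lambda>x. indicator (alcove n) x * f x * complex_of_real (inverse ((cmod (Ca n q x))\<^sup>2)))
     = (1 / of_real ?C) * (1 / of_real P) * tint n h"
    unfolding I using n by (simp add: field_simps)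
  also have "\<dots> = (\<Sum>x\<in>nodes m n q. (w x / of_real ?C) * (h x / of_real P))"
    unfolding w[OF adm] sum_distrib_left by (intro sum.cong refl) simp
  also have "\<dots> = (\<Sum>lam\<in>Lam m n. f (node m n q lam) * complex_of_real (chris m n q lam))"
  proof (rule sum.reindex_bij_witness[where i = "node m n q" and j = "weight_of m n q"])
    fix x assume x: "x \<in> nodes m n q"
    show wL: "weight_of m n q x \<in> Lam m n" by (rule weight_of_Lam[OF q n x])
    show nx: "node m n q (weight_of m n q x) = x" by (rule node_weight_of[OF q n m x])
    \<comment> \<open>This yields some node of the given weight; injectivity of
      \<open>weight_of\<close> identifies it with \<open>x\<close>.\<close>
    from cubature_weight_formula[OF q n m w wL] obtain x' where
      x': "x' \<in> nodes m n q" "weight_of m n q x' = weight_of m n q x"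
      "w x' * of_real (\<Sum>\<mu>\<in>Lam m n. (cmod (Ah n q \<mu> x'))\<^sup>2 * delta m n q \<mu>) = of_real ?C" by blast
    then have "x' = x" using inj_onD[OF inj_weight_of[OF q n m]] x by blast
    let ?T = "\<Sum>\<mu>\<in>Lam m n. (cmod (Ah n q \<mu> x))\<^sup>2 * delta m n q \<mu>"
    have wT: "w x * of_real ?T = of_real ?C" using x'(3) \<open>x' = x\<close> by simp
    then have T0: "?T \<noteq> 0" using C0 by (metis mult_zero_right of_real_0 of_real_eq_iff)
    have xa: "x \<in> alcove n" using x by (simp add: nodes_def)
    note nw = alcove_not_wall[OF n xa]
    obtain K where K: "cmod K = cmod (Ca n q x)" "\<And>\<mu>. HL n q \<mu> x = K * Ah n q \<mu> x"
      using HL_eq_Ah[OF q nw] by blast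
    \<comment> \<open>The factor |K|^2 = |C|^2 leaves the Christoffel sum; its inverse is the factor
      |C|^-2 of the integrand at the node.\<close>
    have "chris m n q (weight_of m n q x) = inverse ((cmod (Ca n q x))\<^sup>2 * ?T)"
      unfolding chris_def nx K(2) norm_mult K(1) power_mult_distrib sum_distrib_left by (simp only: mult.assoc)
    also have "complex_of_real \<dots> = (w x / of_real ?C) * of_real (inverse ((cmod (Ca n q x))\<^sup>2))"
      by (rule inverse_weight[OF wT T0 C0])
    finally show "f (node m n q (weight_of m n q x)) * complex_of_real (chris m n q (weight_of m n q x)) =
      w x / of_real ?C * (h x / of_real P)"
      unfolding nx hC[OF xa, symmetric] by (simp only: mult_ac)
  next
    fix lam assume lam: "lam \<in> Lam m n"
    from cubature_weight_formula[OF q n m w lam] obtain x where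
      x: "x \<in> nodes m n q" "weight_of m n q x = lam" by blast
    have "node m n q lam = x" using node_weight_of[OF q n m x(1)] x(2) by simp
    then show "weight_of m n q (node m n q lam) = lam" "node m n q lam \<in> nodes m n q" using x by auto
  qed
  finally show ?thesis .
qed

end
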